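(* Let $F$ be a flat geodesic in $G$ and let $D$ be an arbitrary geodesic in $G$. The following are equivalent: (a) $D$ is orthogonal to $F$; (b) $D$ meets $F$ at a point $\lambda_0$ and, for some point $\mu\in D\setminus\{\lambda_0\}$, $d_G(\lambda_0,\mu)=\inf_{\lambda\in F}d_G(\lambda,\mu)$; (c) $D$ meets $F$ at a point $\lambda_0$ and, for every point $\mu\in D\setminus\{\lambda_0\}$, $d_G(\lambda_0,\mu)=\inf_{\lambda\in F}d_G(\lambda,\mu)$.
   Context: $\mathbb{D}$ is the open unit disc in $\mathbb{C}$. $G=\{(z+w,zw): |z|<1,|w|<1\}\subset\mathbb{C}^2$ is the symmetrized bidisc. For $\lambda,\mu\in G$, $d_G(\lambda,\mu)$ is the Carathéodory distance, $d_G(\lambda,\mu)=\sup_{f}\tanh^{-1}\left|\frac{f(\lambda)-f(\mu)}{1-\overline{f(\mu)}f(\lambda)}\right|$, the supremum being over all holomorphic $f:G\to\mathbb{D}$ (it is known to coincide with the Kobayashi distance on $G$). A geodesic (that is, complex geodesic) in $G$ is a set $D=h(\mathbb{D})$ where $h:\mathbb{D}\to G$ is holomorphic and has a holomorphic left inverse $\Phi:G\to\mathbb{D}$, $\Phi\circ h=\mathrm{id}_{\mathbb{D}}$. If $\lambda=h(z)\in D$, the complex tangent space is $T_\lambda D=\mathbb{C}\,h'(z)\subset\mathbb{C}^2$. The royal variety is $\mathcal{R}=\{(2z,z^2):z\in\mathbb{D}\}$. A geodesic $D$ is flat if $D^-\cap\mathcal{R}^-$ (closures in $\mathbb{C}^2$)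 consists of a single point, and that point lies in $\mathcal{R}$; equivalently (known), $D=F^\beta=\{(\beta+\bar\beta z,z):z\in\mathbb{D}\}$ for some $\beta\in\mathbb{D}$. Through every point of $G$ passes exactly one flat geodesic. Sharp direction: let $\mathrm{Orb}(\lambda)$ be the orbit of $\lambda\in G$ under the group $\mathrm{Aut}\,G$ of biholomorphic self-maps of $G$. It is known that $\mathrm{Orb}(\lambda)=\mathcal{R}$ if $\lambda\in\mathcal{R}$, and $\mathrm{Orb}(\lambda)$ is a smooth properly embedded real 3-dimensional submanifold of $G$ if $\lambda\notin\mathcal{R}$. In both cases the real tangent space to $\mathrm{Orb}(\lambda)$ at $\lambda$ contains a unique one-dimensional complex subspace of $\mathbb{C}^2$, denoted $\sharp_\lambda$. A geodesic $D$ is orthogonal to a flat geodesic $F$ if $D$ meets $F$ at a point $\lambda$ and $T_\lambda D=\sharp_\lambda$. *)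

theory Defs
  imports "HOL-Complex_Analysis.Complex_Analysis"
begin

abbreviation unit_disc :: "complex set" where
  "unit_disc \<equiv> ball 0 1"

definition sym_bidisc :: "(complex^2) set" where
  "sym_bidisc = {vector [z + w, z * w] | z w. cmod z < 1 \<and> cmod w < 1}"

definition royal_variety :: "(complex^2) set" where
  "royal_variety = {vector [2 * z, z^2] | z. z \<in> unit_disc}"

(* Holomorphy in two variables, as complex Frechet differentiability at every point;
   only meant for open S. *)
definition holomorphic2_on :: "(complex^2 \<Rightarrow> complex) \<Rightarrow> (complex^2) set \<Rightarrow> bool" where
  "holomorphic2_on f S \<longleftrightarrow>
     (\<forall>p\<in>S. \<exists>f'. (f has_derivative f') (at p within S) \<and> Vector_Spaces.linear (*s) (*) f')"

(* The supremum is that of a nonempty set of reals which is bounded above, since the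
   Caratheodory distance of a connected domain is finite. *)
definition cara_dist :: "complex^2 \<Rightarrow> complex^2 \<Rightarrow> real" where
  "cara_dist x y =
     (SUP f\<in>{f. holomorphic2_on f sym_bidisc \<and> f ` sym_bidisc \<subseteq> unit_disc}.
        artanh (cmod ((f x - f y) / (1 - cnj (f y) * f x))))"

definition geodesic_param :: "(complex \<Rightarrow> complex^2) \<Rightarrow> (complex^2) set \<Rightarrow> bool" where
  "geodesic_param h D \<longleftrightarrow>
     (\<forall>i. (\<lambda>z. h z $ i) holomorphic_on unit_disc) \<and> h ` unit_disc \<subseteq> sym_bidisc \<and>
     (\<exists>\<Phi>. holomorphic2_on \<Phi> sym_bidisc \<and> \<Phi> ` sym_bidisc \<subseteq> unit_disc \<and>
        (\<forall>z\<in>unit_disc. \<Phi> (h z) = z)) \<and>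
     D = h ` unit_disc"

definition geodesic :: "(complex^2) set \<Rightarrow> bool" where
  "geodesic D \<longleftrightarrow> (\<exists>h. geodesic_param h D)"

definition flat_geodesic :: "(complex^2) set \<Rightarrow> bool" where
  "flat_geodesic D \<longleftrightarrow>
     geodesic D \<and> (\<exists>p\<in>royal_variety. closure D \<inter> closure royal_variety = {p})"

(* The line spanned by h'(z) where h z = x. Two parametrizations of D differ by an
   automorphism of the disc, so every h contributes the same line to this union. *)
definition complex_tangent_space :: "(complex^2) set \<Rightarrow> complex^2 \<Rightarrow> (complex^2) set" where
  "complex_tangent_space D x =
     {c *s (\<chi> i. deriv (\<lambda>w. h w $ i) z) | c h z.
        geodesic_param h D \<and> z \<in> unit_disc \<and> h z = x}"

definition biholomorphic_self_map :: "(complex^2 \<Rightarrow> complex^2) \<Rightarrow> (complex^2) set \<Rightarrow> bool" where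
  "biholomorphic_self_map f S \<longleftrightarrow>
     bij_betw f S S \<and> (\<forall>i. holomorphic2_on (\<lambda>p. f p $ i) S) \<and>
     (\<forall>i. holomorphic2_on (\<lambda>p. the_inv_into S f p $ i) S)"

definition orbit_sym_bidisc :: "complex^2 \<Rightarrow> (complex^2) set" where
  "orbit_sym_bidisc x = {f x | f. biholomorphic_self_map f sym_bidisc}"

(* Velocities at x of C^1 curves in M through x: the tangent space when M is an
   embedded real submanifold. *)
definition real_tangent_space :: "(complex^2) set \<Rightarrow> complex^2 \<Rightarrow> (complex^2) set" where
  "real_tangent_space M x =
     {v. \<exists>\<gamma> e. 0 < e \<and> \<gamma> C1_differentiable_on {-e<..<e} \<and> \<gamma> ` {-e<..<e} \<subseteq> M \<and>
        \<gamma> 0 = x \<and> (\<gamma> has_vector_derivative v) (at (0::real))}"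

definition sharp :: "complex^2 \<Rightarrow> (complex^2) set" where
  "sharp x = (THE L. vec.subspace L \<and> vec.dim L = 1 \<and>
                L \<subseteq> real_tangent_space (orbit_sym_bidisc x) x)"

definition orthogonal_geodesic :: "(complex^2) set \<Rightarrow> (complex^2) set \<Rightarrow> bool" where
  "orthogonal_geodesic D F \<longleftrightarrow> (\<exists>x\<in>D \<inter> F. complex_tangent_space D x = sharp x)"

end

theory Submission
  imports Defs
begin

text \<open>
  Write sympt z w for the point (z + w, z w) of the symmetrized bidisc G. The maps z, w to m(z), m(w)
  with m an automorphism of the disc descend to automorphisms of G. One of them carries a given flat
  geodesic to the axis, the set of points (0, p), so everything may be measured there. The proof then
  rests on the functions (2 omega p - s) / (2 - omega s) with omega on the unit circle, called magic
  below: they map G to the disc, and so bound the Caratheodory distance from below. Upper bounds come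
  from the Schwarz-Pick lemma along analytic discs.

  For a point sympt b (-b) of the axis, the disc orth_disc leaves the axis in the sharp direction, and
  there are two magic functions, with opposite parameters, that both invert it up to an automorphism
  of the disc. For a point y on this disc, at parameter zeta, the two functions bound the distance
  from y to another point of the axis by the pseudohyperbolic distances of zeta to m and to -m, where
  m is nonzero. Since the larger of these always exceeds the modulus of zeta, sympt b (-b) is the unique
  nearest point on the axis. Every point sympt u v lies on such a disc: b is the hyperbolic midpoint of
  u and -v.

  Let h be a geodesic with h(0) on the axis. If h leaves in the sharp direction, comparing a left
  inverse of h with orth_disc shows that the two magic functions are extremal along h as well, so the
  estimate above applies and h(0) is nearest to every point of h. Conversely, if h(0) is nearest to a
  single further point h(z), then that point lies on the disc orth_disc through h(0). This forces
  equality in the Schwarz-Pick lemma for both magic functions along h, with the same unimodular factor.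
  Comparing the two derivatives at 0 shows that the second component of h'(0) vanishes, which is the
  sharp direction.

  Two further facts connect this with the notions in the theorem. To identify the sharp direction, the
  orbits of the full automorphism group are needed. The infinitesimal Caratheodory norm at the origin is
  an l1 norm, and that at points sympt b (-b) with b nonzero is not; so every automorphism preserves the
  royal variety. An automorphism fixing the origin then acts on the axis by a rotation, and
  consequently the orbit of a point of the axis lies in a level set of a smooth function which the
  automorphisms coming from the disc preserve. To see that every flat geodesic can be carried to the
  axis, move its royal point to the origin. A geodesic through the origin is extremal for a magic
  function; inequality for all other magic functions makes an explicit holomorphic quotient
  real-valued, hence constant. This determines the geodesic, and all geodesics found in this way, except
  the axis, have a limit point (2y, y^2) with y on the unit circle.
\<close>

section \<open>Points of the symmetrized bidisc and holomorphic functions of two variables\<close>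

(* The dollar sign denotes components of vectors throughout, not coefficients of power series. *)
no_notation fps_nth (infixl \<open>$\<close> 75)


lemma vec2_eq_iff: "(x::complex^2) = y \<longleftrightarrow> x$1 = y$1 \<and> x$2 = y$2"
  by (simp add: vec_eq_iff forall_2)

definition sympt :: "complex \<Rightarrow> complex \<Rightarrow> complex^2" where
  "sympt z w = vector [z + w, z * w]"

lemma sympt_nth [simp]: "sympt z w $ 1 = z + w" "sympt z w $ 2 = z * w"
  by (simp_all add: sympt_def vector_2)

lemma sympt_in_sym_bidisc: "cmod z < 1 \<Longrightarrow> cmod w < 1 \<Longrightarrow> sympt z w \<in> sym_bidisc"
  unfolding sym_bidisc_def sympt_def by blast

lemma sym_bidisc_cases:
  assumes "x \<in> sym_bidisc"
  obtains z w where "cmod z < 1" "cmod w < 1" "x = sympt z w"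
  using assms unfolding sym_bidisc_def sympt_def by blast

lemma royal_variety_iff: "x \<in> royal_variety \<longleftrightarrow> (\<exists>z. cmod z < 1 \<and> x = sympt z z)"
  unfolding royal_variety_def sympt_def by (auto simp: power2_eq_square)

lemma royal_variety_subset: "royal_variety \<subseteq> sym_bidisc"
  using royal_variety_iff sympt_in_sym_bidisc by auto

lemma norm_snd_less_one: "x \<in> sym_bidisc \<Longrightarrow> cmod (x$2) < 1"
  by (elim sym_bidisc_cases) (use norm_mult_less[of _ 1 _ 1] in simp)

abbreviation cform :: "complex \<Rightarrow> complex \<Rightarrow> complex^2 \<Rightarrow> complex" where
  "cform A B \<equiv> (\<lambda>v. A * v$1 + B * v$2)"

text \<open>
  Fixes the coordinate form of the complex derivative, so that the chain rule can be applied to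
  explicit coefficients.
\<close>
lemma complex_linear2_iff:
  "Vector_Spaces.linear (*s) (*) (f :: complex^2 \<Rightarrow> complex) \<longleftrightarrow> (\<exists>A B. f = (cform A B))"
proof
  assume lin: "Vector_Spaces.linear (*s) (*) f"
  have "f v = f (axis 1 1) * v$1 + f (axis 2 1) * v$2" for v
  proof -
    have "v = v$1 *s axis 1 1 + v$2 *s axis 2 1"
      by (simp add: vec2_eq_iff axis_def)
    then have "f v = f (v$1 *s axis 1 1 + v$2 *s axis 2 1)" by simp
    also have "\<dots> = v$1 * f (axis 1 1) + v$2 * f (axis 2 1)"
      using lin by (simp add: Vector_Spaces.linear_iff)
    finally show ?thesis by (simp add: mult.commute)
  qed
  then show "\<exists>A B. f = (cform A B)" by blast
next
  assume "\<exists>A B. f = (cform A B)"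
  moreover have "vector_space ((*) :: complex \<Rightarrow> complex \<Rightarrow> complex)"
    by unfold_locales (auto simp: algebra_simps)
  ultimately show "Vector_Spaces.linear (*s) (*) f"
    by (auto simp: Vector_Spaces.linear_iff algebra_simps vec.vector_space_axioms)
qed

lemma holomorphic2_on_iff:
  "holomorphic2_on f S \<longleftrightarrow>
     (\<forall>p\<in>S. \<exists>A B. (f has_derivative (cform A B)) (at p within S))"
  unfolding holomorphic2_on_def complex_linear2_iff by blast

text \<open>
  The magic functions and the components of the automorphisms coming from the disc are all
  quotients of two such functions, so a single computation covers their holomorphy.
\<close>
definition affine2 :: "complex \<Rightarrow> complex \<Rightarrow> complex \<Rightarrow> complex^2 \<Rightarrow> complex" where
  "affine2 c0 c1 c2 x = c0 + c1 * x$1 + c2 * x$2"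

lemma affine2_has_derivative:
  "(affine2 a b c has_derivative (cform b c)) (at x within S)"
  unfolding affine2_def
  by (auto intro!: derivative_eq_intros bounded_linear.has_derivative[OF bounded_linear_vec_nth])

lemma affine2_quotient_has_derivative:
  assumes "affine2 d0 d1 d2 x \<noteq> 0"
  shows "((\<lambda>x. affine2 n0 n1 n2 x / affine2 d0 d1 d2 x) has_derivative
     (\<lambda>v. (n1 * affine2 d0 d1 d2 x - d1 * affine2 n0 n1 n2 x) / (affine2 d0 d1 d2 x)^2 * v$1
        + (n2 * affine2 d0 d1 d2 x - d2 * affine2 n0 n1 n2 x) / (affine2 d0 d1 d2 x)^2 * v$2))
     (at x within S)"
  by (rule derivative_eq_intros affine2_has_derivative assms refl)+
     (use assms in \<open>auto simp: fun_eq_iff divide_simps power2_eq_square algebra_simps\<close>)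

lemma affine2_quotient_holomorphic2:
  assumes "\<And>x. x \<in> S \<Longrightarrow> affine2 d0 d1 d2 x \<noteq> 0"
  shows "holomorphic2_on (\<lambda>x. affine2 n0 n1 n2 x / affine2 d0 d1 d2 x) S"
  unfolding holomorphic2_on_iff using affine2_quotient_has_derivative assms by blast

lemma has_derivative_vec2:
  fixes h :: "'a::real_normed_vector \<Rightarrow> complex^2"
  fixes f :: "'a \<Rightarrow> complex^2"
  assumes "((\<lambda>z. h z $ 1) has_derivative (\<lambda>v. f v $ 1)) (at x within S)"
    and "((\<lambda>z. h z $ 2) has_derivative (\<lambda>v. f v $ 2)) (at x within S)"
  shows "(h has_derivative f) (at x within S)"
proof -
  have *: "y \<in> Basis \<Longrightarrow> \<exists>i c. y = axis i c \<and> c \<in> Basis" for y :: "complex^2"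
    by (auto simp: Basis_vec_def)
  show ?thesis
  proof (subst has_derivative_componentwise_within, intro ballI)
    fix y :: "complex^2" assume "y \<in> Basis"
    then obtain i c where y: "y = axis i c" using * by blast
    have "((\<lambda>z. h z $ i) has_derivative (\<lambda>v. f v $ i)) (at x within S)"
      using assms exhaust_2[of i] by auto
    then have "((\<lambda>z. h z $ i \<bullet> c) has_derivative (\<lambda>v. f v $ i \<bullet> c)) (at x within S)"
      by (rule bounded_linear.has_derivative[OF bounded_linear_inner_left])
    then show "((\<lambda>z. h z \<bullet> y) has_derivative (\<lambda>v. f v \<bullet> y)) (at x within S)"
      by (simp add: y inner_axis)
  qed
qed

lemma has_field_derivative_compose2:
  fixes h :: "complex \<Rightarrow> complex^2"
  assumes f: "(f has_derivative (cform A B)) (at (h z) within T)"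
    and h: "((\<lambda>z. h z $ 1) has_field_derivative h1) (at z within S)"
      "((\<lambda>z. h z $ 2) has_field_derivative h2) (at z within S)"
    and sub: "h ` S \<subseteq> T"
  shows "((\<lambda>z. f (h z)) has_field_derivative A * h1 + B * h2) (at z within S)"
proof -
  have "(h has_derivative (\<lambda>v. vector [h1 * v, h2 * v])) (at z within S)"
    by (rule has_derivative_vec2) (use h in \<open>simp_all add: has_field_derivative_def\<close>)
  moreover have "(f has_derivative (cform A B)) (at (h z) within h ` S)"
    using f sub by (rule has_derivative_subset)
  ultimately have "((\<lambda>z. f (h z)) has_derivative (\<lambda>v. A * (h1 * v) + B * (h2 * v))) (at z within S)"
    using has_derivative_in_compose by fastforce
  also have "(\<lambda>v. A * (h1 * v) + B * (h2 * v)) = (*) (A * h1 + B * h2)"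
    by (simp add: fun_eq_iff algebra_simps)
  finally show ?thesis
    by (simp add: has_field_derivative_def)
qed

lemma holomorphic2_on_compose:
  fixes M :: "complex^2 \<Rightarrow> complex^2"
  assumes f: "holomorphic2_on f T" and M: "\<And>i. holomorphic2_on (\<lambda>p. M p $ i) S"
    and sub: "M ` S \<subseteq> T"
  shows "holomorphic2_on (\<lambda>p. f (M p)) S"
  unfolding holomorphic2_on_iff
proof
  fix p assume p: "p \<in> S"
  obtain A B where f': "(f has_derivative (cform A B)) (at (M p) within T)"
    using f sub p unfolding holomorphic2_on_iff by blast
  obtain A1 B1 where 1: "((\<lambda>p. M p $ 1) has_derivative (cform A1 B1)) (at p within S)"
    using M[of 1] p unfolding holomorphic2_on_iff by blast
  obtain A2 B2 where 2: "((\<lambda>p. M p $ 2) has_derivative (cform A2 B2)) (at p within S)"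
    using M[of 2] p unfolding holomorphic2_on_iff by blast
  have "(M has_derivative (\<lambda>v. vector [A1 * v$1 + B1 * v$2, A2 * v$1 + B2 * v$2])) (at p within S)"
    by (rule has_derivative_vec2) (use 1 2 in simp_all)
  moreover have "(f has_derivative (cform A B)) (at (M p) within M ` S)"
    using f' sub by (rule has_derivative_subset)
  ultimately have "((\<lambda>z. f (M z)) has_derivative
      (\<lambda>v. A * (A1 * v$1 + B1 * v$2) + B * (A2 * v$1 + B2 * v$2))) (at p within S)"
    using has_derivative_in_compose by fastforce
  also have "(\<lambda>v::complex^2. A * (A1 * v$1 + B1 * v$2) + B * (A2 * v$1 + B2 * v$2)) =
      (\<lambda>v. (A * A1 + B * A2) * v$1 + (A * B1 + B * B2) * v$2)"
    by (simp add: algebra_simps)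
  finally show "\<exists>A B. ((\<lambda>z. f (M z)) has_derivative (cform A B)) (at p within S)"
    by blast
qed

section \<open>Moebius transformations of the disc and the Schwarz-Pick lemma\<close>

definition disc_shift :: "complex \<Rightarrow> complex \<Rightarrow> complex" where
  "disc_shift b z = (z - b) / (1 - cnj b * z)"

lemma disc_shift_denom_nonzero:
  assumes "cmod b < 1" "cmod z \<le> 1"
  shows "1 - cnj b * z \<noteq> 0"
proof
  assume "1 - cnj b * z = 0"
  then have "cmod (cnj b * z) = 1" by simp
  moreover have "cmod (cnj b * z) \<le> cmod b * 1"
    unfolding norm_mult using assms by (intro mult_mono) auto
  ultimately show False using assms by simp
qed

lemma disc_shift_zero [simp]: "disc_shift b 0 = - b" "disc_shift 0 z = z" "disc_shift b b = 0"
  by (simp_all add: disc_shift_def)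

lemma disc_shift_minus: "disc_shift b (- z) = - disc_shift (- b) z"
  by (simp add: disc_shift_def minus_divide_left)

lemma disc_shift_norm_identity:
  assumes "1 - cnj b * z \<noteq> 0"
  shows "1 - (cmod (disc_shift b z))^2 = (1 - (cmod b)^2) * (1 - (cmod z)^2) / (cmod (1 - cnj b * z))^2"
proof -
  have "(cmod (1 - cnj b * z))^2 - (cmod (z - b))^2 = (1 - (cmod b)^2) * (1 - (cmod z)^2)"
    by (simp only: cmod_power2) (simp add: power2_eq_square algebra_simps)
  then show ?thesis
    using assms by (simp add: disc_shift_def norm_divide power_divide field_simps)
qed

lemma disc_shift_norm_less_one:
  assumes "cmod b < 1" "cmod z < 1"
  shows "cmod (disc_shift b z) < 1"
proof -
  have "1 - cnj b * z \<noteq> 0" using disc_shift_denom_nonzero assms by simp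
  moreover have "(cmod b)^2 < 1" "(cmod z)^2 < 1" using assms by (simp_all add: abs_square_less_1)
  ultimately have "1 - (cmod (disc_shift b z))^2 > 0"
    by (simp add: disc_shift_norm_identity)
  then show ?thesis by (simp add: abs_square_less_1)
qed

lemma disc_shift_inverse:
  assumes "cmod b < 1" "cmod z < 1"
  shows "disc_shift (- b) (disc_shift b z) = z"
proof -
  have 1: "1 - cnj b * z \<noteq> 0" using disc_shift_denom_nonzero assms by simp
  have 2: "1 - cnj b * b \<noteq> 0" using disc_shift_denom_nonzero[of b b] assms by simp
  have "1 + cnj b * disc_shift b z = (1 - cnj b * b) / (1 - cnj b * z)"
    using 1 by (simp add: disc_shift_def field_simps)
  moreover have "disc_shift b z + b = z * (1 - cnj b * b) / (1 - cnj b * z)"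
    using 1 by (simp add: disc_shift_def field_simps)
  ultimately show ?thesis
    using 1 2 by (simp add: disc_shift_def [of "- b"])
qed

lemma disc_shift_norm_commute: "cmod (disc_shift b z) = cmod (disc_shift z b)"
proof -
  have "cnj (1 - cnj b * z) = 1 - cnj z * b" by simp
  then have "cmod (1 - cnj b * z) = cmod (1 - cnj z * b)" by (metis complex_mod_cnj)
  then show ?thesis by (simp add: disc_shift_def norm_divide norm_minus_commute)
qed

text \<open>
  Up to a unimodular factor, Moebius transformations of the disc carry translations to
  translations. Both the hyperbolic midpoint and the invariance of the pseudohyperbolic distance
  come from this identity.
\<close>
lemma disc_shift_compose:
  assumes "cmod u < 1" "cmod c < 1" "cmod x < 1"
  shows "disc_shift (disc_shift (- u) c) (disc_shift (- u) x)
       = (1 + u * cnj c) / (1 + cnj u * c) * disc_shift c x"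
proof -
  have n: "1 + cnj u * x \<noteq> 0" "1 + cnj u * c \<noteq> 0" "1 - cnj c * x \<noteq> 0" "1 - cnj u * u \<noteq> 0"
    using disc_shift_denom_nonzero[of "- u" x] disc_shift_denom_nonzero[of "- u" c]
      disc_shift_denom_nonzero[of c x] disc_shift_denom_nonzero[of u u] assms by auto
  have n2: "1 + u * cnj c \<noteq> 0"
    using n(2) by (metis complex_cnj_add complex_cnj_cnj complex_cnj_mult complex_cnj_one complex_cnj_zero)
  have 1: "disc_shift (- u) x - disc_shift (- u) c
      = (x - c) * (1 - cnj u * u) / ((1 + cnj u * x) * (1 + cnj u * c))"
    using n by (simp add: disc_shift_def divide_simps) (simp add: algebra_simps)
  have 2: "1 - cnj (disc_shift (- u) c) * disc_shift (- u) x
      = (1 - cnj c * x) * (1 - cnj u * u) / ((1 + u * cnj c) * (1 + cnj u * x))"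
    using n n2 by (simp add: disc_shift_def divide_simps) (simp add: algebra_simps)
  show ?thesis
    unfolding disc_shift_def[of "disc_shift (- u) c"] 1 2
    using n n2 by (simp add: disc_shift_def divide_simps)
qed

text \<open>
  After a translation of u to 0 the midpoint lies on the segment from 0 to the image w of v;
  solving a quadratic equation puts it at the fraction 1 / (1 + sqrt (1 - |w|^2)) of that segment.
\<close>
lemma hyperbolic_midpoint:
  assumes "cmod u < 1" "cmod v < 1"
  obtains b where "cmod b < 1" "disc_shift b v = - disc_shift b u"
proof -
  define w where "w = disc_shift u v"
  have w: "cmod w < 1" unfolding w_def by (rule disc_shift_norm_less_one) (use assms in auto)
  define q where "q = sqrt (1 - (cmod w)^2)"
  define t where "t = 1 / (1 + q)"
  have q: "0 < q" "(cmod w)^2 = 1 - q^2"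
    using w by (auto simp: q_def abs_square_less_1 power_le_one)
  have t: "0 < t" "t < 1" using q by (auto simp: t_def)
  have t2: "1 - t = t * (1 - t * (cmod w)^2)"
  proof -
    have t1: "t * (1 + q) = 1" using q by (simp add: t_def)
    have "t * (1 - q^2) = t * (1 + q) * (1 - q)" by (simp add: power2_eq_square algebra_simps)
    then have e: "t * (1 - q^2) = 1 - q" unfolding t1 by simp
    show ?thesis using t1 unfolding q(2) e by (simp add: algebra_simps)
  qed
  define c where "c = of_real t * w"
  have c: "cmod c < 1"
  proof -
    have "cmod c = t * cmod w" using t by (simp add: c_def norm_mult)
    also have "\<dots> \<le> 1 * cmod w" using t by (intro mult_right_mono) auto
    finally show ?thesis using w by simp
  qed
  have "disc_shift c w = c"
  proof -
    have "1 - cnj c * w \<noteq> 0" using disc_shift_denom_nonzero[of c w] c w by simp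
    moreover have "w - c = c * (1 - cnj c * w)"
    proof -
      have "cnj c * w = of_real (t * (cmod w)^2)"
        unfolding c_def using complex_norm_square[of w] by (simp add: mult_ac)
      then have "c * (1 - cnj c * w) = of_real (t * (1 - t * (cmod w)^2)) * w" by (simp add: c_def)
      also have "\<dots> = of_real (1 - t) * w" by (simp only: t2)
      also have "\<dots> = w - c" by (simp add: c_def algebra_simps)
      finally show ?thesis by simp
    qed
    ultimately show ?thesis by (simp add: disc_shift_def)
  qed
  moreover have "disc_shift (- u) w = v" unfolding w_def using assms by (rule disc_shift_inverse)
  ultimately have "disc_shift (disc_shift (- u) c) v = - disc_shift (disc_shift (- u) c) u"
    using disc_shift_compose[of u c w] disc_shift_compose[of u c 0] assms c w by simp
  moreover have "cmod (disc_shift (- u) c) < 1"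
    using assms c by (intro disc_shift_norm_less_one) auto
  ultimately show ?thesis using that by blast
qed

lemma disc_shift_has_field_derivative:
  assumes "1 - cnj b * z \<noteq> 0"
  shows "(disc_shift b has_field_derivative (1 - (cmod b)^2) / (1 - cnj b * z)^2) (at z within S)"
proof -
  have "((\<lambda>z. (z - b) / (1 - cnj b * z)) has_field_derivative
      (1 - (cmod b)^2) / (1 - cnj b * z)^2) (at z within S)"
    by (rule derivative_eq_intros refl assms)+
       (use assms in \<open>simp add: field_simps power2_eq_square complex_norm_square[symmetric]\<close>)
  then show ?thesis by (simp add: disc_shift_def [abs_def])
qed

lemma disc_shift_holomorphic_on:
  assumes "cmod b < 1"
  shows "disc_shift b holomorphic_on unit_disc"
  unfolding disc_shift_def [abs_def]
  by (intro holomorphic_intros) (use disc_shift_denom_nonzero assms in auto)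

text \<open>
  By the norm identity for Moebius transformations, the pseudohyperbolic distance from z to c is
  large when |1 - cnj c * z| is at least 1. The parallelogram law makes this true for c = m or for
  c = -m. This is the inequality behind the uniqueness of the nearest point.
\<close>
lemma disc_shift_pair_norm_less:
  assumes "cmod m < 1" "cmod z < 1" "m \<noteq> 0"
  shows "cmod z < cmod (disc_shift m z) \<or> cmod z < cmod (disc_shift (- m) z)"
proof -
  have key: "cmod z < cmod (disc_shift c z)"
    if c: "cmod c = cmod m" and one: "1 \<le> (cmod (1 - cnj c * z))^2" for c
  proof -
    have n: "1 - cnj c * z \<noteq> 0" using one by auto
    have z: "0 < 1 - (cmod z)^2" using assms by (simp add: abs_square_less_1)
    have m: "0 < 1 - (cmod m)^2" "1 - (cmod m)^2 < 1" using assms by (auto simp: abs_square_less_1)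
    have "1 - (cmod (disc_shift c z))^2
        = (1 - (cmod m)^2) * (1 - (cmod z)^2) / (cmod (1 - cnj c * z))^2"
      using disc_shift_norm_identity[OF n] c by simp
    also have "\<dots> \<le> (1 - (cmod m)^2) * (1 - (cmod z)^2) / 1"
      using one z m by (intro divide_left_mono) auto
    also have "\<dots> < 1 - (cmod z)^2" using z m by simp
    finally have "(cmod z)^2 < (cmod (disc_shift c z))^2" by simp
    then show ?thesis by (rule power_less_imp_less_base) simp
  qed
  have "(cmod (1 - cnj m * z))^2 + (cmod (1 + cnj m * z))^2 = 2 + 2 * (cmod (cnj m * z))^2"
    by (simp only: cmod_power2) (simp add: power2_eq_square algebra_simps)
  then have "1 \<le> (cmod (1 - cnj m * z))^2 \<or> 1 \<le> (cmod (1 + cnj m * z))^2"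
    using zero_le_power2[of "cmod (cnj m * z)"] by linarith
  then show ?thesis using key[of m] key[of "- m"] by auto
qed

text \<open>
  The Schwarz lemma for the function f followed by the translation of f 0 to 0. Equality at one
  further point, or in the derivative, yields a single constant c describing both the function and
  its derivative; comparing such constants for two functions is the main tool below.
\<close>
lemma schwarz_pick:
  assumes f: "f holomorphic_on unit_disc" "f ` unit_disc \<subseteq> unit_disc"
  shows "cmod z < 1 \<Longrightarrow> cmod (disc_shift (f 0) (f z)) \<le> cmod z"
    and "cmod (deriv f 0) \<le> 1 - (cmod (f 0))^2"
    and "(\<exists>z. cmod z < 1 \<and> z \<noteq> 0 \<and> cmod (disc_shift (f 0) (f z)) = cmod z)
          \<or> cmod (deriv f 0) \<ge> 1 - (cmod (f 0))^2 \<Longrightarrow>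
         \<exists>c. cmod c = 1 \<and> (\<forall>z. cmod z < 1 \<longrightarrow> disc_shift (f 0) (f z) = c * z)
           \<and> deriv f 0 = c * (1 - (cmod (f 0))^2)"
proof -
  define g where "g z = disc_shift (f 0) (f z)" for z
  have f1: "cmod (f z) < 1" if "cmod z < 1" for z
    using f(2) that by (auto simp: image_subset_iff)
  have f0: "cmod (f 0) < 1" using f1 by simp
  then have p: "0 < 1 - (cmod (f 0))^2" by (simp add: abs_square_less_1)
  have hol: "g holomorphic_on unit_disc"
    using holomorphic_on_compose_gen[OF f(1) disc_shift_holomorphic_on[OF f0] f(2)]
    by (simp add: g_def [abs_def] o_def)
  have g0: "g 0 = 0" by (simp add: g_def)
  have g1: "cmod (g z) < 1" if "cmod z < 1" for z
    unfolding g_def using f0 f1 that by (intro disc_shift_norm_less_one) auto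
  have "(f has_field_derivative deriv f 0) (at 0)"
    using f(1) by (intro holomorphic_derivI[of f unit_disc]) auto
  moreover have "(disc_shift (f 0) has_field_derivative 1 / (1 - (cmod (f 0))^2)) (at (f 0))"
  proof -
    have *: "1 - cnj (f 0) * f 0 = of_real (1 - (cmod (f 0))^2)"
      using complex_norm_square[of "f 0"] by (simp add: mult.commute)
    then have "1 - cnj (f 0) * f 0 \<noteq> 0" using p by (metis of_real_eq_0_iff less_irrefl)
    from disc_shift_has_field_derivative[OF this, of UNIV]
    have "(disc_shift (f 0) has_field_derivative
        of_real (1 - (cmod (f 0))^2) / (of_real (1 - (cmod (f 0))^2))^2) (at (f 0))"
      unfolding * by simp
    also have "of_real (1 - (cmod (f 0))^2) / (of_real (1 - (cmod (f 0))^2))^2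
        = 1 / complex_of_real (1 - (cmod (f 0))^2)"
      using p by (simp only: power2_eq_square) (simp del: of_real_diff of_real_mult)
    finally show ?thesis by simp
  qed
  ultimately have "((\<lambda>z. disc_shift (f 0) (f z)) has_field_derivative 1 / (1 - (cmod (f 0))^2) * deriv f 0) (at 0)"
    by (rule DERIV_chain2[rotated])
  then have dg: "deriv g 0 = deriv f 0 / (1 - (cmod (f 0))^2)"
    unfolding g_def by (simp add: DERIV_imp_deriv)
  have ndg: "cmod (deriv g 0) = cmod (deriv f 0) / (1 - (cmod (f 0))^2)"
  proof -
    have "complex_of_real 1 - (complex_of_real (cmod (f 0)))^2 = of_real (1 - (cmod (f 0))^2)" by simp
    then show ?thesis using p unfolding dg norm_divide
      by (metis abs_of_pos norm_of_real of_real_1)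
  qed
  note S = Schwarz_Lemma[OF hol g0 g1]
  show "cmod (disc_shift (f 0) (f z)) \<le> cmod z" if "cmod z < 1"
    using S(1)[OF _ that] by (simp add: g_def)
  show le: "cmod (deriv f 0) \<le> 1 - (cmod (f 0))^2"
    using S(2)[of 0] p unfolding ndg by (simp add: field_simps)
  assume eq: "(\<exists>z. cmod z < 1 \<and> z \<noteq> 0 \<and> cmod (disc_shift (f 0) (f z)) = cmod z)
          \<or> cmod (deriv f 0) \<ge> 1 - (cmod (f 0))^2"
  have "\<exists>\<alpha>. (\<forall>z. cmod z < 1 \<longrightarrow> g z = \<alpha> * z) \<and> cmod \<alpha> = 1"
  proof (rule S(3)[of 0])
    show "(\<exists>z. cmod z < 1 \<and> z \<noteq> 0 \<and> cmod (g z) = cmod z) \<or> cmod (deriv g 0) = 1"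
      using eq le p unfolding ndg g_def by (auto simp: field_simps)
  qed auto
  then obtain c where c: "\<And>z. cmod z < 1 \<Longrightarrow> g z = c * z" "cmod c = 1" by blast
  have "(g has_field_derivative c) (at 0)"
  proof (rule has_field_derivative_transform_within_open[where S = unit_disc])
    show "((\<lambda>z. c * z) has_field_derivative c) (at 0)" by (auto intro!: derivative_eq_intros)
  qed (use c in auto)
  then have "deriv g 0 = c" by (rule DERIV_imp_deriv)
  moreover have "complex_of_real 1 - (complex_of_real (cmod (f 0)))^2 \<noteq> 0"
    using p by (metis less_irrefl of_real_diff of_real_eq_0_iff of_real_power)
  ultimately have "deriv f 0 = c * (1 - (cmod (f 0))^2)" unfolding dg by (simp add: field_simps)
  then show "\<exists>c. cmod c = 1 \<and> (\<forall>z. cmod z < 1 \<longrightarrow> disc_shift (f 0) (f z) = c * z)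
           \<and> deriv f 0 = c * (1 - (cmod (f 0))^2)"
    using c unfolding g_def by blast
qed

section \<open>Magic functions, analytic discs and the Caratheodory distance\<close>

text \<open>
  For unimodular omega these are the functions of Agler and Young, which suffice for all lower
  bounds of the Caratheodory distance below.
\<close>
definition magic :: "complex \<Rightarrow> complex^2 \<Rightarrow> complex" where
  "magic \<omega> x = (2 * \<omega> * x$2 - x$1) / (2 - \<omega> * x$1)"

lemma magic_denom_nonzero:
  assumes "cmod \<omega> = 1" "x \<in> sym_bidisc"
  shows "2 - \<omega> * x$1 \<noteq> 0"
proof
  assume eq: "2 - \<omega> * x$1 = 0"
  from assms(2) obtain z w where "cmod z < 1" "cmod w < 1" "x = sympt z w"
    by (rule sym_bidisc_cases)
  then have "cmod (\<omega> * x$1) < 2"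
    using assms(1) norm_triangle_ineq[of z w] by (simp add: norm_mult)
  moreover have "\<omega> * x$1 = 2" using eq by simp
  ultimately show False by simp
qed

text \<open>
  With a = omega z and b = omega w and X = 1 / (1 - a) + 1 / (1 - b), the quotient becomes, up to
  a unimodular factor, (2 - X) / X. Each summand of X has real part above 1/2, so X is closer to 2
  than to 0.
\<close>
lemma magic_norm_less_one:
  assumes "cmod \<omega> = 1" "x \<in> sym_bidisc"
  shows "cmod (magic \<omega> x) < 1"
proof -
  from assms(2) obtain z w where zw: "cmod z < 1" "cmod w < 1" "x = sympt z w"
    by (rule sym_bidisc_cases)
  define a b where "a = \<omega> * z" and "b = \<omega> * w"
  have ab: "cmod a < 1" "cmod b < 1" using zw assms by (auto simp: a_def b_def norm_mult)
  have half: "1/2 < Re (1 / (1 - u))" if "cmod u < 1" for u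
  proof -
    have "Re u < 1" using complex_Re_le_cmod[of u] that by linarith
    have "(Re u)^2 + (Im u)^2 < 1"
      using that by (simp add: cmod_power2[symmetric] abs_square_less_1)
    moreover have "0 < (1 - Re u)^2 + (Im u)^2" using \<open>Re u < 1\<close> by (simp add: add_pos_nonneg)
    ultimately show ?thesis
      by (simp add: Re_divide divide_simps) (simp add: power2_eq_square algebra_simps)
  qed
  have ne: "a \<noteq> 1" "b \<noteq> 1" using ab by auto
  define X where "X = 1 / (1 - a) + 1 / (1 - b)"
  have X: "1 < Re X" using half[of a] half[of b] ab by (simp add: X_def)
  have "(cmod (X - 2))^2 < (cmod X)^2"
    using X by (simp add: cmod_power2) (simp add: power2_eq_square algebra_simps)
  then have lt: "cmod (X - 2) < cmod X" by (rule power_less_imp_less_base) simp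
  have e1: "2 - \<omega> * x$1 = X * ((1 - a) * (1 - b))"
    using ne unfolding X_def by (simp add: zw a_def[symmetric] b_def[symmetric] distrib_left divide_simps)
  have e2: "\<omega> * (2 * \<omega> * x$2 - x$1) = - (X - 2) * ((1 - a) * (1 - b))"
    using ne unfolding X_def by (simp add: divide_simps) (simp add: zw a_def b_def algebra_simps)
  have "cmod (\<omega> * (2 * \<omega> * x$2 - x$1)) < cmod (2 - \<omega> * x$1)"
    unfolding e1 e2 norm_mult using lt ne by (simp add: norm_minus_commute)
  then show ?thesis
    using assms(1) magic_denom_nonzero[OF assms] by (simp add: magic_def norm_divide norm_mult)
qed

lemma magic_has_derivative:
  assumes "cmod \<omega> = 1" "x \<in> sym_bidisc"
  shows "(magic \<omega> has_derivative
     (\<lambda>v. 2 * (\<omega>^2 * x$2 - 1) / (2 - \<omega> * x$1)^2 * v$1 + 2 * \<omega> / (2 - \<omega> * x$1) * v$2)) (at x within S)"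
proof -
  have "affine2 2 (- \<omega>) 0 x \<noteq> 0"
    using magic_denom_nonzero[OF assms] by (simp add: affine2_def)
  from affine2_quotient_has_derivative[OF this, of 0 "-1" "2 * \<omega>" S]
  have "(magic \<omega> has_derivative
      (\<lambda>v. (-1 * affine2 2 (- \<omega>) 0 x - (- \<omega>) * affine2 0 (-1) (2 * \<omega>) x) / (affine2 2 (- \<omega>) 0 x)^2 * v$1
         + (2 * \<omega> * affine2 2 (- \<omega>) 0 x - 0 * affine2 0 (-1) (2 * \<omega>) x) / (affine2 2 (- \<omega>) 0 x)^2 * v$2))
      (at x within S)"
    by (simp add: magic_def [abs_def] affine2_def [abs_def])
  then show ?thesis
  proof (rule has_derivative_eq_rhs, intro ext)
    fix v :: "complex^2"
    show "(-1 * affine2 2 (- \<omega>) 0 x - (- \<omega>) * affine2 0 (-1) (2 * \<omega>) x) / (affine2 2 (- \<omega>) 0 x)^2 * v$1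
         + (2 * \<omega> * affine2 2 (- \<omega>) 0 x - 0 * affine2 0 (-1) (2 * \<omega>) x) / (affine2 2 (- \<omega>) 0 x)^2 * v$2
       = 2 * (\<omega>^2 * x$2 - 1) / (2 - \<omega> * x$1)^2 * v$1 + 2 * \<omega> / (2 - \<omega> * x$1) * v$2"
    proof -
      have e1: "-1 * affine2 2 (- \<omega>) 0 x - (- \<omega>) * affine2 0 (-1) (2 * \<omega>) x = 2 * (\<omega>^2 * x$2 - 1)"
        by (simp add: affine2_def power2_eq_square algebra_simps)
      have e2: "affine2 2 (- \<omega>) 0 x = 2 - \<omega> * x$1" by (simp add: affine2_def)
      show ?thesis unfolding e1 unfolding e2
        using magic_denom_nonzero[OF assms] by (simp add: power2_eq_square)
    qed
  qed
qed

lemma magic_holomorphic2: "cmod \<omega> = 1 \<Longrightarrow> holomorphic2_on (magic \<omega>) sym_bidisc"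
  unfolding holomorphic2_on_iff using magic_has_derivative by blast

lemma snd_holomorphic2: "holomorphic2_on (\<lambda>x. x$2) S"
  using affine2_quotient_holomorphic2[of S 1 0 0 0 0 1] by (simp add: affine2_def)

lemma artanh_strict_mono:
  assumes "0 \<le> a" "a < b" "b < (1::real)"
  shows "artanh a < artanh b"
proof -
  have "(1 + a) / (1 - a) < (1 + b) / (1 - b)"
    using assms by (intro frac_less2) auto
  moreover have "0 < (1 + a) / (1 - a)" using assms by simp
  ultimately show ?thesis unfolding artanh_def by simp
qed

lemma artanh_le_iff:
  assumes "0 \<le> a" "a < 1" "0 \<le> b" "b < (1::real)"
  shows "artanh a \<le> artanh b \<longleftrightarrow> a \<le> b"
  using artanh_strict_mono[of a b] artanh_strict_mono[of b a] assms
  by (cases a b rule: linorder_cases) auto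

abbreviation disc_functions :: "(complex^2 \<Rightarrow> complex) set" where
  "disc_functions \<equiv> {f. holomorphic2_on f sym_bidisc \<and> f ` sym_bidisc \<subseteq> unit_disc}"

lemma disc_functions_norm: "f \<in> disc_functions \<Longrightarrow> x \<in> sym_bidisc \<Longrightarrow> cmod (f x) < 1"
  by (auto simp: image_subset_iff)

lemma magic_in_disc_functions: "cmod \<omega> = 1 \<Longrightarrow> magic \<omega> \<in> disc_functions"
  by (simp add: magic_holomorphic2 magic_norm_less_one image_subset_iff)

abbreviation velocity :: "(complex \<Rightarrow> complex^2) \<Rightarrow> 2 \<Rightarrow> complex" where
  "velocity h i \<equiv> deriv (\<lambda>z. h z $ i) 0"

definition analytic_disc :: "(complex \<Rightarrow> complex^2) \<Rightarrow> bool" where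
  "analytic_disc h \<longleftrightarrow> (\<forall>i. (\<lambda>z. h z $ i) holomorphic_on unit_disc) \<and> h ` unit_disc \<subseteq> sym_bidisc"

lemma analytic_discI:
  assumes "(\<lambda>z. h z $ 1) holomorphic_on unit_disc" "(\<lambda>z. h z $ 2) holomorphic_on unit_disc"
    and "\<And>z. cmod z < 1 \<Longrightarrow> h z \<in> sym_bidisc"
  shows "analytic_disc h"
  using assms unfolding analytic_disc_def by (auto simp: forall_2)

lemma analytic_disc_sympt:
  assumes "f holomorphic_on unit_disc" "g holomorphic_on unit_disc"
    and "\<And>z. cmod z < 1 \<Longrightarrow> cmod (f z) < 1" "\<And>z. cmod z < 1 \<Longrightarrow> cmod (g z) < 1"
  shows "analytic_disc (\<lambda>z. sympt (f z) (g z))"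
  by (rule analytic_discI)
     (use assms in \<open>auto intro!: holomorphic_intros sympt_in_sym_bidisc\<close>)

lemma analytic_disc_in: "analytic_disc h \<Longrightarrow> cmod z < 1 \<Longrightarrow> h z \<in> sym_bidisc"
  unfolding analytic_disc_def by (auto simp: image_subset_iff)

lemma analytic_disc_deriv:
  assumes "analytic_disc h" "cmod z < 1"
  shows "((\<lambda>z. h z $ i) has_field_derivative deriv (\<lambda>z. h z $ i) z) (at z)"
proof (rule holomorphic_derivI[of _ unit_disc])
  show "(\<lambda>z. h z $ i) holomorphic_on unit_disc" using assms(1) by (simp add: analytic_disc_def)
qed (use assms(2) in simp_all)

lemma compose_disc_derivative:
  assumes f: "(f has_derivative (cform A B)) (at (h z) within sym_bidisc)"
    and h: "analytic_disc h" and z: "cmod z < 1"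
  shows "((\<lambda>z. f (h z)) has_field_derivative
      A * deriv (\<lambda>z. h z $ 1) z + B * deriv (\<lambda>z. h z $ 2) z) (at z)"
proof -
  have "((\<lambda>z. f (h z)) has_field_derivative
      A * deriv (\<lambda>z. h z $ 1) z + B * deriv (\<lambda>z. h z $ 2) z) (at z within unit_disc)"
  proof (rule has_field_derivative_compose2[where f = f and h = h, OF f])
    show "((\<lambda>z. h z $ 1) has_field_derivative deriv (\<lambda>z. h z $ 1) z) (at z within unit_disc)"
      "((\<lambda>z. h z $ 2) has_field_derivative deriv (\<lambda>z. h z $ 2) z) (at z within unit_disc)"
      by (rule has_field_derivative_at_within[OF analytic_disc_deriv[OF h z]])+
    show "h ` unit_disc \<subseteq> sym_bidisc" using h unfolding analytic_disc_def by blast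
  qed
  then show ?thesis using z by (simp add: at_within_open[of z unit_disc])
qed

lemma compose_disc:
  assumes "f \<in> disc_functions" "analytic_disc h"
  shows "(\<lambda>z. f (h z)) holomorphic_on unit_disc" "(\<lambda>z. f (h z)) ` unit_disc \<subseteq> unit_disc"
proof -
  have "(\<lambda>z. f (h z)) field_differentiable (at z within unit_disc)" if z: "z \<in> unit_disc" for z
  proof -
    have "h z \<in> sym_bidisc" using z by (intro analytic_disc_in[OF assms(2)]) simp
    then obtain A B where "(f has_derivative (cform A B)) (at (h z) within sym_bidisc)"
      using assms(1) unfolding holomorphic2_on_iff by auto
    from compose_disc_derivative[where f = f and h = h, OF this assms(2)] z
    have "(\<lambda>z. f (h z)) field_differentiable (at z)" unfolding field_differentiable_def by auto
    then show ?thesis by (rule field_differentiable_at_within)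
  qed
  then show "(\<lambda>z. f (h z)) holomorphic_on unit_disc" unfolding holomorphic_on_def by blast
  show "(\<lambda>z. f (h z)) ` unit_disc \<subseteq> unit_disc"
  proof (rule image_subsetI)
    fix z :: complex assume "z \<in> unit_disc"
    then have "h z \<in> sym_bidisc" by (intro analytic_disc_in[OF assms(2)]) simp
    from disc_functions_norm[OF assms(1) this] show "f (h z) \<in> unit_disc" by simp
  qed
qed

text \<open>
  Left inverses enter the infinitesimal arguments only through this functional, which normalizes the
  velocity.
\<close>
lemma left_inverse_derivative:
  assumes h: "analytic_disc h" and \<Phi>: "\<Phi> \<in> disc_functions" "\<And>z. cmod z < 1 \<Longrightarrow> \<Phi> (h z) = z"
  obtains A B where "(\<Phi> has_derivative (cform A B)) (at (h 0) within sym_bidisc)"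
    "A * velocity h 1 + B * velocity h 2 = 1"
proof -
  obtain A B where AB: "(\<Phi> has_derivative (cform A B)) (at (h 0) within sym_bidisc)"
    using \<Phi>(1) analytic_disc_in[OF h, of 0] unfolding holomorphic2_on_iff by auto
  have "((\<lambda>z. \<Phi> (h z)) has_field_derivative A * velocity h 1 + B * velocity h 2) (at 0)"
    using compose_disc_derivative[where f = \<Phi>, OF AB h] by simp
  moreover have "((\<lambda>z. \<Phi> (h z)) has_field_derivative 1) (at 0)"
    by (rule has_field_derivative_transform_within_open[where S = unit_disc and f = "\<lambda>z. z"])
       (use \<Phi>(2) in auto)
  ultimately show ?thesis using that[OF AB] DERIV_unique by blast
qed

lemma pseudo_distance_le_disc:
  assumes "f \<in> disc_functions" "analytic_disc h" "cmod z < 1"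
  shows "cmod (disc_shift (f (h z)) (f (h 0))) \<le> cmod z"
  using schwarz_pick(1)[OF compose_disc[OF assms(1,2)] assms(3)]
  by (simp add: disc_shift_norm_commute)

text \<open>
  In the bidisc a product of two Moebius discs, with the parameter scaled to the larger of the two
  pseudohyperbolic distances, joins any two points. The only purpose is a finite upper bound for
  the distance.
\<close>
lemma product_disc_through:
  assumes "x \<in> sym_bidisc" "y \<in> sym_bidisc"
  obtains h t where "analytic_disc h" "cmod t < 1" "h 0 = x" "h t = y"
proof -
  from assms(1) obtain z w where x: "cmod z < 1" "cmod w < 1" "x = sympt z w"
    by (rule sym_bidisc_cases)
  from assms(2) obtain z' w' where y: "cmod z' < 1" "cmod w' < 1" "y = sympt z' w'"
    by (rule sym_bidisc_cases)
  define a b where "a = disc_shift z z'" and "b = disc_shift w w'"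
  have ab: "cmod a < 1" "cmod b < 1" unfolding a_def b_def
    using x y by (auto intro: disc_shift_norm_less_one)
  define t where "t = max (cmod a) (cmod b)"
  have t: "0 \<le> t" "t < 1" "cmod a \<le> t" "cmod b \<le> t" using ab by (auto simp: t_def le_max_iff_disj)
  \<comment> \<open>If t = 0 then a and b vanish, and the quotients below are 0 by the convention for division.\<close>
  define g where "g u c \<zeta> = disc_shift (- u) (c / of_real t * \<zeta>)" for u c \<zeta>
  have le: "cmod (c / of_real t * \<zeta>) < 1" if "cmod c \<le> t" "cmod \<zeta> < 1" for c \<zeta>
  proof (cases "t = 0")
    case False
    then have "cmod (c / of_real t) \<le> 1" using that t by (simp add: norm_divide)
    then have "cmod (c / of_real t) * cmod \<zeta> \<le> 1 * cmod \<zeta>" by (intro mult_right_mono) auto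
    then show ?thesis using that unfolding norm_mult by linarith
  qed auto
  have g: "g u c holomorphic_on unit_disc" "\<And>\<zeta>. cmod \<zeta> < 1 \<Longrightarrow> cmod (g u c \<zeta>) < 1"
    if "cmod u < 1" "cmod c \<le> t" for u c
  proof -
    have "disc_shift (- u) \<circ> (\<lambda>\<zeta>. c / of_real t * \<zeta>) holomorphic_on unit_disc"
      by (rule holomorphic_on_compose_gen[OF _ disc_shift_holomorphic_on])
         (use that le in \<open>auto intro!: holomorphic_intros\<close>)
    then show "g u c holomorphic_on unit_disc" by (simp add: g_def [abs_def] o_def)
    show "\<And>\<zeta>. cmod \<zeta> < 1 \<Longrightarrow> cmod (g u c \<zeta>) < 1"
      unfolding g_def using that le by (intro disc_shift_norm_less_one) auto
  qed
  have gt: "g u c (of_real t) = disc_shift (- u) c" if "cmod c \<le> t" for u c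
    using that by (cases "t = 0") (auto simp: g_def)
  have "analytic_disc (\<lambda>\<zeta>. sympt (g z a \<zeta>) (g w b \<zeta>))"
    using x t by (intro analytic_disc_sympt g) auto
  moreover have "sympt (g z a 0) (g w b 0) = x" by (simp add: g_def x)
  moreover have "sympt (g z a (of_real t)) (g w b (of_real t)) = y"
    unfolding gt[OF t(3)] gt[OF t(4)] using x y by (simp add: a_def b_def disc_shift_inverse)
  ultimately show ?thesis
    using t by (intro that[of "\<lambda>\<zeta>. sympt (g z a \<zeta>) (g w b \<zeta>)" "of_real t"]) auto
qed

text \<open>
  Finiteness of the supremum: without it the supremum would be a meaningless default value and no
  lower bound could be read off.
\<close>
lemma cara_dist_bdd:
  assumes "x \<in> sym_bidisc" "y \<in> sym_bidisc"
  shows "bdd_above ((\<lambda>f. artanh (cmod ((f x - f y) / (1 - cnj (f y) * f x)))) ` disc_functions)"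
proof -
  obtain h t where h: "analytic_disc h" "cmod t < 1" "h 0 = x" "h t = y"
    using product_disc_through[OF assms] .
  have "artanh (cmod ((f x - f y) / (1 - cnj (f y) * f x))) \<le> artanh (cmod t)"
    if "f \<in> disc_functions" for f
    using pseudo_distance_le_disc[OF that h(1,2)] h unfolding disc_shift_def
    by (subst artanh_le_iff) auto
  then show ?thesis by (rule bdd_aboveI2)
qed

lemma cara_dist_ge:
  assumes "f \<in> disc_functions" "x \<in> sym_bidisc" "y \<in> sym_bidisc"
  shows "artanh (cmod (disc_shift (f y) (f x))) \<le> cara_dist x y"
proof -
  have "artanh (cmod ((f x - f y) / (1 - cnj (f y) * f x)))
      \<in> (\<lambda>f. artanh (cmod ((f x - f y) / (1 - cnj (f y) * f x)))) ` disc_functions"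
    using assms(1) by (rule imageI)
  from cSup_upper[OF this cara_dist_bdd[OF assms(2,3)]] show ?thesis
    by (simp only: cara_dist_def disc_shift_def)
qed

lemma cara_dist_le_disc:
  assumes "analytic_disc h" "cmod z < 1"
  shows "cara_dist (h 0) (h z) \<le> artanh (cmod z)"
  unfolding cara_dist_def
proof (rule cSUP_least)
  show "disc_functions \<noteq> {}" using magic_in_disc_functions[of 1] by (metis empty_iff norm_one)
  fix f assume "f \<in> disc_functions"
  from pseudo_distance_le_disc[OF this assms] assms(2)
  show "artanh (cmod ((f (h 0) - f (h z)) / (1 - cnj (f (h z)) * f (h 0)))) \<le> artanh (cmod z)"
    unfolding disc_shift_def by (subst artanh_le_iff) auto
qed

lemma cara_dist_nonneg:
  assumes "x \<in> sym_bidisc" "y \<in> sym_bidisc"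
  shows "0 \<le> cara_dist x y"
proof -
  have "cmod (disc_shift (magic 1 y) (magic 1 x)) < 1"
    using assms by (intro disc_shift_norm_less_one magic_norm_less_one) auto
  then have "artanh 0 \<le> artanh (cmod (disc_shift (magic 1 y) (magic 1 x)))"
    by (subst artanh_le_iff) auto
  then show ?thesis using cara_dist_ge[OF magic_in_disc_functions assms, of 1] by simp
qed

section \<open>Automorphisms of the symmetrized bidisc and geodesics\<close>

text \<open>
  The automorphism of the symmetrized bidisc induced by the translation of the disc that takes b
  to 0, written in the coordinates s and p. It is a quotient of affine functions with a
  common denominator, so that holomorphy can be read off and the map extends past the boundary.
\<close>
definition sym_lift :: "complex \<Rightarrow> complex^2 \<Rightarrow> complex^2" where
  "sym_lift b x = vector
     [affine2 (- 2 * b) (1 + b * cnj b) (- 2 * cnj b) x / affine2 1 (- cnj b) ((cnj b)^2) x,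
      affine2 (b^2) (- b) 1 x / affine2 1 (- cnj b) ((cnj b)^2) x]"

lemma sym_lift_denom: "affine2 1 (- cnj b) ((cnj b)^2) (sympt z w) = (1 - cnj b * z) * (1 - cnj b * w)"
  by (simp add: affine2_def power2_eq_square algebra_simps)

lemma sym_lift_denom_nonzero:
  assumes "cmod b < 1" "x \<in> sym_bidisc"
  shows "affine2 1 (- cnj b) ((cnj b)^2) x \<noteq> 0"
  using assms(2) disc_shift_denom_nonzero[OF assms(1)]
  by (elim sym_bidisc_cases) (simp add: sym_lift_denom)

lemma sym_lift_sympt:
  assumes "cmod b < 1" "cmod z \<le> 1" "cmod w \<le> 1"
  shows "sym_lift b (sympt z w) = sympt (disc_shift b z) (disc_shift b w)"
proof -
  have n: "1 - cnj b * z \<noteq> 0" "1 - cnj b * w \<noteq> 0"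
    using disc_shift_denom_nonzero assms by auto
  have "disc_shift b z + disc_shift b w
      = ((z - b) * (1 - cnj b * w) + (w - b) * (1 - cnj b * z)) / ((1 - cnj b * z) * (1 - cnj b * w))"
    using n by (simp add: disc_shift_def add_frac_eq)
  moreover have "(z - b) * (1 - cnj b * w) + (w - b) * (1 - cnj b * z)
      = affine2 (- 2 * b) (1 + b * cnj b) (- 2 * cnj b) (sympt z w)"
    by (simp add: affine2_def algebra_simps)
  moreover have "disc_shift b z * disc_shift b w
      = affine2 (b^2) (- b) 1 (sympt z w) / ((1 - cnj b * z) * (1 - cnj b * w))"
    by (simp add: disc_shift_def affine2_def power2_eq_square algebra_simps)
  ultimately show ?thesis
    by (simp add: vec2_eq_iff sym_lift_def sym_lift_denom)
qed

lemma sym_lift_in: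
  assumes "cmod b < 1" "x \<in> sym_bidisc"
  shows "sym_lift b x \<in> sym_bidisc"
  using assms(2) by (elim sym_bidisc_cases)
    (simp add: assms(1) sym_lift_sympt sympt_in_sym_bidisc disc_shift_norm_less_one)

lemma sym_lift_inverse:
  assumes "cmod b < 1" "x \<in> sym_bidisc"
  shows "sym_lift (- b) (sym_lift b x) = x"
  using assms(2) by (elim sym_bidisc_cases)
    (simp add: assms(1) sym_lift_sympt disc_shift_norm_less_one less_imp_le disc_shift_inverse)

lemma sym_lift_holomorphic2:
  assumes "cmod b < 1"
  shows "holomorphic2_on (\<lambda>x. sym_lift b x $ i) sym_bidisc"
  using affine2_quotient_holomorphic2[OF sym_lift_denom_nonzero[OF assms]] exhaust_2[of i]
  by (auto simp: sym_lift_def)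

text \<open>
  An automorphism together with its inverse. With the inverse named, composition and
  inversion are immediate.
\<close>
definition aut_pair :: "(complex^2 \<Rightarrow> complex^2) \<Rightarrow> (complex^2 \<Rightarrow> complex^2) \<Rightarrow> bool" where
  "aut_pair f g \<longleftrightarrow>
     (\<forall>i. holomorphic2_on (\<lambda>p. f p $ i) sym_bidisc) \<and> (\<forall>i. holomorphic2_on (\<lambda>p. g p $ i) sym_bidisc) \<and>
     f ` sym_bidisc \<subseteq> sym_bidisc \<and> g ` sym_bidisc \<subseteq> sym_bidisc \<and>
     (\<forall>x\<in>sym_bidisc. g (f x) = x) \<and> (\<forall>x\<in>sym_bidisc. f (g x) = x)"

lemma aut_pair_sym_lift: "cmod b < 1 \<Longrightarrow> aut_pair (sym_lift b) (sym_lift (- b))"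
  unfolding aut_pair_def
  using sym_lift_inverse[of "- b"]
  by (simp add: sym_lift_holomorphic2 sym_lift_in sym_lift_inverse image_subset_iff)

lemma aut_pair_commute: "aut_pair f g \<Longrightarrow> aut_pair g f"
  unfolding aut_pair_def by auto

lemma aut_pair_in: "aut_pair f g \<Longrightarrow> x \<in> sym_bidisc \<Longrightarrow> f x \<in> sym_bidisc"
  unfolding aut_pair_def by auto

lemma aut_pair_inverse: "aut_pair f g \<Longrightarrow> x \<in> sym_bidisc \<Longrightarrow> g (f x) = x"
  unfolding aut_pair_def by auto

lemma aut_pair_compose:
  assumes "aut_pair f g" "aut_pair k l"
  shows "aut_pair (\<lambda>x. k (f x)) (\<lambda>x. g (l x))"
proof -
  have "holomorphic2_on (\<lambda>p. k (f p) $ i) sym_bidisc" for i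
    using holomorphic2_on_compose[of "\<lambda>x. k x $ i" sym_bidisc f sym_bidisc] assms
    by (simp add: aut_pair_def)
  moreover have "holomorphic2_on (\<lambda>p. g (l p) $ i) sym_bidisc" for i
    using holomorphic2_on_compose[of "\<lambda>x. g x $ i" sym_bidisc l sym_bidisc] assms
    by (simp add: aut_pair_def)
  moreover have "(\<lambda>x. k (f x)) ` sym_bidisc \<subseteq> sym_bidisc" "(\<lambda>x. g (l x)) ` sym_bidisc \<subseteq> sym_bidisc"
    using assms by (auto simp: aut_pair_def image_subset_iff)
  moreover have "\<forall>x\<in>sym_bidisc. g (l (k (f x))) = x" "\<forall>x\<in>sym_bidisc. k (f (g (l x))) = x"
    using assms by (auto simp: aut_pair_def image_subset_iff)
  ultimately show ?thesis unfolding aut_pair_def by blast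
qed

lemma holomorphic2_on_cong:
  assumes "holomorphic2_on g S" "\<And>x. x \<in> S \<Longrightarrow> f x = g x"
  shows "holomorphic2_on f S"
  unfolding holomorphic2_on_def
proof
  fix p assume p: "p \<in> S"
  then obtain f' where f': "(g has_derivative f') (at p within S)" "Vector_Spaces.linear (*s) (*) f'"
    using assms(1) unfolding holomorphic2_on_def by blast
  from has_derivative_transform[OF p assms(2) f'(1)] f'(2)
  show "\<exists>f'. (f has_derivative f') (at p within S) \<and> Vector_Spaces.linear (*s) (*) f'" by blast
qed

lemma biholomorphic_self_map_iff:
  "biholomorphic_self_map f sym_bidisc \<longleftrightarrow> (\<exists>g. aut_pair f g)"
proof
  assume b: "biholomorphic_self_map f sym_bidisc"
  then have bij: "bij_betw f sym_bidisc sym_bidisc" by (simp add: biholomorphic_self_map_def)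
  then have inj: "inj_on f sym_bidisc" and im: "f ` sym_bidisc = sym_bidisc"
    by (auto simp: bij_betw_def)
  have "aut_pair f (the_inv_into sym_bidisc f)"
    unfolding aut_pair_def using b im the_inv_into_f_f[OF inj] f_the_inv_into_f[OF inj]
      the_inv_into_into[OF inj]
    by (auto simp: biholomorphic_self_map_def)
  then show "\<exists>g. aut_pair f g" by blast
next
  assume "\<exists>g. aut_pair f g"
  then obtain g where fg: "aut_pair f g" by blast
  have bij: "bij_betw f sym_bidisc sym_bidisc"
    using fg unfolding aut_pair_def by (intro bij_betw_byWitness[where f' = g]) auto
  then have inj: "inj_on f sym_bidisc" by (auto simp: bij_betw_def)
  have inv: "the_inv_into sym_bidisc f x = g x" if "x \<in> sym_bidisc" for x
    using that fg by (intro the_inv_into_f_eq[OF inj]) (auto simp: aut_pair_def)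
  have "holomorphic2_on (\<lambda>p. the_inv_into sym_bidisc f p $ i) sym_bidisc" for i
  proof -
    have "holomorphic2_on (\<lambda>p. g p $ i) sym_bidisc" using fg by (simp add: aut_pair_def)
    then show ?thesis by (rule holomorphic2_on_cong) (simp add: inv)
  qed
  then show "biholomorphic_self_map f sym_bidisc"
    using bij fg unfolding biholomorphic_self_map_def aut_pair_def by blast
qed

lemma disc_functions_compose:
  assumes "f \<in> disc_functions" "aut_pair M N"
  shows "(\<lambda>x. f (M x)) \<in> disc_functions"
proof -
  have "holomorphic2_on (\<lambda>x. f (M x)) sym_bidisc"
    by (rule holomorphic2_on_compose[of f sym_bidisc]) (use assms in \<open>auto simp: aut_pair_def\<close>)
  moreover have "(\<lambda>x. f (M x)) ` sym_bidisc \<subseteq> unit_disc"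
    using assms by (auto simp: aut_pair_def image_subset_iff)
  ultimately show ?thesis by simp
qed

lemma cara_dist_aut:
  assumes M: "aut_pair M N" and x: "x \<in> sym_bidisc" and y: "y \<in> sym_bidisc"
  shows "cara_dist (M x) (M y) = cara_dist x y"
proof -
  let ?d = "\<lambda>a b :: complex. artanh (cmod ((a - b) / (1 - cnj b * a)))"
  have "(\<lambda>f. ?d (f (M x)) (f (M y))) ` disc_functions = (\<lambda>f. ?d (f x) (f y)) ` disc_functions"
  proof (intro equalityI image_subsetI)
    fix f assume "f \<in> disc_functions"
    from disc_functions_compose[OF this M]
    show "?d (f (M x)) (f (M y)) \<in> (\<lambda>f. ?d (f x) (f y)) ` disc_functions"
      by (rule image_eqI[rotated]) simp
  next
    fix f assume "f \<in> disc_functions"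
    from disc_functions_compose[OF this aut_pair_commute[OF M]]
    show "?d (f x) (f y) \<in> (\<lambda>f. ?d (f (M x)) (f (M y))) ` disc_functions"
      by (rule image_eqI[rotated]) (simp add: aut_pair_inverse[OF M] x y)
  qed
  then show ?thesis unfolding cara_dist_def by simp
qed

lemma analytic_disc_compose:
  assumes h: "analytic_disc h" and M: "aut_pair M N"
  shows "analytic_disc (\<lambda>z. M (h z))"
  unfolding analytic_disc_def
proof (intro conjI allI)
  fix i
  show "(\<lambda>z. M (h z) $ i) holomorphic_on unit_disc"
    unfolding holomorphic_on_def
  proof
    fix z :: complex assume "z \<in> unit_disc"
    then have z: "cmod z < 1" by simp
    obtain A B where "((\<lambda>p. M p $ i) has_derivative (cform A B)) (at (h z) within sym_bidisc)"
      using M analytic_disc_in[OF h z] unfolding aut_pair_def holomorphic2_on_iff by blast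
    from compose_disc_derivative[where f = "\<lambda>p. M p $ i", OF this h z]
    have "(\<lambda>z. M (h z) $ i) field_differentiable (at z)" unfolding field_differentiable_def by auto
    then show "(\<lambda>z. M (h z) $ i) field_differentiable (at z within unit_disc)"
      by (rule field_differentiable_at_within)
  qed
next
  show "(\<lambda>z. M (h z)) ` unit_disc \<subseteq> sym_bidisc"
    using analytic_disc_in[OF h] aut_pair_in[OF M] by auto
qed

lemma geodesic_param_iff:
  "geodesic_param h D \<longleftrightarrow> analytic_disc h \<and> D = h ` unit_disc \<and>
     (\<exists>\<Phi>\<in>disc_functions. \<forall>z. cmod z < 1 \<longrightarrow> \<Phi> (h z) = z)"
  unfolding geodesic_param_def analytic_disc_def by auto

lemma geodesic_param_compose:
  assumes "geodesic_param h D" "aut_pair M N"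
  shows "geodesic_param (\<lambda>z. M (h z)) (M ` D)"
proof -
  obtain \<Phi> where \<Phi>: "\<Phi> \<in> disc_functions" "\<And>z. cmod z < 1 \<Longrightarrow> \<Phi> (h z) = z"
    and h: "analytic_disc h" "D = h ` unit_disc"
    using assms(1) unfolding geodesic_param_iff by blast
  have "(\<lambda>x. \<Phi> (N x)) \<in> disc_functions"
    using \<Phi>(1) aut_pair_commute[OF assms(2)] by (rule disc_functions_compose)
  moreover have "\<forall>z. cmod z < 1 \<longrightarrow> \<Phi> (N (M (h z))) = z"
    using \<Phi>(2) aut_pair_inverse[OF assms(2)] analytic_disc_in[OF h(1)] by simp
  moreover have "M ` D = (\<lambda>z. M (h z)) ` unit_disc" by (simp add: h(2) image_image)
  ultimately show ?thesis
    using analytic_disc_compose[OF h(1) assms(2)] by (auto simp: geodesic_param_iff)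
qed

text \<open>
  Reparametrization places a given point of the geodesic at parameter 0, where the Schwarz-Pick
  lemma is stated.
\<close>
lemma geodesic_param_reparam:
  assumes "geodesic_param h D" "cmod b < 1"
  shows "geodesic_param (\<lambda>z. h (disc_shift (- b) z)) D"
proof -
  obtain \<Phi> where \<Phi>: "\<Phi> \<in> disc_functions" "\<And>z. cmod z < 1 \<Longrightarrow> \<Phi> (h z) = z"
    and h: "analytic_disc h" "D = h ` unit_disc"
    using assms(1) unfolding geodesic_param_iff by blast
  have b: "cmod (- b) < 1" using assms(2) by simp
  have into: "cmod (disc_shift (- b) z) < 1" "cmod (disc_shift b z) < 1" if "cmod z < 1" for z
    using that assms(2) by (auto intro: disc_shift_norm_less_one)
  have inv: "disc_shift (- b) (disc_shift b z) = z" "disc_shift b (disc_shift (- b) z) = z" if "cmod z < 1" for z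
    using disc_shift_inverse[of b z] disc_shift_inverse[of "- b" z] that assms(2) by auto
  have "analytic_disc (\<lambda>z. h (disc_shift (- b) z))"
    unfolding analytic_disc_def
  proof (intro conjI allI)
    fix i
    show "(\<lambda>z. h (disc_shift (- b) z) $ i) holomorphic_on unit_disc"
    proof -
      have "(\<lambda>z. h z $ i) holomorphic_on unit_disc" using h(1) by (simp add: analytic_disc_def)
      moreover have "disc_shift (- b) ` unit_disc \<subseteq> unit_disc" using into by auto
      ultimately show ?thesis
        using holomorphic_on_compose_gen[OF disc_shift_holomorphic_on[OF b], of "\<lambda>z. h z $ i" unit_disc]
        by (simp add: o_def)
    qed
    show "(\<lambda>z. h (disc_shift (- b) z)) ` unit_disc \<subseteq> sym_bidisc"
      using analytic_disc_in[OF h(1)] into by auto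
  qed
  moreover have "h ` unit_disc = (\<lambda>z. h (disc_shift (- b) z)) ` unit_disc"
  proof (intro equalityI image_subsetI)
    fix z :: complex assume "z \<in> unit_disc"
    then show "h z \<in> (\<lambda>z. h (disc_shift (- b) z)) ` unit_disc"
      using into inv by (intro image_eqI[of _ _ "disc_shift b z"]) auto
  qed (use into in auto)
  moreover have "(\<lambda>x. disc_shift b (\<Phi> x)) \<in> disc_functions"
  proof -
    have "(\<lambda>x. disc_shift b (\<Phi> x)) ` sym_bidisc \<subseteq> unit_disc"
      using into disc_functions_norm[OF \<Phi>(1)] by auto
    moreover have "holomorphic2_on (\<lambda>x. disc_shift b (\<Phi> x)) sym_bidisc"
      unfolding holomorphic2_on_iff
    proof
      fix x :: "complex^2" assume x: "x \<in> sym_bidisc"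
      obtain A B where d: "(\<Phi> has_derivative (cform A B)) (at x within sym_bidisc)"
        using \<Phi>(1) x unfolding holomorphic2_on_iff by auto
      have "1 - cnj b * \<Phi> x \<noteq> 0"
        using disc_functions_norm[OF \<Phi>(1) x] assms(2) by (intro disc_shift_denom_nonzero) auto
      from disc_shift_has_field_derivative[OF this, of UNIV] obtain c
        where "(disc_shift b has_derivative (*) c) (at (\<Phi> x))" by (auto simp: has_field_derivative_def)
      from has_derivative_compose[OF d this]
      have "((\<lambda>x. disc_shift b (\<Phi> x)) has_derivative (\<lambda>v. c * (A * v$1 + B * v$2))) (at x within sym_bidisc)" .
      also have "(\<lambda>v::complex^2. c * (A * v$1 + B * v$2)) = (\<lambda>v. (c * A) * v$1 + (c * B) * v$2)"
        by (simp add: algebra_simps)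
      finally show "\<exists>A B. ((\<lambda>x. disc_shift b (\<Phi> x)) has_derivative (cform A B)) (at x within sym_bidisc)"
        by blast
    qed
    ultimately show ?thesis by simp
  qed
  moreover have "\<forall>z. cmod z < 1 \<longrightarrow> disc_shift b (\<Phi> (h (disc_shift (- b) z))) = z"
    using \<Phi>(2) into inv by simp
  ultimately show ?thesis
    unfolding geodesic_param_iff h(2) by (intro conjI bexI[of _ "\<lambda>x. disc_shift b (\<Phi> x)"])
qed

lemma geodesic_through:
  assumes "geodesic D" "x \<in> D"
  obtains h \<Phi> where "analytic_disc h" "\<Phi> \<in> disc_functions" "\<And>z. cmod z < 1 \<Longrightarrow> \<Phi> (h z) = z"
    "D = h ` unit_disc" "h 0 = x"
proof -
  obtain h where h: "geodesic_param h D" using assms(1) unfolding geodesic_def by blast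
  then have "D = h ` unit_disc" by (simp add: geodesic_param_iff)
  then obtain b where b: "cmod b < 1" "x = h b" using assms(2) by auto
  from geodesic_param_reparam[OF h b(1)] obtain \<Phi> where
    "analytic_disc (\<lambda>z. h (disc_shift (- b) z))" "D = (\<lambda>z. h (disc_shift (- b) z)) ` unit_disc"
    "\<Phi> \<in> disc_functions" "\<And>z. cmod z < 1 \<Longrightarrow> \<Phi> (h (disc_shift (- b) z)) = z"
    unfolding geodesic_param_iff by blast
  with b show ?thesis by (intro that[of "\<lambda>z. h (disc_shift (- b) z)" \<Phi>]) auto
qed

text \<open>
  A left inverse attains the upper bound given by the disc itself.
\<close>
lemma cara_dist_geodesic:
  assumes h: "analytic_disc h" and \<Phi>: "\<Phi> \<in> disc_functions" "\<And>z. cmod z < 1 \<Longrightarrow> \<Phi> (h z) = z"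
    and z: "cmod z < 1"
  shows "cara_dist (h 0) (h z) = artanh (cmod z)"
proof (rule antisym)
  show "cara_dist (h 0) (h z) \<le> artanh (cmod z)" by (rule cara_dist_le_disc[OF h z])
  show "artanh (cmod z) \<le> cara_dist (h 0) (h z)"
    using cara_dist_ge[OF \<Phi>(1) analytic_disc_in[OF h, of 0] analytic_disc_in[OF h z]] \<Phi>(2) z by simp
qed

section \<open>Nearest points on the axis\<close>

text \<open>
  The flat geodesic through the origin, to which all others will be carried.
\<close>
definition flat_axis :: "(complex^2) set" where
  "flat_axis = {x \<in> sym_bidisc. x$1 = 0}"

lemma sympt_minus_in_flat_axis: "cmod b < 1 \<Longrightarrow> sympt b (- b) \<in> flat_axis"
  by (simp add: flat_axis_def sympt_in_sym_bidisc)

lemma flat_axis_cases: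
  assumes "x \<in> flat_axis"
  obtains b where "cmod b < 1" "x = sympt b (- b)"
proof -
  obtain z w where "cmod z < 1" "cmod w < 1" "x = sympt z w" "z + w = 0"
    using assms unfolding flat_axis_def by (auto elim!: sym_bidisc_cases)
  then show ?thesis using that[of z] by (simp add: add_eq_0_iff)
qed

lemma flat_axis_subset: "flat_axis \<subseteq> sym_bidisc"
  by (auto simp: flat_axis_def)

lemma magic_flat_axis: "x \<in> flat_axis \<Longrightarrow> magic \<omega> x = \<omega> * x$2"
  by (simp add: flat_axis_def magic_def)

text \<open>
  The parameters omega and -omega with omega b nonnegative are those whose magic functions are
  extremal, at the point sympt b (-b), in the direction of the first coordinate.
\<close>
definition aligned :: "complex \<Rightarrow> complex \<Rightarrow> bool" where
  "aligned \<omega> b \<longleftrightarrow> cmod \<omega> = 1 \<and> \<omega> * b = of_real (cmod b)"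

lemma aligned_exists: obtains \<omega> where "aligned \<omega> b"
proof (cases "b = 0")
  case True
  then show ?thesis using that[of 1] by (simp add: aligned_def)
next
  case False
  then have "aligned (of_real (cmod b) / b) b" by (simp add: aligned_def norm_divide)
  then show ?thesis using that by blast
qed

text \<open>
  The geodesic through sympt b (-b) orthogonal to the axis. Its two roots are translates of -z to
  the points b and -b; at parameter z it is therefore the point sympt u v for which b is the
  midpoint of u and -v.
\<close>
definition orth_disc :: "complex \<Rightarrow> complex \<Rightarrow> complex^2" where
  "orth_disc b z = sympt (disc_shift (- b) (- z)) (disc_shift b (- z))"

lemma orth_disc_zero: "orth_disc b 0 = sympt b (- b)"
  by (simp add: orth_disc_def)

lemma orth_disc_analytic: "cmod b < 1 \<Longrightarrow> analytic_disc (orth_disc b)"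
proof -
  assume b: "cmod b < 1"
  have "disc_shift c \<circ> uminus holomorphic_on unit_disc" if "cmod c < 1" for c
    by (rule holomorphic_on_compose_gen[OF _ disc_shift_holomorphic_on[OF that]])
       (auto intro!: holomorphic_intros)
  from this[of b] this[of "- b"] b
  have "analytic_disc (\<lambda>z. sympt (disc_shift (- b) (- z)) (disc_shift b (- z)))"
    by (intro analytic_disc_sympt) (auto simp: o_def intro: disc_shift_norm_less_one)
  then show ?thesis by (simp add: orth_disc_def [abs_def])
qed

lemma orth_disc_deriv:
  assumes "cmod b < 1"
  shows "deriv (\<lambda>z. orth_disc b z $ 1) 0 = - 2 * (1 - (cmod b)^2)"
    and "deriv (\<lambda>z. orth_disc b z $ 2) 0 = 0"
proof -
  have d: "((\<lambda>z. disc_shift c (- z)) has_field_derivative - (1 - (cmod c)^2)) (at 0)" for c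
  proof -
    have "(disc_shift c has_field_derivative (1 - (cmod c)^2)) (at (- 0))"
      using disc_shift_has_field_derivative[of c 0 UNIV] by simp
    from DERIV_chain2[where f = "disc_shift c" and g = uminus, OF this DERIV_minus[OF DERIV_ident]]
    show ?thesis by simp
  qed
  have "((\<lambda>z. disc_shift (- b) (- z) + disc_shift b (- z)) has_field_derivative - 2 * (1 - (cmod b)^2)) (at 0)"
    by (rule derivative_eq_intros d refl)+ simp
  then show "deriv (\<lambda>z. orth_disc b z $ 1) 0 = - 2 * (1 - (cmod b)^2)"
    by (simp add: orth_disc_def DERIV_imp_deriv)
  have "((\<lambda>z. disc_shift (- b) (- z) * disc_shift b (- z)) has_field_derivative 0) (at 0)"
    by (rule derivative_eq_intros d refl)+ (simp add: algebra_simps)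
  then show "deriv (\<lambda>z. orth_disc b z $ 2) 0 = 0"
    by (simp add: orth_disc_def DERIV_imp_deriv)
qed

text \<open>
  Numerator and denominator of the magic function along the disc share the factor 1 + omega z;
  this is where the choice of omega is used. What remains is a translation of the disc.
\<close>
lemma magic_orth_disc_plus:
  assumes b: "cmod b < 1" and \<omega>: "aligned \<omega> b" and z: "cmod z < 1"
  shows "magic \<omega> (orth_disc b z) = disc_shift (of_real (cmod b) * b) z"
proof -
  define r where "r = complex_of_real (cmod b)"
  have wc: "\<omega> * cnj \<omega> = 1" using \<omega> by (simp add: aligned_def complex_norm_square[symmetric])
  have wb: "\<omega> * b = r" using \<omega> by (simp add: aligned_def r_def)
  have bb: "b * cnj b = r^2" unfolding r_def by (simp only: complex_norm_square[symmetric] of_real_power)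
  have cr: "cnj r = r" by (simp add: r_def)
  have b': "b = r * cnj \<omega>" using wb wc by (metis mult.commute mult.left_commute mult_1_right)
  have cb: "cnj b = r * \<omega>" by (simp add: b' cr)
  have n: "1 + cnj b * z \<noteq> 0" "1 - cnj b * z \<noteq> 0" "1 - cnj (r * b) * z \<noteq> 0" "1 + \<omega> * z \<noteq> 0"
  proof -
    show "1 + cnj b * z \<noteq> 0" "1 - cnj b * z \<noteq> 0"
      using disc_shift_denom_nonzero[of b z] disc_shift_denom_nonzero[of "- b" z] b z by auto
    have "cmod (r * b) < 1"
      using b norm_mult_less[of r 1 b 1] by (simp add: r_def)
    then show "1 - cnj (r * b) * z \<noteq> 0" using z by (intro disc_shift_denom_nonzero) auto
    show "1 + \<omega> * z \<noteq> 0"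
    proof
      assume "1 + \<omega> * z = 0"
      then have "cmod (\<omega> * z) = 1" by (metis add.commute eq_neg_iff_add_eq_0 norm_minus_cancel norm_one)
      then show False using z \<omega> by (simp add: norm_mult aligned_def)
    qed
  qed
  define E where "E = (1 + cnj b * z) * (1 - cnj b * z)"
  have E: "E \<noteq> 0" using n by (simp add: E_def)
  have s: "orth_disc b z $ 1 = - 2 * z * (1 - r^2) / E"
    unfolding orth_disc_def E_def using n bb
    by (simp add: disc_shift_def divide_simps) (simp add: algebra_simps)
  have p: "orth_disc b z $ 2 = (z^2 - b^2) / E"
    unfolding orth_disc_def E_def using n
    by (simp add: disc_shift_def divide_simps) (simp add: power2_eq_square algebra_simps)
  have n1: "2 * \<omega> * orth_disc b z $ 2 - orth_disc b z $ 1 = 2 * (1 + \<omega> * z) * (z - r * b) / E"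
  proof -
    have "2 * \<omega> * (z^2 - b^2) + 2 * z * (1 - r^2) = 2 * (1 + \<omega> * z) * (z - r * b)"
      unfolding wb [symmetric] by (simp add: power2_eq_square algebra_simps)
    then show ?thesis unfolding s p by (simp add: add_divide_distrib[symmetric])
  qed
  have n2: "2 - \<omega> * orth_disc b z $ 1 = 2 * (1 + \<omega> * z) * (1 - cnj (r * b) * z) / E"
  proof -
    have "2 * E + 2 * \<omega> * z * (1 - r^2) = 2 * (1 + \<omega> * z) * (1 - cnj (r * b) * z)"
      unfolding E_def by (simp add: cb cr power2_eq_square algebra_simps)
    then show ?thesis using E unfolding s by (simp add: field_simps)
  qed
  have cancel: "(k * x / E) / (k * y / E) = x / y" if "k \<noteq> 0" for k x y
    using that E by simp
  have "2 * (1 + \<omega> * z) \<noteq> 0" using n(4) by (simp only: mult_eq_0_iff) simp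
  from cancel[OF this] show ?thesis
    unfolding magic_def n1 n2 r_def[symmetric] by (simp only: disc_shift_def)
qed

lemma magic_minus: "magic (- \<omega>) x = - magic \<omega> (vector [- x$1, x$2])"
  by (simp add: magic_def minus_divide_left)

lemma orth_disc_minus: "orth_disc b (- z) = vector [- orth_disc b z $ 1, orth_disc b z $ 2]"
  by (simp add: orth_disc_def vec2_eq_iff disc_shift_minus)

lemma magic_orth_disc_minus:
  assumes "cmod b < 1" "aligned \<omega> b" "cmod z < 1"
  shows "magic (- \<omega>) (orth_disc b z) = disc_shift (- (of_real (cmod b) * b)) z"
  using magic_orth_disc_plus[OF assms(1,2), of "- z"] assms(3)
  by (simp add: magic_minus orth_disc_minus disc_shift_minus)

lemma magic_foot:
  assumes "aligned \<omega> b" "cmod b < 1"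
  shows "magic \<omega> (sympt b (- b)) = - (of_real (cmod b) * b)"
    and "magic (- \<omega>) (sympt b (- b)) = of_real (cmod b) * b"
  using assms magic_flat_axis[OF sympt_minus_in_flat_axis[OF assms(2)]]
  by (simp_all add: aligned_def mult.assoc[symmetric])

lemma norm_times_self_less_one: "cmod b < 1 \<Longrightarrow> cmod (of_real (cmod b) * b) < 1"
  using norm_mult_less[of "of_real (cmod b)" 1 b 1] by simp

lemma disc_shift_isometry:
  assumes "cmod u < 1" "cmod c < 1" "cmod x < 1"
  shows "cmod (disc_shift (disc_shift (- u) c) (disc_shift (- u) x)) = cmod (disc_shift c x)"
proof -
  have n: "1 + cnj u * c \<noteq> 0"
    using disc_shift_denom_nonzero[of "- u" c] assms by auto
  have "cnj (1 + cnj u * c) = 1 + u * cnj c" by simp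
  then have "cmod (1 + u * cnj c) = cmod (1 + cnj u * c)" by (metis complex_mod_cnj)
  then show ?thesis
    unfolding disc_shift_compose[OF assms] using n by (simp add: norm_mult norm_divide)
qed

text \<open>
  Let u be the common value, up to sign, of the two magic functions at sympt b (-b). After the
  translation of this value to 0, the two magic functions take the same value zeta at y, while at
  x they take values m and -m with m nonzero. So one of the two pseudohyperbolic distances exceeds
  the modulus of zeta.
\<close>
lemma flat_axis_farther:
  assumes x: "x \<in> flat_axis" "x \<noteq> sympt b (- b)" and b: "cmod b < 1" "aligned \<omega> b"
    and y: "y \<in> sym_bidisc" and \<zeta>: "cmod \<zeta> < 1"
    and m1: "magic \<omega> y = disc_shift (of_real (cmod b) * b) \<zeta>"
    and m2: "magic (- \<omega>) y = disc_shift (- (of_real (cmod b) * b)) \<zeta>"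
  shows "artanh (cmod \<zeta>) < cara_dist x y"
proof -
  define u where "u = - (of_real (cmod b) * b)"
  have u: "cmod u < 1" unfolding u_def using norm_times_self_less_one b by simp
  have w: "cmod \<omega> = 1" "cmod (- \<omega>) = 1" using b by (auto simp: aligned_def)
  have xG: "x \<in> sym_bidisc" using x flat_axis_subset by blast
  define m where "m = disc_shift u (\<omega> * x$2)"
  have wx: "cmod (\<omega> * x$2) < 1" using norm_snd_less_one[OF xG] w by (simp add: norm_mult)
  have m: "cmod m < 1" unfolding m_def using u wx by (rule disc_shift_norm_less_one)
  have mx: "magic \<omega> x = disc_shift (- u) m"
    unfolding m_def disc_shift_inverse[OF u wx] by (rule magic_flat_axis[OF x(1)])
  have mx': "magic (- \<omega>) x = disc_shift u (- m)"
  proof -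
    have "disc_shift u (- m) = - disc_shift (- u) m" by (rule disc_shift_minus)
    then show ?thesis unfolding m_def disc_shift_inverse[OF u wx] by (simp add: magic_flat_axis[OF x(1)])
  qed
  have "m \<noteq> 0"
  proof
    assume "m = 0"
    then have "\<omega> * x$2 = u" using mx magic_flat_axis[OF x(1)] by simp
    also have "u = \<omega> * (- (b * b))" using b(2) by (simp add: u_def aligned_def mult.assoc[symmetric])
    finally have "x$2 = - (b * b)" using w(1) by (subst (asm) mult_left_cancel) auto
    then show False using x by (simp add: flat_axis_def vec2_eq_iff)
  qed
  from disc_shift_pair_norm_less[OF m \<zeta> this] show ?thesis
  proof
    assume *: "cmod \<zeta> < cmod (disc_shift m \<zeta>)"
    have "cmod (disc_shift (magic \<omega> y) (magic \<omega> x)) = cmod (disc_shift m \<zeta>)"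
      using disc_shift_isometry[OF u m \<zeta>] m1 unfolding mx
      by (subst disc_shift_norm_commute) (simp add: u_def)
    moreover have "cmod (disc_shift m \<zeta>) < 1" using m \<zeta> by (rule disc_shift_norm_less_one)
    ultimately have "artanh (cmod \<zeta>) < artanh (cmod (disc_shift (magic \<omega> y) (magic \<omega> x)))"
      using * by (intro artanh_strict_mono) auto
    then show ?thesis using cara_dist_ge[OF magic_in_disc_functions[OF w(1)] xG y] by linarith
  next
    assume *: "cmod \<zeta> < cmod (disc_shift (- m) \<zeta>)"
    have um: "cmod (- u) < 1" "cmod (- m) < 1" using u m by auto
    have "cmod (disc_shift (magic (- \<omega>) y) (magic (- \<omega>) x)) = cmod (disc_shift (- m) \<zeta>)"
      using disc_shift_isometry[OF um \<zeta>] m2 unfolding mx'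
      by (subst disc_shift_norm_commute) (simp add: u_def)
    moreover have "cmod (disc_shift (- m) \<zeta>) < 1" using um(2) \<zeta> by (rule disc_shift_norm_less_one)
    ultimately have "artanh (cmod \<zeta>) < artanh (cmod (disc_shift (magic (- \<omega>) y) (magic (- \<omega>) x)))"
      using * by (intro artanh_strict_mono) auto
    then show ?thesis using cara_dist_ge[OF magic_in_disc_functions[OF w(2)] xG y] by linarith
  qed
qed

lemma magic_disc_deriv:
  assumes h: "analytic_disc h" and h0: "h 0 = sympt b (- b)" and b: "cmod b < 1" and w: "cmod \<omega> = 1"
  shows "deriv (\<lambda>z. magic \<omega> (h z)) 0
     = - (1 + (\<omega> * b)^2) / 2 * velocity h 1 + \<omega> * velocity h 2"
proof -
  have "(magic \<omega> has_derivative
     (\<lambda>v. 2 * (\<omega>^2 * h 0 $ 2 - 1) / (2 - \<omega> * h 0 $ 1)^2 * v$1 + 2 * \<omega> / (2 - \<omega> * h 0 $ 1) * v$2)) (at (h 0) within sym_bidisc)"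
    using w analytic_disc_in[OF h, of 0] by (intro magic_has_derivative) auto
  from DERIV_imp_deriv[OF compose_disc_derivative[where f = "magic \<omega>", OF this h]]
  have "deriv (\<lambda>z. magic \<omega> (h z)) 0
      = 2 * (- ((\<omega> * b)^2) - 1) / 4 * velocity h 1 + \<omega> * velocity h 2"
    by (simp add: h0 power2_eq_square algebra_simps)
  also have "2 * (- ((\<omega> * b)^2) - 1) / 4 = - (1 + (\<omega> * b)^2) / 2" by (simp add: field_simps)
  finally show ?thesis .
qed

text \<open>
  A left inverse of h has the derivative 1 along h and, by the Schwarz-Pick lemma, a bounded
  derivative along the disc orth_disc, which starts in the same direction. This bounds the speed
  of h from below by the speed of orth_disc. Along orth_disc both magic functions have the largest
  derivative possible, hence also along h, and the two derivatives agree.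
\<close>
lemma orthogonal_geodesic_magic:
  assumes h: "analytic_disc h" and \<Phi>: "\<Phi> \<in> disc_functions" "\<And>z. cmod z < 1 \<Longrightarrow> \<Phi> (h z) = z"
    and h0: "h 0 = sympt b (- b)" and b: "cmod b < 1" "aligned \<omega> b"
    and orth: "velocity h 2 = 0"
  obtains c where "cmod c = 1"
    "\<And>z. cmod z < 1 \<Longrightarrow> magic \<omega> (h z) = disc_shift (of_real (cmod b) * b) (c * z)"
    "\<And>z. cmod z < 1 \<Longrightarrow> magic (- \<omega>) (h z) = disc_shift (- (of_real (cmod b) * b)) (c * z)"
proof -
  define v where "v = velocity h 1"
  define r where "r = cmod b"
  have r: "0 \<le> r" "r < 1" "r^2 < 1" using b by (auto simp: r_def abs_square_less_1)
  have w: "cmod \<omega> = 1" "cmod (- \<omega>) = 1" using b by (auto simp: aligned_def)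
  have wb: "\<omega> * b = of_real r" using b by (simp add: aligned_def r_def)
  obtain A B where AB: "(\<Phi> has_derivative (cform A B)) (at (h 0) within sym_bidisc)"
    and Av': "A * velocity h 1 + B * velocity h 2 = 1"
    by (rule left_inverse_derivative[OF h \<Phi>]) (assumption, rule that)
  have Av: "A * v = 1" using Av' orth by (simp add: v_def)
  have "cmod A * (2 * (1 - r^2)) \<le> 1"
  proof -
    have AB': "(\<Phi> has_derivative (cform A B)) (at (orth_disc b 0) within sym_bidisc)"
      using AB h0 orth_disc_zero[of b] by simp
    have "deriv (\<lambda>z. \<Phi> (orth_disc b z)) 0 = A * (- 2 * (1 - (cmod b)^2))"
      using DERIV_imp_deriv[OF compose_disc_derivative[where f = \<Phi>, OF AB' orth_disc_analytic[OF b(1)]]]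
      by (simp add: orth_disc_deriv[OF b(1)])
    moreover have "\<Phi> (orth_disc b 0) = 0" using \<Phi>(2)[of 0] h0 orth_disc_zero[of b] by simp
    ultimately have "cmod (A * (- 2 * (1 - (cmod b)^2))) \<le> 1"
      using schwarz_pick(2)[OF compose_disc[OF \<Phi>(1) orth_disc_analytic[OF b(1)]]] by simp
    moreover have "A * (- 2 * (1 - (cmod b)^2)) = A * of_real (- 2 * (1 - r^2))" by (simp add: r_def)
    ultimately have "cmod A * \<bar>- 2 * (1 - r^2)\<bar> \<le> 1" by (metis norm_mult norm_of_real)
    then show ?thesis using r by simp
  qed
  then have "cmod A * (2 * (1 - r^2)) \<le> cmod A * cmod v" using Av by (metis norm_mult norm_one)
  moreover have "0 < cmod A" using Av by auto
  ultimately have v: "2 * (1 - r^2) \<le> cmod v" by simp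
  define P where "P = - (1 + complex_of_real r^2) / 2 * v"
  have P: "1 - (r * r)^2 \<le> cmod P"
  proof -
    have "1 + complex_of_real r^2 = of_real (1 + r^2)" by simp
    then have "cmod (1 + complex_of_real r^2) = 1 + r^2" by (metis abs_of_nonneg add_nonneg_nonneg norm_of_real zero_le_one zero_le_power2)
    moreover have "P = - ((1 + complex_of_real r^2) / 2 * v)" by (simp add: P_def algebra_simps)
    ultimately have "cmod P = (1 + r^2) / 2 * cmod v"
      by (simp only: norm_minus_cancel norm_mult norm_divide) simp
    moreover have "(1 + r^2) / 2 * (2 * (1 - r^2)) \<le> (1 + r^2) / 2 * cmod v"
      using v by (intro mult_left_mono) (auto intro: add_nonneg_nonneg)
    moreover have "(1 + r^2) / 2 * (2 * (1 - r^2)) = 1 - (r * r)^2"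
      by (simp add: power2_eq_square field_simps)
    ultimately show ?thesis by simp
  qed
  define a where "a = complex_of_real r * b"
  have a: "cmod a = r * r" "cmod a < 1" "cmod (- a) < 1"
    using norm_times_self_less_one[OF b(1)] r by (auto simp: a_def r_def norm_mult)
  have d1: "deriv (\<lambda>z. magic \<omega> (h z)) 0 = P"
    using magic_disc_deriv[OF h h0 b(1) w(1)] by (simp add: orth wb P_def v_def)
  have d2: "deriv (\<lambda>z. magic (- \<omega>) (h z)) 0 = P"
    using magic_disc_deriv[OF h h0 b(1) w(2)] by (simp add: orth wb P_def v_def)
  have f1: "magic \<omega> (h 0) = - a" and f2: "magic (- \<omega>) (h 0) = a"
    using magic_foot[OF b(2,1)] by (simp_all add: h0 a_def r_def)
  obtain c where c: "cmod c = 1" "\<And>z. cmod z < 1 \<Longrightarrow> disc_shift (- a) (magic \<omega> (h z)) = c * z"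
      "P = c * (1 - (cmod a)^2)"
    using schwarz_pick(3)[OF compose_disc[OF magic_in_disc_functions[OF w(1)] h]] d1 f1 P a by auto
  obtain c' where c': "cmod c' = 1" "\<And>z. cmod z < 1 \<Longrightarrow> disc_shift a (magic (- \<omega>) (h z)) = c' * z"
      "P = c' * (1 - (cmod a)^2)"
    using schwarz_pick(3)[OF compose_disc[OF magic_in_disc_functions[OF w(2)] h]] d2 f2 P a by auto
  have "complex_of_real (1 - (cmod a)^2) \<noteq> 0"
    using a(2) by (simp only: of_real_eq_0_iff) (auto simp: abs_square_eq_1)
  then have cc: "c' = c" using c(3) c'(3) by (simp del: of_real_diff of_real_power) 
  show ?thesis
  proof (rule that[OF c(1)])
    fix z :: complex assume z: "cmod z < 1"
    have m: "cmod (magic \<omega> (h z)) < 1" "cmod (magic (- \<omega>) (h z)) < 1"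
      using magic_norm_less_one[OF w(1)] magic_norm_less_one[OF w(2)] analytic_disc_in[OF h z] by auto
    show "magic \<omega> (h z) = disc_shift (of_real (cmod b) * b) (c * z)"
      using disc_shift_inverse[OF a(3) m(1)] c(2)[OF z] by (simp add: a_def r_def)
    show "magic (- \<omega>) (h z) = disc_shift (- (of_real (cmod b) * b)) (c * z)"
      using disc_shift_inverse[OF a(2) m(2)] c'(2)[OF z] by (simp add: a_def r_def cc)
  qed
qed

lemma INF_flat_axis_le:
  assumes "y \<in> sym_bidisc" "x \<in> flat_axis"
  shows "(INF x\<in>flat_axis. cara_dist x y) \<le> cara_dist x y"
proof (rule cINF_lower[OF bdd_belowI2 assms(2)])
  fix x assume "x \<in> flat_axis"
  then show "0 \<le> cara_dist x y" using flat_axis_subset assms(1) by (intro cara_dist_nonneg) auto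
qed

text \<open>
  Both magic functions agree along h with those along the orthogonal disc up to a rotation of the
  parameter, so the estimate for orthogonal discs applies to h.
\<close>
lemma orthogonal_imp_nearest:
  assumes h: "analytic_disc h" and \<Phi>: "\<Phi> \<in> disc_functions" "\<And>z. cmod z < 1 \<Longrightarrow> \<Phi> (h z) = z"
    and h0: "h 0 \<in> flat_axis" and orth: "velocity h 2 = 0" and z: "cmod z < 1"
  shows "cara_dist (h 0) (h z) = (INF x\<in>flat_axis. cara_dist x (h z))"
proof (rule antisym)
  obtain b where b: "cmod b < 1" "h 0 = sympt b (- b)" using h0 by (rule flat_axis_cases)
  obtain \<omega> where \<omega>: "aligned \<omega> b" by (rule aligned_exists)
  obtain c where c: "cmod c = 1"
    "\<And>z. cmod z < 1 \<Longrightarrow> magic \<omega> (h z) = disc_shift (of_real (cmod b) * b) (c * z)"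
    "\<And>z. cmod z < 1 \<Longrightarrow> magic (- \<omega>) (h z) = disc_shift (- (of_real (cmod b) * b)) (c * z)"
    using orthogonal_geodesic_magic[OF h \<Phi> b(2,1) \<omega> orth] by metis
  have d0: "cara_dist (h 0) (h z) = artanh (cmod z)" by (rule cara_dist_geodesic[OF h \<Phi> z])
  show "cara_dist (h 0) (h z) \<le> (INF x\<in>flat_axis. cara_dist x (h z))"
  proof (rule cINF_greatest)
    show "flat_axis \<noteq> {}" using h0 by auto
    fix x assume x: "x \<in> flat_axis"
    show "cara_dist (h 0) (h z) \<le> cara_dist x (h z)"
    proof (cases "x = h 0")
      case False
      have "artanh (cmod (c * z)) < cara_dist x (h z)"
        using False b c z
        by (intro flat_axis_farther[OF x _ b(1) \<omega> analytic_disc_in[OF h z]]) (auto simp: norm_mult)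
      then show ?thesis using d0 c(1) by (simp add: norm_mult)
    qed simp
  qed
  show "(INF x\<in>flat_axis. cara_dist x (h z)) \<le> cara_dist (h 0) (h z)"
    by (rule INF_flat_axis_le[OF analytic_disc_in[OF h z] h0])
qed

text \<open>
  The point sympt u v lies on the orthogonal disc at the hyperbolic midpoint of u and -v.
\<close>
lemma orth_disc_through:
  assumes "y \<in> sym_bidisc"
  obtains b \<zeta> where "cmod b < 1" "cmod \<zeta> < 1" "y = orth_disc b \<zeta>"
proof -
  obtain u v where uv: "cmod u < 1" "cmod v < 1" "y = sympt u v" using assms by (rule sym_bidisc_cases)
  then obtain b where b: "cmod b < 1" "disc_shift b (- v) = - disc_shift b u"
    using hyperbolic_midpoint[of u "- v"] by auto
  define \<zeta> where "\<zeta> = - disc_shift b u"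
  have \<zeta>: "cmod \<zeta> < 1" using disc_shift_norm_less_one[OF b(1) uv(1)] by (simp add: \<zeta>_def)
  have "disc_shift (- b) (- \<zeta>) = u" by (simp add: \<zeta>_def disc_shift_inverse[OF b(1) uv(1)])
  moreover have "disc_shift b (- \<zeta>) = v"
  proof -
    have "disc_shift (- b) \<zeta> = - v"
      unfolding \<zeta>_def b(2)[symmetric] using uv by (intro disc_shift_inverse[OF b(1)]) simp
    then show ?thesis by (simp add: disc_shift_minus)
  qed
  ultimately show ?thesis using that[OF b(1) \<zeta>] uv by (simp add: orth_disc_def)
qed

text \<open>
  Put h z on an orthogonal disc. Uniqueness of the nearest point shows that h 0 is the foot of
  this disc and that h z has the same hyperbolic parameter on both discs. Both magic functions
  therefore attain equality in the Schwarz-Pick lemma along h, at the same point and with the same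
  value, hence with the same constant. Their derivatives at 0 coincide, and these differ only in
  the sign of the second velocity component.
\<close>
lemma nearest_imp_orthogonal:
  assumes h: "analytic_disc h" and \<Phi>: "\<Phi> \<in> disc_functions" "\<And>z. cmod z < 1 \<Longrightarrow> \<Phi> (h z) = z"
    and h0: "h 0 \<in> flat_axis" and z: "cmod z < 1" "z \<noteq> 0"
    and near: "cara_dist (h 0) (h z) = (INF x\<in>flat_axis. cara_dist x (h z))"
  shows "velocity h 2 = 0"
proof -
  have yG: "h z \<in> sym_bidisc" by (rule analytic_disc_in[OF h z(1)])
  obtain b \<zeta> where b: "cmod b < 1" and \<zeta>: "cmod \<zeta> < 1" and y: "h z = orth_disc b \<zeta>"
    using yG by (rule orth_disc_through)
  obtain \<omega> where \<omega>: "aligned \<omega> b" by (rule aligned_exists)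
  then have w: "cmod \<omega> = 1" "cmod (- \<omega>) = 1" by (auto simp: aligned_def)
  define a where "a = complex_of_real (cmod b) * b"
  have a: "cmod a < 1" unfolding a_def by (rule norm_times_self_less_one[OF b])
  have d0: "cara_dist (h 0) (h z) = artanh (cmod z)" by (rule cara_dist_geodesic[OF h \<Phi> z(1)])
  have m1: "magic \<omega> (h z) = disc_shift a \<zeta>"
    unfolding y a_def by (rule magic_orth_disc_plus[OF b \<omega> \<zeta>])
  have m2: "magic (- \<omega>) (h z) = disc_shift (- a) \<zeta>"
    unfolding y a_def by (rule magic_orth_disc_minus[OF b \<omega> \<zeta>])
  have "artanh (cmod z) \<le> cara_dist (orth_disc b 0) (orth_disc b \<zeta>)"
    using INF_flat_axis_le[OF yG sympt_minus_in_flat_axis[OF b]] near d0 y by (simp add: orth_disc_zero)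
  also have "\<dots> \<le> artanh (cmod \<zeta>)"
    by (rule cara_dist_le_disc[OF orth_disc_analytic[OF b] \<zeta>])
  finally have le: "artanh (cmod z) \<le> artanh (cmod \<zeta>)" .
  have h0b: "h 0 = sympt b (- b)"
  proof (rule ccontr)
    assume "h 0 \<noteq> sympt b (- b)"
    from flat_axis_farther[OF h0 this b \<omega> yG \<zeta>] m1 m2 have "artanh (cmod \<zeta>) < artanh (cmod z)"
      by (simp add: a_def d0)
    then show False using le by simp
  qed
  have f: "magic \<omega> (h 0) = - a" "magic (- \<omega>) (h 0) = a"
    using magic_foot[OF \<omega> b] by (simp_all add: h0b a_def)
  have z1: "disc_shift (magic \<omega> (h 0)) (magic \<omega> (h z)) = \<zeta>"
    using disc_shift_inverse[OF a \<zeta>] by (simp add: f m1)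
  have z2: "disc_shift (magic (- \<omega>) (h 0)) (magic (- \<omega>) (h z)) = \<zeta>"
    using disc_shift_inverse[of "- a" \<zeta>] a \<zeta> by (simp add: f m2)
  note sp = schwarz_pick[OF compose_disc[OF magic_in_disc_functions[OF w(1)] h]]
  note sp' = schwarz_pick[OF compose_disc[OF magic_in_disc_functions[OF w(2)] h]]
  have eq: "cmod \<zeta> = cmod z"
    using sp(1)[OF z(1)] le \<zeta> z(1) artanh_le_iff[of "cmod z" "cmod \<zeta>"] unfolding z1 by simp
  obtain c where c: "\<And>z. cmod z < 1 \<Longrightarrow> disc_shift (magic \<omega> (h 0)) (magic \<omega> (h z)) = c * z"
    "deriv (\<lambda>z. magic \<omega> (h z)) 0 = c * (1 - (cmod (magic \<omega> (h 0)))^2)"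
    using sp(3) z z1 eq by blast
  obtain c' where c': "\<And>z. cmod z < 1 \<Longrightarrow> disc_shift (magic (- \<omega>) (h 0)) (magic (- \<omega>) (h z)) = c' * z"
    "deriv (\<lambda>z. magic (- \<omega>) (h z)) 0 = c' * (1 - (cmod (magic (- \<omega>) (h 0)))^2)"
    using sp'(3) z z2 eq by blast
  have "c * z = c' * z" using c(1)[OF z(1)] c'(1)[OF z(1)] z1 z2 by simp
  then have "c = c'" using z(2) by simp
  then have "deriv (\<lambda>z. magic \<omega> (h z)) 0 = deriv (\<lambda>z. magic (- \<omega>) (h z)) 0"
    unfolding c(2) c'(2) f by simp
  then have "\<omega> * velocity h 2 = - (\<omega> * velocity h 2)"
    using magic_disc_deriv[OF h h0b b w(1)] magic_disc_deriv[OF h h0b b w(2)] by simp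
  then have "\<omega> * velocity h 2 = 0" by simp
  then show ?thesis using w(1) by auto
qed

section \<open>Automorphisms preserve the royal variety and act on the axis\<close>

lemma axis_in_flat_axis: "cmod z < 1 \<Longrightarrow> vector [0, z] \<in> flat_axis"
proof -
  assume z: "cmod z < 1"
  define b where "b = csqrt (- z)"
  have "b^2 = - z" by (simp add: b_def)
  then have "(cmod b)^2 = cmod z" by (metis norm_minus_cancel norm_power)
  then have "cmod b < 1" using z abs_square_less_1[of "cmod b"] by simp
  moreover have "sympt b (- b) = vector [0, z]"
    using \<open>b^2 = - z\<close> by (simp add: vec2_eq_iff power2_eq_square)
  ultimately show ?thesis using sympt_minus_in_flat_axis[of b] by simp
qed

definition axis_disc :: "complex \<Rightarrow> complex \<Rightarrow> complex^2" where
  "axis_disc a z = vector [0, disc_shift (- a) z]"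

lemma axis_disc_eq [simp]: "axis_disc a 0 = vector [0, a]" "axis_disc 0 z = vector [0, z]"
  by (simp_all add: axis_disc_def)

lemma axis_disc_analytic:
  assumes "cmod a < 1"
  shows "analytic_disc (axis_disc a)"
proof (rule analytic_discI)
  have a: "cmod (- a) < 1" using assms by simp
  show "(\<lambda>z. axis_disc a z $ 1) holomorphic_on unit_disc" "(\<lambda>z. axis_disc a z $ 2) holomorphic_on unit_disc"
    by (simp_all add: axis_disc_def disc_shift_holomorphic_on[OF a])
  show "axis_disc a z \<in> sym_bidisc" if "cmod z < 1" for z
    unfolding axis_disc_def
    using axis_in_flat_axis[OF disc_shift_norm_less_one[OF a that]] flat_axis_subset by blast
qed

lemma axis_disc_velocity:
  "velocity (axis_disc a) 1 = 0" "velocity (axis_disc a) 2 = 1 - of_real (cmod a)^2"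
proof -
  have "(disc_shift (- a) has_field_derivative 1 - of_real (cmod a)^2) (at 0)"
    using disc_shift_has_field_derivative[of "- a" 0 UNIV] by simp
  then show "velocity (axis_disc a) 1 = 0" "velocity (axis_disc a) 2 = 1 - of_real (cmod a)^2"
    by (simp_all add: axis_disc_def DERIV_imp_deriv)
qed

lemma royal_disc_analytic: "analytic_disc (\<lambda>z. sympt z z)"
  by (intro analytic_disc_sympt) (auto intro!: holomorphic_intros)

lemma royal_disc_velocity: "velocity (\<lambda>z. sympt z z) 1 = 2" "velocity (\<lambda>z. sympt z z) 2 = 0"
  by (rule DERIV_imp_deriv, auto intro!: derivative_eq_intros)+

text \<open>
  The norm |v| / 2 + |w| is the maximum, over the magic functions, of the modulus of the
  derivative at the origin in the direction (v, w).
\<close>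
lemma l1_norm_attained:
  obtains \<omega> where "cmod \<omega> = 1" "cmod v / 2 + cmod w \<le> cmod (- v / 2 + \<omega> * w)"
proof -
  have "\<exists>\<omega>. cmod \<omega> = 1 \<and> cmod v / 2 + cmod w \<le> cmod (- v / 2 + \<omega> * w)"
  proof (cases "v = 0 \<or> w = 0")
    case True
    then show ?thesis by (intro exI[of _ 1]) (auto simp: norm_divide)
  next
    case False
    define e where "e = v / of_real (cmod v)"
    define \<omega> where "\<omega> = - e * of_real (cmod w) / w"
    have "cmod e = 1" using False by (simp add: e_def norm_divide)
    then have "cmod \<omega> = 1" using False by (simp add: \<omega>_def norm_divide norm_mult)
    moreover have "- v / 2 + \<omega> * w = - e * of_real (cmod v / 2 + cmod w)"
      using False by (simp add: e_def \<omega>_def algebra_simps)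
    then have "cmod (- v / 2 + \<omega> * w) = cmod v / 2 + cmod w"
      using \<open>cmod e = 1\<close> by (simp only: norm_mult norm_minus_cancel norm_of_real) simp
    ultimately show ?thesis by auto
  qed
  then show ?thesis using that by blast
qed

text \<open>
  The Schwarz lemma for the magic function that attains the norm.
\<close>
lemma origin_disc_norm:
  assumes j: "analytic_disc j" and j0: "j 0 = sympt 0 0"
  shows "cmod (velocity j 1) / 2 + cmod (velocity j 2) \<le> 1"
proof -
  define v w where "v = velocity j 1" and "w = velocity j 2"
  obtain \<omega> where \<omega>: "cmod \<omega> = 1" "cmod v / 2 + cmod w \<le> cmod (- v / 2 + \<omega> * w)"
    by (rule l1_norm_attained)
  have "deriv (\<lambda>z. magic \<omega> (j z)) 0 = - v / 2 + \<omega> * w"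
    using magic_disc_deriv[OF j, of 0 \<omega>] j0 \<omega> by (simp add: v_def w_def)
  then have "cmod (- v / 2 + \<omega> * w) \<le> 1 - (cmod (magic \<omega> (j 0)))^2"
    using schwarz_pick(2)[OF compose_disc[OF magic_in_disc_functions[OF \<omega>(1)] j]] by simp
  also have "\<dots> \<le> 1" by simp
  finally show ?thesis using \<omega>(2) unfolding v_def w_def by linarith
qed

lemma Re_ge_norm_imp_of_real:
  assumes "cmod z \<le> t" "t \<le> Re z"
  shows "z = of_real t"
proof -
  have "Re z = t" using assms complex_Re_le_cmod[of z] by linarith
  moreover have "cmod z = t" using assms complex_Re_le_cmod[of z] by linarith
  ultimately have "Im z = 0" using cmod_power2[of z] by simp
  then show ?thesis using \<open>Re z = t\<close> by (simp add: complex_eq_iff)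
qed

text \<open>
  A functional of norm at most 1 that attains the l1 norm at a vector is determined, on each
  coordinate where that vector does not vanish.
\<close>
lemma l1_norming_functional:
  assumes "cmod p \<le> 1/2" "cmod q \<le> 1" "cmod v / 2 + cmod w \<le> 1" "p * v + q * w = e" "cmod e = 1"
  shows "p * v = e * of_real (cmod v / 2)" "q * w = e * of_real (cmod w)"
proof -
  define P Q where "P = cnj e * (p * v)" and "Q = cnj e * (q * w)"
  have ee: "cnj e * e = 1" using assms(5) by (simp add: complex_norm_square[symmetric] mult.commute)
  have "P + Q = 1" using assms(4) ee by (metis P_def Q_def distrib_left)
  then have s: "Re P + Re Q = 1" by (metis one_complex.sel(1) plus_complex.sel(1))
  have P: "cmod P \<le> cmod v / 2"
    using mult_right_mono[OF assms(1), of "cmod v"] by (simp add: P_def norm_mult assms(5))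
  have Q: "cmod Q \<le> cmod w"
    using mult_right_mono[OF assms(2), of "cmod w"] by (simp add: Q_def norm_mult assms(5))
  have "cmod v / 2 \<le> Re P" "cmod w \<le> Re Q"
    using s assms(3) P Q complex_Re_le_cmod[of P] complex_Re_le_cmod[of Q] by linarith+
  then have "P = of_real (cmod v / 2)" "Q = of_real (cmod w)"
    using P Q Re_ge_norm_imp_of_real by blast+
  moreover have "p * v = e * P" "q * w = e * Q"
    using ee by (simp_all add: P_def Q_def mult.assoc[symmetric] mult.commute[of e])
  ultimately show "p * v = e * of_real (cmod v / 2)" "q * w = e * of_real (cmod w)" by simp_all
qed

text \<open>
  The vectors (w1, w2) and (u1, u2) have two different norming functionals each; those for the
  first agree in value and those for the second are opposite. In an l1 norm a vector with two
  norming functionals lies on a coordinate axis, and the signs rule out that both lie on the same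
  one.
\<close>
lemma l1_axes:
  assumes p: "cmod p \<le> 1/2" "cmod q \<le> 1" and p': "cmod p' \<le> 1/2" "cmod q' \<le> 1"
    and w: "cmod w1 / 2 + cmod w2 \<le> 1" and u: "cmod u1 / 2 + cmod u2 \<le> 1"
    and pw: "p * w1 + q * w2 = 1" "p' * w1 + q' * w2 = 1"
    and pu: "p * u1 + q * u2 = e" "p' * u1 + q' * u2 = - e" "cmod e = 1"
  shows "(w2 = 0 \<and> cmod w1 = 2 \<and> u1 = 0 \<and> cmod u2 = 1) \<or>
         (w1 = 0 \<and> cmod w2 = 1 \<and> u2 = 0 \<and> cmod u1 = 2)"
proof -
  have W: "p * w1 = p' * w1" "q * w2 = q' * w2"
    by (simp_all only: l1_norming_functional[OF p w pw(1)] l1_norming_functional[OF p' w pw(2)] norm_one)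
  have U: "p * u1 = - (p' * u1)" "q * u2 = - (q' * u2)"
    using l1_norming_functional[OF p u pu(1)] l1_norming_functional[OF p' u pu(2)] pu(3) by simp_all
  have len: "2 \<le> cmod x1" if "cmod a \<le> 1/2" "1 \<le> cmod (a * x1)" for a x1
  proof -
    have "cmod (a * x1) \<le> 1/2 * cmod x1" unfolding norm_mult using that by (intro mult_right_mono) auto
    then show ?thesis using that by simp
  qed
  have len': "1 \<le> cmod x1" if "cmod a \<le> 1" "1 \<le> cmod (a * x1)" for a x1
  proof -
    have "cmod (a * x1) \<le> 1 * cmod x1" unfolding norm_mult using that by (intro mult_right_mono) auto
    then show ?thesis using that by simp
  qed
  have "e \<noteq> 0" using pu(3) by auto
  consider "w1 \<noteq> 0" "w2 \<noteq> 0" | "w1 = 0" "w2 = 0" | "w1 \<noteq> 0" "w2 = 0" | "w1 = 0" "w2 \<noteq> 0" by blast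
  then show ?thesis
  proof cases
    case 1
    then have "p = p'" "q = q'" using W by auto
    then have "e = - e" using pu by simp
    then show ?thesis using \<open>e \<noteq> 0\<close> by simp
  next
    case 2
    then show ?thesis using pw by simp
  next
    case 3
    then have "p = p'" "p \<noteq> 0" using W pw by auto
    then have "u1 = 0" using U by auto
    moreover have "1 \<le> cmod u2" using pu(1,3) \<open>u1 = 0\<close> len'[OF p(2), of u2] by simp
    moreover have "2 \<le> cmod w1" using pw(1) 3 len[OF p(1), of w1] by simp
    ultimately show ?thesis using 3 w u by auto
  next
    case 4
    then have "q = q'" "q \<noteq> 0" using W pw by auto
    then have "u2 = 0" using U by auto
    moreover have "2 \<le> cmod u1" using pu(1,3) \<open>u2 = 0\<close> len[OF p(1), of u1] by simp
    moreover have "1 \<le> cmod w2" using pw(1) 4 len'[OF p(2), of w2] by simp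
    ultimately show ?thesis using 4 w u by auto
  qed
qed

text \<open>
  The Schwarz-Pick lemma along the discs (2z, z^2) and (0, z); these show that the l1 norm at the
  origin is an upper bound as well.
\<close>
lemma disc_function_derivative_at_origin:
  assumes F: "F \<in> disc_functions"
    and FD: "(F has_derivative (cform P Q)) (at (sympt 0 0) within sym_bidisc)"
  shows "cmod P \<le> (1 - (cmod (F (sympt 0 0)))^2) / 2" "cmod Q \<le> 1 - (cmod (F (sympt 0 0)))^2"
proof -
  have "velocity (\<lambda>z. sympt z z) 1 = 2" "velocity (\<lambda>z. sympt z z) 2 = 0" by (rule royal_disc_velocity)+
  then have "cmod (P * 2) \<le> 1 - (cmod (F (sympt 0 0)))^2"
    using schwarz_pick(2)[OF compose_disc[OF F royal_disc_analytic]]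
      DERIV_imp_deriv[OF compose_disc_derivative[where f = F, OF FD royal_disc_analytic]] by simp
  then show "cmod P \<le> (1 - (cmod (F (sympt 0 0)))^2) / 2" by (simp add: norm_mult)
  have ax: "analytic_disc (axis_disc 0)" by (rule axis_disc_analytic) simp
  have o: "axis_disc 0 0 = sympt 0 0" by (simp add: vec2_eq_iff)
  have "(F has_derivative (cform P Q)) (at (axis_disc 0 0) within sym_bidisc)"
    using FD by (simp only: o)
  from DERIV_imp_deriv[OF compose_disc_derivative[where f = F, OF this ax]]
  have "deriv (\<lambda>z. F (axis_disc 0 z)) 0 = Q" by (simp only: axis_disc_velocity) simp
  then show "cmod Q \<le> 1 - (cmod (F (sympt 0 0)))^2"
    using schwarz_pick(2)[OF compose_disc[OF F ax]] by (simp only: o)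
qed

text \<open>
  The derivative of an automorphism would carry the l1 norm at the origin to the infinitesimal
  Caratheodory norm at sympt b (-b). There the tangent vectors of the orthogonal disc and of the
  axis are normed by two magic functions each, so they would have to correspond to the two
  coordinate axes of the l1 norm. The velocity of a product of two Moebius discs has norm at most
  1, but its l1 norm computed from its two components exceeds 1 for a suitable choice of the two
  rotations.
\<close>
lemma no_automorphism_off_royal:
  assumes fg: "aut_pair f g" and b: "cmod b < 1" "b \<noteq> 0" and f0: "f (sympt 0 0) = sympt b (- b)"
  shows False
proof -
  define r where "r = cmod b"
  have r: "0 < r" "r < 1" using b by (auto simp: r_def)
  define N where "N = 1 - r^4"
  have N: "0 < N" using r by (simp add: N_def power_less_one_iff)
  obtain \<omega> where \<omega>: "aligned \<omega> b" by (rule aligned_exists)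
  then have w: "cmod \<omega> = 1" "cmod (- \<omega>) = 1" "\<omega> * b = of_real r" by (auto simp: aligned_def r_def)
  have oG: "sympt 0 0 \<in> sym_bidisc" and xG: "sympt b (- b) \<in> sym_bidisc"
    using b by (auto intro: sympt_in_sym_bidisc)
  have gx: "g (sympt b (- b)) = sympt 0 0" using aut_pair_inverse[OF fg oG] f0 by simp
  obtain A1 B1 where D1: "((\<lambda>p. g p $ 1) has_derivative (cform A1 B1)) (at (sympt b (- b)) within sym_bidisc)"
    using fg xG unfolding aut_pair_def holomorphic2_on_iff by blast
  obtain A2 B2 where D2: "((\<lambda>p. g p $ 2) has_derivative (cform A2 B2)) (at (sympt b (- b)) within sym_bidisc)"
    using fg xG unfolding aut_pair_def holomorphic2_on_iff by blast
  define S1 S2 where "S1 x y = A1 * x + B1 * y" and "S2 x y = A2 * x + B2 * y" for x y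
  define V1 V2 where "V1 k = S1 (velocity k 1) (velocity k 2)" and "V2 k = S2 (velocity k 1) (velocity k 2)" for k
  have gk: "analytic_disc (\<lambda>z. g (k z))" "g (k 0) = sympt 0 0"
      "deriv (\<lambda>z. g (k z) $ 1) 0 = V1 k"
      "deriv (\<lambda>z. g (k z) $ 2) 0 = V2 k"
    if k: "analytic_disc k" "k 0 = sympt b (- b)" for k
  proof -
    show "analytic_disc (\<lambda>z. g (k z))" by (rule analytic_disc_compose[OF k(1) aut_pair_commute[OF fg]])
    show "g (k 0) = sympt 0 0" by (simp add: k(2) gx)
    show "deriv (\<lambda>z. g (k z) $ 1) 0 = V1 k"
      using DERIV_imp_deriv[OF compose_disc_derivative[where f = "\<lambda>p. g p $ 1" and h = k and z = 0, OF _ k(1)]] D1 k(2)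
      by (simp add: V1_def S1_def)
    show "deriv (\<lambda>z. g (k z) $ 2) 0 = V2 k"
      using DERIV_imp_deriv[OF compose_disc_derivative[where f = "\<lambda>p. g p $ 2" and h = k and z = 0, OF _ k(1)]] D2 k(2)
      by (simp add: V2_def S2_def)
  qed
  have S_norm: "cmod (V1 k) / 2
      + cmod (V2 k) \<le> 1"
    if k: "analytic_disc k" "k 0 = sympt b (- b)" for k
    using origin_disc_norm[OF gk(1)[OF k]] gk(2-4)[OF k] by simp
  have functional: "\<exists>p q. cmod p \<le> 1/2 \<and> cmod q \<le> 1 \<and>
      (\<forall>k. analytic_disc k \<and> k 0 = sympt b (- b) \<longrightarrow>
        p * V1 k
        + q * V2 k
        = (- (1 + (\<omega>' * b)^2) / 2 * velocity k 1 + \<omega>' * velocity k 2) / of_real N)"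
    if w': "cmod \<omega>' = 1" for \<omega>'
  proof -
    define F where "F x = magic \<omega>' (f x)" for x
    have F: "F \<in> disc_functions"
      unfolding F_def [abs_def] by (rule disc_functions_compose[OF magic_in_disc_functions[OF w'] fg])
    have "F (sympt 0 0) = - (\<omega>' * (b * b))"
      using magic_flat_axis[OF sympt_minus_in_flat_axis[OF b(1)]] by (simp add: F_def f0)
    then have F0: "1 - (cmod (F (sympt 0 0)))^2 = N"
      using w' by (simp add: norm_mult r_def N_def power_mult_distrib power2_eq_square numeral_eq_Suc)
    obtain P Q where FD: "(F has_derivative (cform P Q)) (at (sympt 0 0) within sym_bidisc)"
      using F oG unfolding holomorphic2_on_iff by auto
    note PQ = disc_function_derivative_at_origin[OF F FD, unfolded F0]
    have "P * V1 k
        + Q * V2 k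
        = - (1 + (\<omega>' * b)^2) / 2 * velocity k 1 + \<omega>' * velocity k 2"
      if k: "analytic_disc k" "k 0 = sympt b (- b)" for k
    proof -
      have FD': "(F has_derivative (cform P Q)) (at (g (k 0)) within sym_bidisc)"
        using FD gk(2)[OF k] by simp
      have "((\<lambda>z. F (g (k z))) has_field_derivative
          P * V1 k
          + Q * V2 k) (at 0)"
        using compose_disc_derivative[where f = F and h = "\<lambda>z. g (k z)", OF FD' gk(1)[OF k]]
          gk(3,4)[OF k] by simp
      then have "((\<lambda>z. magic \<omega>' (k z)) has_field_derivative
          P * V1 k
          + Q * V2 k) (at 0)"
        by (rule has_field_derivative_transform_within_open[where S = unit_disc])
          (auto simp: F_def aut_pair_inverse[OF aut_pair_commute[OF fg]] analytic_disc_in[OF k(1)])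
      from DERIV_imp_deriv[OF this] show ?thesis
        using magic_disc_deriv[OF k b(1) w'] by simp
    qed
    moreover have "cmod (P / of_real N) \<le> 1/2" "cmod (Q / of_real N) \<le> 1"
      using PQ N by (simp_all add: norm_divide field_simps)
    ultimately show ?thesis
      by (intro exI[of _ "P / of_real N"] exI[of _ "Q / of_real N"]) (auto simp: add_divide_distrib[symmetric])
  qed
  obtain p q where p: "cmod p \<le> 1/2" "cmod q \<le> 1" and pk: "\<And>k. analytic_disc k \<Longrightarrow> k 0 = sympt b (- b) \<Longrightarrow>
      p * V1 k + q * V2 k
        = (- (1 + (\<omega> * b)^2) / 2 * velocity k 1 + \<omega> * velocity k 2) / of_real N"
    using functional[OF w(1)] by blast
  obtain p' q' where p': "cmod p' \<le> 1/2" "cmod q' \<le> 1" and pk': "\<And>k. analytic_disc k \<Longrightarrow> k 0 = sympt b (- b) \<Longrightarrow>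
      p' * V1 k + q' * V2 k
        = (- (1 + (- \<omega> * b)^2) / 2 * velocity k 1 + - \<omega> * velocity k 2) / of_real N"
    using functional[OF w(2)] by blast
  have N': "(1 + complex_of_real r^2) * (1 - complex_of_real r^2) = of_real N" "complex_of_real N \<noteq> 0"
  proof -
    show "complex_of_real N \<noteq> 0" using N by simp
    show "(1 + complex_of_real r^2) * (1 - complex_of_real r^2) = of_real N"
      by (simp add: N_def algebra_simps power2_eq_square numeral_eq_Suc)
  qed
  \<comment> \<open>Both magic functions have derivative 1 - r^4 along the orthogonal disc and plus or minus omega (1 - r^4)
    along the disc in the axis; this is the largest modulus that the Schwarz-Pick lemma permits.\<close>
  note od = orth_disc_analytic[OF b(1)] orth_disc_zero[of b]
  define w1 w2 where "w1 = S1 (- 2 * (1 - of_real r^2)) 0" and "w2 = S2 (- 2 * (1 - of_real r^2)) 0"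
  have W: "cmod w1 / 2 + cmod w2 \<le> 1"
    using S_norm[OF od] orth_disc_deriv[OF b(1)] by (simp add: V1_def V2_def w1_def w2_def r_def)
  have "(- 1 - complex_of_real r^2) * (2 * complex_of_real r^2 - 2) = 2 * of_real N"
    unfolding N'(1)[symmetric] by (simp add: algebra_simps)
  then have W1: "p * w1 + q * w2 = 1" "p' * w1 + q' * w2 = 1"
    using pk[OF od] pk'[OF od] orth_disc_deriv[OF b(1)] w(3) N'
    by (simp_all add: V1_def V2_def w1_def w2_def r_def)
  define ax where "ax = axis_disc (- (b * b))"
  have ax: "analytic_disc ax" unfolding ax_def
    using norm_mult_less[OF b(1) b(1)] by (intro axis_disc_analytic) simp
  have ax0: "ax 0 = sympt b (- b)" by (simp add: ax_def vec2_eq_iff)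
  have axd: "velocity ax 1 = 0" "velocity ax 2 = of_real N"
    unfolding ax_def axis_disc_velocity
    by (simp_all add: N_def r_def norm_mult power_mult_distrib power2_eq_square numeral_eq_Suc mult.assoc)
  define u1 u2 where "u1 = S1 0 (of_real N)" and "u2 = S2 0 (of_real N)"
  have U: "cmod u1 / 2 + cmod u2 \<le> 1"
    using S_norm[OF ax ax0] axd by (simp add: V1_def V2_def u1_def u2_def)
  have U1: "p * u1 + q * u2 = \<omega>" "p' * u1 + q' * u2 = - \<omega>"
    using pk[OF ax ax0] pk'[OF ax ax0] axd N' by (simp_all add: V1_def V2_def u1_def u2_def)
  have axes: "(w2 = 0 \<and> cmod w1 = 2 \<and> u1 = 0 \<and> cmod u2 = 1) \<or>
         (w1 = 0 \<and> cmod w2 = 1 \<and> u2 = 0 \<and> cmod u1 = 2)"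
    by (rule l1_axes[OF p p' W U W1 U1 w(1)])
  \<comment> \<open>The velocity of the product disc with rotations y and cnj y is a combination of the two velocities above;
    as these go to different axes, its l1 norm is the left-hand side below.\<close>
  define \<kappa> where "\<kappa> = 2 * r / (1 + r^2)"
  have \<kappa>: "0 < \<kappa>" using r by (simp add: \<kappa>_def add_pos_nonneg)
  have prod: "\<bar>X\<bar> + \<kappa> * \<bar>Y\<bar> \<le> 1" if XY: "X^2 + Y^2 = 1" for X Y
  proof -
    define y where "y = Complex X Y"
    have y: "cmod y = 1" "cmod (cnj y) = 1" using XY by (simp_all add: y_def cmod_def)
    define k where "k z = sympt (disc_shift (- b) (y * z)) (disc_shift b (cnj y * z))" for z
    have hol: "(\<lambda>z. disc_shift c (e * z)) holomorphic_on unit_disc" if "cmod c < 1" "cmod e = 1" for c e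
    proof -
      have "(\<lambda>z. e * z) ` unit_disc \<subseteq> unit_disc" using that by (auto simp: norm_mult)
      then show ?thesis
        using holomorphic_on_compose_gen[OF _ disc_shift_holomorphic_on[OF that(1)], of "\<lambda>z. e * z" unit_disc]
        by (simp add: o_def holomorphic_intros)
    qed
    have k: "analytic_disc k" unfolding k_def [abs_def]
      using b y by (intro analytic_disc_sympt hol) (auto intro!: disc_shift_norm_less_one simp: norm_mult)
    have k0: "k 0 = sympt b (- b)" by (simp add: k_def)
    have d: "((\<lambda>z. disc_shift c (e * z)) has_field_derivative e * (1 - of_real (cmod c)^2)) (at 0)" for c e
    proof -
      have "(disc_shift c has_field_derivative (1 - of_real (cmod c)^2)) (at (e * 0))"
        using disc_shift_has_field_derivative[of c 0 UNIV] by simp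
      from DERIV_chain2[where f = "disc_shift c" and g = "\<lambda>z. e * z", OF this DERIV_cmult_Id]
      show ?thesis by (simp add: mult.commute)
    qed
    have yc: "y + cnj y = of_real (2 * X)" "y - cnj y = of_real (2 * Y) * \<i>"
      by (simp_all add: y_def complex_eq_iff)
    have "((\<lambda>z. k z $ 1) has_field_derivative (y + cnj y) * (1 - of_real r^2)) (at 0)"
      unfolding k_def sympt_nth r_def by (rule derivative_eq_intros d refl)+ (simp add: algebra_simps)
    moreover have "((\<lambda>z. k z $ 2) has_field_derivative - b * (y - cnj y) * (1 - of_real r^2)) (at 0)"
      unfolding k_def sympt_nth r_def by (rule derivative_eq_intros d refl)+ (simp add: algebra_simps)
    ultimately have dk: "velocity k 1 = - of_real X * (- 2 * (1 - of_real r^2))"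
        "velocity k 2 = - of_real (2 * Y) * \<i> * b * (1 - of_real r^2)"
      unfolding yc by (auto dest!: DERIV_imp_deriv simp: algebra_simps)
    define m where "m = - of_real (2 * Y) * \<i> * b / (1 + of_real r^2)"
    have n1: "1 + complex_of_real r^2 \<noteq> 0" using N' by auto
    have dk2: "velocity k 2 = m * of_real N"
      unfolding dk(2) m_def N'(1)[symmetric] using n1 by simp
    have "cmod (1 + complex_of_real r^2) = 1 + r^2"
    proof -
      have "1 + complex_of_real r^2 = of_real (1 + r^2)" by simp
      then show ?thesis by (metis abs_of_nonneg add_nonneg_nonneg norm_of_real zero_le_one zero_le_power2)
    qed
    then have m: "cmod m = \<kappa> * \<bar>Y\<bar>"
      by (simp add: m_def norm_mult norm_divide \<kappa>_def r_def)
    have S: "V1 k = - of_real X * w1 + m * u1"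
      "V2 k = - of_real X * w2 + m * u2"
      unfolding V1_def V2_def dk(1) dk2 by (simp_all add: S1_def S2_def w1_def w2_def u1_def u2_def algebra_simps)
    from S_norm[OF k k0] axes m show ?thesis
      unfolding S by (auto simp: norm_mult)
  qed
  \<comment> \<open>A rational point of the circle close to (1, 0): the second term is of first order in t, the loss in
    the first term only of second order.\<close>
  define t where "t = \<kappa> / 2"
  have t: "0 < t" using \<kappa> by (simp add: t_def)
  have tt: "1 + t^2 > 0" by (simp add: add_pos_nonneg)
  have "((1 - t^2) / (1 + t^2))^2 + (2 * t / (1 + t^2))^2 = 1"
  proof -
    have "(1 - t^2)^2 + (2 * t)^2 = (1 + t^2)^2" by (simp add: power2_eq_square algebra_simps)
    then show ?thesis using tt by (simp add: power_divide add_divide_distrib[symmetric])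
  qed
  note bound = prod[OF this]
  have e: "\<bar>2 * t / (1 + t^2)\<bar> = 2 * t / (1 + t^2)" using t tt by (intro abs_of_nonneg) simp
  have "(1 - t^2) / (1 + t^2) + \<kappa> * (2 * t / (1 + t^2)) \<le> 1"
    using bound[unfolded e] abs_ge_self[of "(1 - t^2) / (1 + t^2)"] by linarith
  then have "(1 - t^2) + \<kappa> * (2 * t) \<le> 1 + t^2"
    using tt by (simp add: add_divide_distrib[symmetric])
  then have "\<kappa> * (2 * t) \<le> t * (2 * t)" by (simp add: power2_eq_square)
  then show False using mult_pos_pos[OF \<kappa> \<kappa>] by (simp add: t_def)
qed

text \<open>
  If the image of the origin is sympt u v, the midpoint of u and v can be moved to 0, and the
  preceding lemma then forces u = v.
\<close>
lemma automorphism_origin_royal: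
  assumes fg: "aut_pair f g"
  shows "f (sympt 0 0) \<in> royal_variety"
proof -
  have "f (sympt 0 0) \<in> sym_bidisc" by (rule aut_pair_in[OF fg]) (simp add: sympt_in_sym_bidisc)
  then obtain u v where uv: "cmod u < 1" "cmod v < 1" "f (sympt 0 0) = sympt u v" by (rule sym_bidisc_cases)
  obtain b where b: "cmod b < 1" "disc_shift b v = - disc_shift b u" using hyperbolic_midpoint[OF uv(1,2)] .
  define c where "c = disc_shift b u"
  have c: "cmod c < 1" unfolding c_def by (rule disc_shift_norm_less_one[OF b(1) uv(1)])
  have "sym_lift b (f (sympt 0 0)) = sympt c (- c)"
    using uv b by (simp add: sym_lift_sympt c_def)
  then have "c = 0"
    using no_automorphism_off_royal[OF aut_pair_compose[OF fg aut_pair_sym_lift[OF b(1)]] c] by blast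
  then have "u = b" "v = b"
    using disc_shift_inverse[OF b(1) uv(1)] disc_shift_inverse[OF b(1) uv(2)] b(2) by (simp_all add: c_def)
  then show ?thesis using b(1) uv(3) royal_variety_iff by blast
qed

lemma automorphism_royal:
  assumes fg: "aut_pair f g" and x: "x \<in> royal_variety"
  shows "f x \<in> royal_variety"
proof -
  obtain z where z: "cmod z < 1" "x = sympt z z" using x by (auto simp: royal_variety_iff)
  have "sym_lift (- z) (sympt 0 0) = x" using z by (simp add: sym_lift_sympt)
  then show ?thesis
    using automorphism_origin_royal[OF aut_pair_compose[OF aut_pair_sym_lift[of "- z"] fg]] z by simp
qed

text \<open>
  The royal variety is preserved, so the derivative at the origin preserves its tangent direction;
  both it and its inverse are contractions for the l1 norm, so the second coordinate axis is
  preserved too. The image of the axis is then an analytic disc along which the second coordinate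
  and one magic function are both extremal, which forces the first coordinate to vanish.
\<close>
lemma automorphism_fixing_origin:
  assumes fg: "aut_pair f g" and f0: "f (sympt 0 0) = sympt 0 0"
  obtains y where "cmod y = 1" "\<And>z. cmod z < 1 \<Longrightarrow> f (vector [0, z]) = vector [0, y * z]"
proof -
  have oG: "sympt 0 0 \<in> sym_bidisc" by (simp add: sympt_in_sym_bidisc)
  have g0: "g (sympt 0 0) = sympt 0 0" using aut_pair_inverse[OF fg oG] f0 by simp
  define ax where "ax = axis_disc 0"
  have ax: "analytic_disc ax" unfolding ax_def by (rule axis_disc_analytic) simp
  have ax0: "ax 0 = sympt 0 0" by (simp add: ax_def vec2_eq_iff)
  have axd: "velocity ax 1 = 0" "velocity ax 2 = 1"
    unfolding ax_def by (simp_all only: axis_disc_velocity) simp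
  \<comment> \<open>On the royal variety the second coordinate is a quarter of the square of the first, hence of second order.\<close>
  have snd: "\<exists>B. ((\<lambda>p. k p $ 2) has_derivative (cform 0 B)) (at (sympt 0 0) within sym_bidisc)"
    if kl: "aut_pair k l" and k0: "k (sympt 0 0) = sympt 0 0" for k l
  proof -
    obtain A B where D: "((\<lambda>p. k p $ 2) has_derivative (cform A B)) (at (sympt 0 0) within sym_bidisc)"
      using kl oG unfolding aut_pair_def holomorphic2_on_iff by blast
    obtain A1 B1 where D1: "((\<lambda>p. k p $ 1) has_derivative (cform A1 B1)) (at (sympt 0 0) within sym_bidisc)"
      using kl oG unfolding aut_pair_def holomorphic2_on_iff by blast
    note ad = royal_disc_analytic and d = royal_disc_velocity
    have 2: "((\<lambda>z. k (sympt z z) $ 2) has_field_derivative A * 2) (at 0)"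
      using compose_disc_derivative[where f = "\<lambda>p. k p $ 2", OF D ad] d by simp
    have 1: "((\<lambda>z. k (sympt z z) $ 1) has_field_derivative A1 * 2) (at 0)"
      using compose_disc_derivative[where f = "\<lambda>p. k p $ 1", OF D1 ad] d by simp
    have k01: "k (sympt 0 0) $ 1 = 0" by (simp add: k0)
    have "((\<lambda>z. (k (sympt z z) $ 1)^2 / 4) has_field_derivative 2 * (A1 * 2) * (k (sympt 0 0) $ 1) / 4) (at 0)"
      by (auto intro!: derivative_eq_intros 1)
    then have "((\<lambda>z. (k (sympt z z) $ 1)^2 / 4) has_field_derivative 0) (at 0)"
      unfolding k01 by simp
    moreover have "((\<lambda>z. (k (sympt z z) $ 1)^2 / 4) has_field_derivative A * 2) (at 0)"
    proof (rule has_field_derivative_transform_within_open[where S = unit_disc, OF 2])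
      fix z :: complex assume "z \<in> unit_disc"
      then have "k (sympt z z) \<in> royal_variety"
        by (intro automorphism_royal[OF kl]) (auto simp: royal_variety_iff)
      then obtain w where "k (sympt z z) = sympt w w" by (auto simp: royal_variety_iff)
      then show "k (sympt z z) $ 2 = (k (sympt z z) $ 1)^2 / 4" by (simp add: power2_eq_square)
    qed auto
    ultimately have "A * 2 = 0" using DERIV_unique by blast
    then show ?thesis using D by auto
  qed
  obtain B where Bf: "((\<lambda>p. f p $ 2) has_derivative (cform 0 B)) (at (sympt 0 0) within sym_bidisc)"
    using snd[OF fg f0] by blast
  obtain B' where Bg: "((\<lambda>p. g p $ 2) has_derivative (\<lambda>v. 0 * v$1 + B' * v$2)) (at (sympt 0 0) within sym_bidisc)"
    using snd[OF aut_pair_commute[OF fg] g0] by blast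
  have fa: "analytic_disc (\<lambda>z. f (ax z))" by (rule analytic_disc_compose[OF ax fg])
  have ga: "analytic_disc (\<lambda>z. g (ax z))" by (rule analytic_disc_compose[OF ax aut_pair_commute[OF fg]])
  have df: "deriv (\<lambda>z. f (ax z) $ 2) 0 = B"
  proof -
    have "((\<lambda>p. f p $ 2) has_derivative (cform 0 B)) (at (ax 0) within sym_bidisc)"
      unfolding ax0 by (rule Bf)
    from DERIV_imp_deriv[OF compose_disc_derivative[where f = "\<lambda>p. f p $ 2", OF this ax]]
    show ?thesis by (simp add: axd)
  qed
  have dg: "deriv (\<lambda>z. g (ax z) $ 2) 0 = B'"
  proof -
    have "((\<lambda>p. g p $ 2) has_derivative (\<lambda>v. 0 * v$1 + B' * v$2)) (at (ax 0) within sym_bidisc)"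
      unfolding ax0 by (rule Bg)
    from DERIV_imp_deriv[OF compose_disc_derivative[where f = "\<lambda>p. g p $ 2", OF this ax]]
    show ?thesis by (simp add: axd)
  qed
  have nf: "cmod (deriv (\<lambda>z. f (ax z) $ 1) 0) / 2 + cmod B \<le> 1"
    using origin_disc_norm[OF fa] df by (simp add: ax0 f0)
  have "cmod (deriv (\<lambda>z. g (ax z) $ 1) 0) / 2 + cmod B' \<le> 1"
    using origin_disc_norm[OF ga] dg by (simp add: ax0 g0)
  then have ng: "cmod B' \<le> 1" using norm_ge_zero[of "deriv (\<lambda>z. g (ax z) $ 1) 0"] by linarith
  have "B' * B = 1"
  proof -
    have fa0: "f (ax 0) = sympt 0 0" by (simp add: ax0 f0)
    have "((\<lambda>p. g p $ 2) has_derivative (\<lambda>v. 0 * v$1 + B' * v$2)) (at (f (ax 0)) within sym_bidisc)"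
      unfolding fa0 by (rule Bg)
    from compose_disc_derivative[where f = "\<lambda>p. g p $ 2" and h = "\<lambda>z. f (ax z)", OF this fa]
    have "((\<lambda>z. g (f (ax z)) $ 2) has_field_derivative B' * B) (at 0)" by (simp add: df)
    moreover have "((\<lambda>z. g (f (ax z)) $ 2) has_field_derivative 1) (at 0)"
      by (rule has_field_derivative_transform_within_open[where S = unit_disc and f = "\<lambda>z. z"])
         (auto simp: aut_pair_inverse[OF fg] analytic_disc_in[OF ax], simp add: ax_def)
    ultimately show ?thesis by (rule DERIV_unique)
  qed
  then have "cmod B' * cmod B = 1" by (metis norm_mult norm_one)
  then have "1 \<le> cmod B" using mult_right_mono[OF ng, of "cmod B"] by simp
  then have "cmod (deriv (\<lambda>z. f (ax z) $ 1) 0) \<le> 0" and B1: "cmod B = 1"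
    using nf norm_ge_zero[of "deriv (\<lambda>z. f (ax z) $ 1) 0"] by linarith+
  then have B: "cmod B = 1" "deriv (\<lambda>z. f (ax z) $ 1) 0 = 0" by simp_all
  \<comment> \<open>Equality holds in Schwarz' lemma both for the second coordinate and for one of the magic functions.\<close>
  have P2: "(\<lambda>x. x$2) \<in> disc_functions"
    using snd_holomorphic2 norm_snd_less_one by auto
  have "\<exists>c. (\<forall>z. cmod z < 1 \<longrightarrow> f (ax z) $ 2 = c * z) \<and> deriv (\<lambda>z. f (ax z) $ 2) 0 = c"
    using schwarz_pick(3)[OF compose_disc[OF P2 fa]] df B by (simp add: ax0 f0)
  then have s2: "f (ax z) $ 2 = B * z" if "cmod z < 1" for z using df that by auto
  have dm: "deriv (\<lambda>z. magic 1 (f (ax z))) 0 = B"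
    using magic_disc_deriv[OF fa, of 0 1] B df by (simp add: ax0 f0)
  have m0: "magic 1 (f (ax 0)) = 0" by (simp add: ax0 f0 magic_def)
  have "\<exists>c. (\<forall>z. cmod z < 1 \<longrightarrow> magic 1 (f (ax z)) = c * z) \<and> deriv (\<lambda>z. magic 1 (f (ax z))) 0 = c"
    using schwarz_pick(3)[OF compose_disc[OF magic_in_disc_functions[of 1] fa]] dm B m0 by simp
  then have m: "magic 1 (f (ax z)) = B * z" if "cmod z < 1" for z using dm that by auto
  have "f (ax z) $ 1 = 0" if z: "cmod z < 1" for z
  proof -
    have n: "2 - f (ax z) $ 1 \<noteq> 0"
      using magic_denom_nonzero[of 1, OF _ analytic_disc_in[OF fa z]] by simp
    have "2 * (B * z) - f (ax z) $ 1 = B * z * (2 - f (ax z) $ 1)"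
      using m[OF z] n s2[OF z] by (simp add: magic_def divide_eq_eq)
    then have "f (ax z) $ 1 * (1 - B * z) = 0" by (simp add: algebra_simps)
    moreover have "cmod (B * z) < 1" using z B by (simp add: norm_mult)
    then have "1 - B * z \<noteq> 0" by auto
    ultimately show ?thesis by simp
  qed
  then show ?thesis
    using s2 by (intro that[OF B(1)]) (simp add: vec2_eq_iff ax_def)
qed

text \<open>
  The square of the difference of the two roots; its zero set is the royal variety.
\<close>
definition discr :: "complex^2 \<Rightarrow> complex" where
  "discr x = (x$1)^2 - 4 * x$2"

text \<open>
  For the point sympt z w this is |1 - cnj w * z|^2 + (1 - |z|^2) (1 - |w|^2). The ratio of the
  modulus of discr to it is a function of the pseudohyperbolic distance of z and w; in contrast to
  that distance it is given by polynomials in the coordinates and their conjugates, apart from the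
  modulus of discr.
\<close>
definition level_weight :: "complex^2 \<Rightarrow> real" where
  "level_weight x = 2 * (1 + (cmod (x$2))^2) - (cmod (x$1))^2"

lemma level_weight_sympt:
  "level_weight (sympt z w) = (cmod (1 - cnj w * z))^2 + (1 - (cmod z)^2) * (1 - (cmod w)^2)"
  unfolding level_weight_def
  by (simp add: norm_mult power_mult_distrib) (simp only: cmod_power2, simp add: power2_eq_square algebra_simps)

lemma discr_sympt: "discr (sympt z w) = (z - w)^2"
  by (simp add: discr_def power2_eq_square algebra_simps)

text \<open>
  Under a Moebius transformation both functions are multiplied by the same factor.
\<close>
lemma sym_lift_level:
  assumes b: "cmod b < 1" and x: "x \<in> sym_bidisc"
  shows "cmod (discr (sym_lift b x)) * level_weight x = cmod (discr x) * level_weight (sym_lift b x)"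
proof -
  obtain z w where zw: "cmod z < 1" "cmod w < 1" "x = sympt z w" using x by (rule sym_bidisc_cases)
  define p q where "p = 1 - cnj b * z" and "q = 1 - cnj b * w"
  have n: "p \<noteq> 0" "q \<noteq> 0" unfolding p_def q_def
    using disc_shift_denom_nonzero[OF b] zw by auto
  define s where "s = 1 - complex_of_real (cmod b)^2"
  have bb: "of_real (cmod b)^2 = b * cnj b" by (simp only: complex_norm_square[symmetric] of_real_power)
  define t where "t = (1 - (cmod b)^2) / (cmod p * cmod q)"
  have st: "cmod s = 1 - (cmod b)^2"
  proof -
    have "s = of_real (1 - (cmod b)^2)" by (simp add: s_def)
    moreover have "0 \<le> 1 - (cmod b)^2" using b by (simp add: power_le_one)
    ultimately show ?thesis by (metis abs_of_nonneg norm_of_real)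
  qed
  have 1: "disc_shift b z - disc_shift b w = (z - w) * s / (p * q)"
    using n unfolding disc_shift_def p_def [symmetric] q_def [symmetric]
    by (simp add: divide_simps) (simp add: p_def q_def s_def bb algebra_simps)
  have cq: "cnj q \<noteq> 0" using n by simp
  have 2: "1 - cnj (disc_shift b w) * disc_shift b z = (1 - cnj w * z) * s / (p * cnj q)"
  proof -
    have "cnj (disc_shift b w) = (cnj w - cnj b) / cnj q" by (simp add: disc_shift_def q_def)
    moreover have "disc_shift b z = (z - b) / p" by (simp add: disc_shift_def p_def)
    moreover have "cnj q * p - (cnj w - cnj b) * (z - b) = (1 - cnj w * z) * s"
      by (simp add: p_def q_def s_def bb algebra_simps)
    moreover have "1 - A / cnj q * (B / p) = (cnj q * p - A * B) / (p * cnj q)" for A B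
      using n cq by (simp add: divide_simps)
    ultimately show ?thesis by simp
  qed
  have d: "cmod (discr (sym_lift b x)) = cmod (discr x) * t^2"
    using zw b st by (simp add: sym_lift_sympt discr_sympt 1 norm_power norm_mult norm_divide t_def power_mult_distrib power_divide)
  have k: "level_weight (sym_lift b x) = level_weight x * t^2"
  proof -
    have "1 - (cmod (disc_shift b z))^2 = (1 - (cmod b)^2) * (1 - (cmod z)^2) / (cmod p)^2"
      "1 - (cmod (disc_shift b w))^2 = (1 - (cmod b)^2) * (1 - (cmod w)^2) / (cmod q)^2"
      using disc_shift_norm_identity n by (simp_all add: p_def q_def)
    moreover have "(cmod (1 - cnj (disc_shift b w) * disc_shift b z))^2 = (cmod (1 - cnj w * z))^2 * t^2"
      unfolding 2 using st by (simp add: norm_mult norm_divide t_def power_mult_distrib power_divide)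
    ultimately have "level_weight (sym_lift b x) = (cmod (1 - cnj w * z))^2 * t^2
        + ((1 - (cmod b)^2) * (1 - (cmod z)^2) / (cmod p)^2) * ((1 - (cmod b)^2) * (1 - (cmod w)^2) / (cmod q)^2)"
      using zw b by (simp add: sym_lift_sympt level_weight_sympt)
    also have "((1 - (cmod b)^2) * (1 - (cmod z)^2) / (cmod p)^2) * ((1 - (cmod b)^2) * (1 - (cmod w)^2) / (cmod q)^2)
        = (1 - (cmod z)^2) * (1 - (cmod w)^2) * t^2"
      by (simp add: t_def power_mult_distrib power_divide power2_eq_square mult_ac)
    finally show ?thesis unfolding zw(3) level_weight_sympt by (simp add: algebra_simps)
  qed
  show ?thesis unfolding d k by simp
qed

lemma level_weight_pos:
  assumes "x \<in> sym_bidisc" shows "0 < level_weight x"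
proof -
  obtain z w where zw: "cmod z < 1" "cmod w < 1" "x = sympt z w" using assms by (rule sym_bidisc_cases)
  then have "0 < (1 - (cmod z)^2) * (1 - (cmod w)^2)" by (simp add: abs_square_less_1)
  then show ?thesis unfolding zw(3) level_weight_sympt by (simp add: add_nonneg_pos)
qed

text \<open>
  Compose an automorphism with one induced from the disc so that the origin is fixed. The
  composition rotates the axis, which does not change the two functions, and the second factor
  preserves their ratio.
\<close>
lemma orbit_flat_axis_level:
  assumes x: "x \<in> flat_axis" and y: "y \<in> orbit_sym_bidisc x"
  shows "cmod (discr y) * level_weight x = cmod (discr x) * level_weight y"
proof -
  obtain f g where fg: "aut_pair f g" "y = f x"
    using y unfolding orbit_sym_bidisc_def biholomorphic_self_map_iff by blast
  have xG: "x \<in> sym_bidisc" using x flat_axis_subset by blast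
  have yG: "y \<in> sym_bidisc" using fg aut_pair_in xG by simp
  obtain b where b: "cmod b < 1" "f (sympt 0 0) = sympt b b"
    using automorphism_origin_royal[OF fg(1)] by (auto simp: royal_variety_iff)
  have k0: "sym_lift b (f (sympt 0 0)) = sympt 0 0" using b by (simp add: sym_lift_sympt)
  obtain e where e: "cmod e = 1" "\<And>z. cmod z < 1 \<Longrightarrow> sym_lift b (f (vector [0, z])) = vector [0, e * z]"
    using automorphism_fixing_origin[OF aut_pair_compose[OF fg(1) aut_pair_sym_lift[OF b(1)]] k0] by metis
  have "x = vector [0, x$2]" using x by (simp add: flat_axis_def vec2_eq_iff)
  then have "sym_lift b y = vector [0, e * x$2]" using e(2)[OF norm_snd_less_one[OF xG]] fg(2) by simp
  then have "cmod (discr (sym_lift b y)) = cmod (discr x)" "level_weight (sym_lift b y) = level_weight x"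
    using x e(1) by (simp_all add: discr_def level_weight_def flat_axis_def norm_mult)
  then show ?thesis using sym_lift_level[OF b(1) yG] by simp
qed

section \<open>Flat geodesics\<close>

text \<open>
  A nonconstant holomorphic function has an open image, and no open set consists of numbers with
  vanishing imaginary part.
\<close>
lemma holomorphic_real_valued_constant:
  assumes "q holomorphic_on unit_disc" "\<And>z. cmod z < 1 \<Longrightarrow> Im (q z) = 0" "cmod z < 1"
  shows "q z = q 0"
proof (rule ccontr)
  assume "q z \<noteq> q 0"
  then have "\<not> q constant_on unit_disc" using assms(3) unfolding constant_on_def by force
  then have "open (q ` unit_disc)"
    by (intro open_mapping_thm[OF assms(1)]) auto
  moreover have "q 0 \<in> q ` unit_disc" by auto
  ultimately obtain e where e: "0 < e" "ball (q 0) e \<subseteq> q ` unit_disc"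
    unfolding open_contains_ball by blast
  have "q 0 + of_real (e / 2) * \<i> \<in> ball (q 0) e" using e(1) by (simp add: dist_norm norm_mult)
  then obtain w where "cmod w < 1" "q w = q 0 + of_real (e / 2) * \<i>" using e(2) by auto
  then show False using assms(2)[of w] assms(2)[of 0] e(1) by simp
qed

text \<open>
  Divide S by 2z to obtain sigma. The inequality for parameter eta is an inequality for the real
  part of eta u with a fixed complex number u, and it holds with equality at eta = 1. So u is real
  and nonnegative, which says that (1 - sigma) / (1 - z sigma) is real for every z. Being
  holomorphic, this quotient is constant.
\<close>
lemma flat_analysis:
  fixes S P :: "complex \<Rightarrow> complex"
  assumes S: "S holomorphic_on unit_disc" "S 0 = 0" "deriv S 0 = 2 * of_real \<rho>"
    and le: "\<And>z \<eta>. cmod z < 1 \<Longrightarrow> cmod \<eta> = 1 \<Longrightarrow>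
      cmod (2 * \<eta> * P z - S z) \<le> cmod z * cmod (2 - \<eta> * S z)"
    and eq: "\<And>z. cmod z < 1 \<Longrightarrow> 2 * P z - S z = - z * (2 - S z)"
    and ne: "\<And>z. cmod z < 1 \<Longrightarrow> S z \<noteq> 2"
    and z: "cmod z < 1"
  shows "S z * (1 - (1 - of_real \<rho>) * z) = 2 * of_real \<rho> * z"
proof -
  obtain h where h: "h holomorphic_on unit_disc" "\<And>z. cmod z < 1 \<Longrightarrow> S z = z * h z" "deriv S 0 = h 0"
    using Schwarz3[OF S(1,2)] by metis
  define \<sigma> where "\<sigma> z = h z / 2" for z
  have Ss: "S z = 2 * z * \<sigma> z" if "cmod z < 1" for z using h(2)[OF that] by (simp add: \<sigma>_def)
  have "h 0 = 2 * of_real \<rho>" using h(3) S(3) by metis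
  then have s0: "\<sigma> 0 = of_real \<rho>" by (simp add: \<sigma>_def)
  have hol: "\<sigma> holomorphic_on unit_disc" unfolding \<sigma>_def [abs_def] by (intro holomorphic_intros h(1)) simp
  have n: "1 - z * \<sigma> z \<noteq> 0" if "cmod z < 1" for z
    using ne[OF that] Ss[OF that] by auto
  define q where "q z = (1 - \<sigma> z) / (1 - z * \<sigma> z)" for z
  have qhol: "q holomorphic_on unit_disc"
    unfolding q_def [abs_def] using n by (intro holomorphic_intros hol) auto
  have qreal: "Im (q z) = 0" if z: "cmod z < 1" for z
  proof (cases "z = 0")
    case True
    then show ?thesis by (simp add: q_def s0)
  next
    case False
    define A where "A = \<sigma> z * (1 + z) - 1"
    have "2 * P z = 2 * (z * A)"
      using eq[OF z] Ss[OF z] by (simp add: A_def algebra_simps)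
    then have Pz: "P z = z * A" by simp
    \<comment> \<open>Expanding the squares, the inequality for eta bounds the real part of eta * u by a constant C / 2.\<close>
    define u where "u = z * \<sigma> z - A * cnj (\<sigma> z)"
    have ineq: "cmod (\<eta> * A - \<sigma> z) \<le> cmod (1 - \<eta> * (z * \<sigma> z))" if "cmod \<eta> = 1" for \<eta>
    proof -
      have "2 * \<eta> * P z - S z = 2 * z * (\<eta> * A - \<sigma> z)" "2 - \<eta> * S z = 2 * (1 - \<eta> * (z * \<sigma> z))"
        by (simp_all add: Pz Ss[OF z] algebra_simps)
      with le[OF z that] have "cmod z * cmod (\<eta> * A - \<sigma> z) \<le> cmod z * cmod (1 - \<eta> * (z * \<sigma> z))"
        by (simp only: norm_mult) simp
      then show ?thesis using False by simp
    qed
    define C where "C = 1 + (cmod (z * \<sigma> z))^2 - (cmod A)^2 - (cmod (\<sigma> z))^2"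
    have expand: "(cmod (1 - \<eta> * (z * \<sigma> z)))^2 - (cmod (\<eta> * A - \<sigma> z))^2 = C - 2 * Re (\<eta> * u)"
      if "cmod \<eta> = 1" for \<eta>
    proof -
      have sq: "(cmod (a - b))^2 = (cmod a)^2 + (cmod b)^2 - 2 * Re (a * cnj b)" for a b
        by (simp only: cmod_power2) (simp add: power2_eq_square algebra_simps)
      have "Re (1 * cnj (\<eta> * (z * \<sigma> z))) = Re (\<eta> * (z * \<sigma> z))"
        by (simp only: mult_1 cnj.sel)
      moreover have "Re (\<eta> * u) = Re (\<eta> * (z * \<sigma> z)) - Re (\<eta> * A * cnj (\<sigma> z))"
        by (simp only: u_def right_diff_distrib mult.assoc minus_complex.sel)
      moreover have "(cmod (\<eta> * (z * \<sigma> z)))^2 = (cmod (z * \<sigma> z))^2" "(cmod (\<eta> * A))^2 = (cmod A)^2"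
        using that by (simp_all add: norm_mult[of \<eta>])
      ultimately show ?thesis unfolding sq C_def norm_one power_one by linarith
    qed
    have "A - \<sigma> z = - (1 - z * \<sigma> z)" by (simp add: A_def algebra_simps)
    then have "cmod (1 * A - \<sigma> z) = cmod (1 - 1 * (z * \<sigma> z))" by (simp only: mult_1 norm_minus_cancel)
    then have C: "C = 2 * Re u" using expand[of 1] by simp
    have Re_le: "Re (\<eta> * u) \<le> Re u" if "cmod \<eta> = 1" for \<eta>
      using expand[OF that] power_mono[OF ineq[OF that] norm_ge_zero, of 2] C by linarith
    have "u = of_real (cmod u)"
    proof (cases "u = 0")
      case False
      define e where "e = cnj u / of_real (cmod u)"
      have "e * u = of_real (cmod u)"
        using False complex_norm_square[of u] by (simp add: e_def field_simps power2_eq_square)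
      then have "cmod u \<le> Re u" using Re_le[of e] False by (simp add: e_def norm_divide)
      then show ?thesis by (rule Re_ge_norm_imp_of_real[OF order_refl])
    qed simp
    then have "Im u = 0" by (metis Im_complex_of_real)
    moreover have "Im ((1 - \<sigma> z) * cnj (1 - z * \<sigma> z)) = Im u"
      unfolding u_def A_def by (simp add: algebra_simps)
    moreover have "q z = (1 - \<sigma> z) * cnj (1 - z * \<sigma> z) / of_real ((cmod (1 - z * \<sigma> z))^2)"
      by (simp only: q_def complex_div_cnj[of "1 - \<sigma> z"] of_real_power)
    ultimately show ?thesis by (simp only: Im_divide_of_real div_0)
  qed
  have "q z = 1 - of_real \<rho>"
    using holomorphic_real_valued_constant[OF qhol qreal z] by (simp add: q_def s0)
  then have "1 - \<sigma> z = (1 - of_real \<rho>) * (1 - z * \<sigma> z)" using n[OF z] by (simp add: q_def divide_eq_eq)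
  then have "\<sigma> z * (1 - (1 - of_real \<rho>) * z) = of_real \<rho>" by (simp add: algebra_simps)
  then have "2 * z * (\<sigma> z * (1 - (1 - of_real \<rho>) * z)) = 2 * z * of_real \<rho>" by (simp only:)
  then show ?thesis unfolding Ss[OF z] by (simp only: mult_ac)
qed

lemma sequence_to_one:
  obtains t :: "nat \<Rightarrow> complex" where "t \<longlonglongrightarrow> 1" "\<And>n. cmod (t n) < 1"
proof
  have "(\<lambda>n. complex_of_real (1 - inverse (real (Suc n)))) \<longlonglongrightarrow> of_real (1 - 0)"
    by (intro tendsto_intros LIMSEQ_inverse_real_of_nat)
  then show "(\<lambda>n. complex_of_real (1 - inverse (real (Suc n)))) \<longlonglongrightarrow> 1" by simp
  fix n
  have "0 < inverse (real (Suc n))" "inverse (real (Suc n)) \<le> 1" by (auto simp: field_simps)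
  then show "cmod (complex_of_real (1 - inverse (real (Suc n)))) < 1" unfolding norm_of_real by linarith
qed

text \<open>
  The l1 norm of the initial velocity is 1, because the derivative of a left inverse has norm at
  most 1. Hence some magic function is extremal along H; a rotation of the parameter and of the
  bidisc turns it into the one with omega = 1, and the preceding lemma determines the disc up to a
  number rho in [0, 1]. For rho = 0 the disc is the axis; for positive rho the disc tends to a
  point (2y, y^2) when the rotated parameter tends to 1.
\<close>
lemma geodesic_through_origin:
  assumes H: "analytic_disc H" and \<Phi>: "\<Phi> \<in> disc_functions" "\<And>z. cmod z < 1 \<Longrightarrow> \<Phi> (H z) = z"
    and H0: "H 0 = sympt 0 0"
  shows "H ` unit_disc = flat_axis \<or> (\<exists>y. cmod y = 1 \<and> sympt y y \<in> closure (H ` unit_disc))"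
proof -
  define v w where "v = velocity H 1" and "w = velocity H 2"
  obtain A B where AB': "(\<Phi> has_derivative (cform A B)) (at (H 0) within sym_bidisc)"
    and Av': "A * velocity H 1 + B * velocity H 2 = 1"
    by (rule left_inverse_derivative[OF H \<Phi>]) (assumption, rule that)
  have Av: "A * v + B * w = 1" using Av' by (simp add: v_def w_def)
  have AB: "(\<Phi> has_derivative (cform A B)) (at (sympt 0 0) within sym_bidisc)" using AB' H0 by simp
  have "\<Phi> (sympt 0 0) = 0" using \<Phi>(2)[of 0] H0 by simp
  then have nA: "cmod A \<le> 1/2" "cmod B \<le> 1"
    using disc_function_derivative_at_origin[OF \<Phi>(1) AB] by simp_all
  have ge: "1 \<le> cmod v / 2 + cmod w"
  proof -
    have "1 \<le> cmod (A * v) + cmod (B * w)" using norm_triangle_ineq[of "A * v" "B * w"] Av by simp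
    also have "\<dots> \<le> 1/2 * cmod v + 1 * cmod w" unfolding norm_mult
      using nA by (intro add_mono mult_right_mono) auto
    finally show ?thesis by simp
  qed
  have le: "cmod v / 2 + cmod w \<le> 1" using origin_disc_norm[OF H H0] by (simp add: v_def w_def)
  obtain \<omega> where \<omega>: "cmod \<omega> = 1" "cmod v / 2 + cmod w \<le> cmod (- v / 2 + \<omega> * w)" by (rule l1_norm_attained)
  have dm: "deriv (\<lambda>z. magic \<omega> (H z)) 0 = - v / 2 + \<omega> * w"
    using magic_disc_deriv[OF H, of 0 \<omega>] H0 \<omega> by (simp add: v_def w_def)
  have m0: "magic \<eta> (H 0) = 0" for \<eta> by (simp add: H0 magic_def)
  have "\<exists>c. cmod c = 1 \<and> (\<forall>z. cmod z < 1 \<longrightarrow> disc_shift (magic \<omega> (H 0)) (magic \<omega> (H z)) = c * z)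
      \<and> deriv (\<lambda>z. magic \<omega> (H z)) 0 = c * (1 - (cmod (magic \<omega> (H 0)))^2)"
    by (rule schwarz_pick(3)[OF compose_disc[OF magic_in_disc_functions[OF \<omega>(1)] H]])
       (use \<omega>(2) ge in \<open>simp add: m0 dm\<close>)
  then obtain c where c0: "cmod c = 1" "\<forall>z. cmod z < 1 \<longrightarrow> disc_shift (magic \<omega> (H 0)) (magic \<omega> (H z)) = c * z"
    "deriv (\<lambda>z. magic \<omega> (H z)) 0 = c * (1 - (cmod (magic \<omega> (H 0)))^2)" by blast
  have c: "cmod c = 1" "\<And>z. cmod z < 1 \<Longrightarrow> magic \<omega> (H z) = c * z" "- v / 2 + \<omega> * w = c"
    using c0 by (simp_all add: m0 dm)
  have "- (1/2) * v + \<omega> * w = c" using c(3) by simp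
  then have "- (1/2) * v = c * of_real (cmod v / 2)"
    by (intro l1_norming_functional(1)[of _ \<omega> v w] le c(1)) (simp_all add: \<omega>)
  then have "- v = c * of_real (cmod v)" by simp
  then have vc: "v = - c * of_real (cmod v)" by (simp only: mult_minus_left minus_equation_iff[of v])
  define \<rho> where "\<rho> = cmod v / 2"
  have \<rho>: "0 \<le> \<rho>" "\<rho> \<le> 1" using le norm_ge_zero[of w] unfolding \<rho>_def by (simp, linarith)
  \<comment> \<open>Rotate the disc and the bidisc so that the extremal magic function becomes the one with parameter 1.\<close>
  define \<tau> where "\<tau> = - c * \<omega>"
  have \<tau>: "cmod \<tau> = 1" "\<tau> * cnj \<tau> = 1" "\<omega> * cnj \<omega> = 1" "cnj \<tau> * \<tau> = 1" "cnj \<omega> * \<omega> = 1"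
  proof -
    have unit: "x * cnj x = 1" if "cmod x = 1" for x
      using complex_norm_square[of x] that by simp
    show "cmod \<tau> = 1" using c(1) \<omega>(1) by (simp add: \<tau>_def norm_mult)
    then show "\<tau> * cnj \<tau> = 1" "cnj \<tau> * \<tau> = 1" using unit[of \<tau>] by (simp_all add: mult.commute)
    show "\<omega> * cnj \<omega> = 1" "cnj \<omega> * \<omega> = 1" using unit[OF \<omega>(1)] by (simp_all add: mult.commute)
  qed
  define S P where "S z = \<omega> * H (cnj \<tau> * z) $ 1" and "P z = \<omega>^2 * H (cnj \<tau> * z) $ 2" for z
  have in_disc: "cmod (cnj \<tau> * z) < 1" if "cmod z < 1" for z using that \<tau>(1) by (simp add: norm_mult)
  have S0: "S 0 = 0" by (simp add: S_def H0)
  have dS: "(S has_field_derivative \<omega> * (deriv (\<lambda>z. H z $ 1) (cnj \<tau> * z) * cnj \<tau>)) (at z)" if "cmod z < 1" for z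
  proof -
    have "((\<lambda>z. H (cnj \<tau> * z) $ 1) has_field_derivative deriv (\<lambda>z. H z $ 1) (cnj \<tau> * z) * cnj \<tau>) (at z)"
      using DERIV_chain2[where f = "\<lambda>z. H z $ 1" and g = "\<lambda>z. cnj \<tau> * z", OF analytic_disc_deriv[OF H in_disc[OF that]] DERIV_cmult_Id] .
    then show ?thesis unfolding S_def [abs_def] by (rule DERIV_cmult)
  qed
  have Shol: "S holomorphic_on unit_disc"
    unfolding holomorphic_on_def field_differentiable_def
  proof
    fix z :: complex assume "z \<in> unit_disc"
    then have "cmod z < 1" by simp
    from has_field_derivative_at_within[OF dS[OF this]]
    show "\<exists>f'. (S has_field_derivative f') (at z within unit_disc)" by blast
  qed
  have "deriv S 0 = \<omega> * (v * cnj \<tau>)" using DERIV_imp_deriv[OF dS[of 0]] by (simp add: v_def)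
  also have "\<dots> = (\<tau> * cnj \<tau>) * of_real (cmod v)" by (subst vc) (simp add: \<tau>_def)
  finally have S': "deriv S 0 = 2 * of_real \<rho>" by (simp add: \<tau> \<rho>_def)
  have SP: "cmod (2 * \<eta> * P z - S z) \<le> cmod z * cmod (2 - \<eta> * S z)" if z: "cmod z < 1" and \<eta>: "cmod \<eta> = 1" for z \<eta>
  proof -
    have w: "cmod (\<eta> * \<omega>) = 1" using \<eta> \<omega> by (simp add: norm_mult)
    have "cmod (magic (\<eta> * \<omega>) (H (cnj \<tau> * z))) \<le> cmod z"
      using schwarz_pick(1)[OF compose_disc[OF magic_in_disc_functions[OF w] H] in_disc[OF z]] \<tau>(1)
      by (simp add: m0 norm_mult)
    moreover have "2 * \<eta> * P z - S z = \<omega> * magic (\<eta> * \<omega>) (H (cnj \<tau> * z)) * (2 - \<eta> * S z)"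
      using magic_denom_nonzero[OF w analytic_disc_in[OF H in_disc[OF z]]]
      by (simp add: magic_def S_def P_def power2_eq_square mult.assoc) (simp add: algebra_simps)
    ultimately show ?thesis using \<omega>(1) by (simp add: norm_mult mult_right_mono)
  qed
  have SPeq: "2 * P z - S z = - z * (2 - S z)" if z: "cmod z < 1" for z
  proof -
    have "2 * P z - S z = \<omega> * magic \<omega> (H (cnj \<tau> * z)) * (2 - S z)"
      using magic_denom_nonzero[OF \<omega>(1) analytic_disc_in[OF H in_disc[OF z]]]
      by (simp add: magic_def S_def P_def power2_eq_square mult.assoc) (simp add: algebra_simps)
    also have "\<omega> * magic \<omega> (H (cnj \<tau> * z)) = - (\<tau> * cnj \<tau>) * z"
      unfolding c(2)[OF in_disc[OF z]] by (simp add: \<tau>_def)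
    finally show ?thesis by (simp add: \<tau>)
  qed
  have S2: "S z \<noteq> 2" if z: "cmod z < 1" for z
    using magic_denom_nonzero[OF \<omega>(1) analytic_disc_in[OF H in_disc[OF z]]] by (auto simp: S_def)
  have form: "S z * (1 - (1 - of_real \<rho>) * z) = 2 * of_real \<rho> * z" if "cmod z < 1" for z
    by (rule flat_analysis[OF Shol S0 S' SP SPeq S2 that])
  have H_back: "H (cnj \<tau> * z) = vector [cnj \<omega> * S z, (cnj \<omega>)^2 * P z]" for z
    using \<tau> by (simp add: vec2_eq_iff S_def P_def mult.assoc[symmetric] power_mult_distrib[symmetric])
  show ?thesis
  proof (cases "\<rho> = 0")
    case True
    have *: "H (cnj \<tau> * z) = vector [0, - ((cnj \<omega>)^2 * z)]" if z: "cmod z < 1" for z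
    proof -
      have "S z * (1 - z) = 0" using form[OF z] True by simp
      moreover have "1 - z \<noteq> 0" using z by auto
      ultimately have "S z = 0" by simp
      moreover have "P z = - z" using SPeq[OF z] \<open>S z = 0\<close> by simp
      ultimately show ?thesis by (simp add: H_back)
    qed
    have "H ` unit_disc = flat_axis"
    proof (intro equalityI subsetI)
      fix x assume "x \<in> H ` unit_disc"
      then obtain z where z: "cmod z < 1" "x = H z" by auto
      then have "cmod (\<tau> * z) < 1" "cnj \<tau> * (\<tau> * z) = z" using \<tau> by (simp_all add: norm_mult mult.assoc[symmetric])
      then have "x = vector [0, - ((cnj \<omega>)^2 * (\<tau> * z))]" using *[of "\<tau> * z"] z by metis
      then show "x \<in> flat_axis" using analytic_disc_in[OF H z(1)] z by (simp add: flat_axis_def)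
    next
      fix x assume x: "x \<in> flat_axis"
      define z where "z = - (\<omega>^2 * x$2)"
      have z: "cmod z < 1" using norm_snd_less_one[of x] x flat_axis_subset \<omega>(1)
        by (auto simp: z_def norm_mult norm_power)
      have "- ((cnj \<omega>)^2 * z) = x$2" using \<tau>(5) by (simp add: z_def mult.assoc[symmetric] power_mult_distrib[symmetric])
      then have "H (cnj \<tau> * z) = x" using *[OF z] x by (simp add: vec2_eq_iff flat_axis_def)
      then show "x \<in> H ` unit_disc" using in_disc[OF z] by force
    qed
    then show ?thesis ..
  next
    case False
    obtain t where t1: "t \<longlonglongrightarrow> 1" and tn: "\<And>n. cmod (t n) < 1" by (rule sequence_to_one) (rule that)
    have den: "1 - (1 - complex_of_real \<rho>) * t n \<noteq> 0" for n
    proof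
      assume "1 - (1 - complex_of_real \<rho>) * t n = 0"
      then have "cmod (of_real (1 - \<rho>) * t n) = 1" by simp
      then have "(1 - \<rho>) * cmod (t n) = 1" using \<rho> unfolding norm_mult norm_of_real by simp
      moreover have "(1 - \<rho>) * cmod (t n) \<le> 1 * cmod (t n)" using \<rho> by (intro mult_right_mono) auto
      ultimately show False using tn[of n] by simp
    qed
    have St: "S (t n) = 2 * of_real \<rho> * t n / (1 - (1 - of_real \<rho>) * t n)" for n
      using form[OF tn[of n]] den[of n] by (simp add: eq_divide_eq)
    have "(\<lambda>n. 2 * of_real \<rho> * t n / (1 - (1 - of_real \<rho>) * t n)) \<longlonglongrightarrow> 2 * of_real \<rho> * 1 / (1 - (1 - of_real \<rho>) * 1)"
      by (intro tendsto_intros t1) (use False in simp)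
    then have Sl: "(\<lambda>n. S (t n)) \<longlonglongrightarrow> 2" using False by (simp add: St)
    have Pt: "P (t n) = (S (t n) - t n * (2 - S (t n))) / 2" for n
      using SPeq[OF tn[of n]] by (simp add: field_simps)
    have "(\<lambda>n. (S (t n) - t n * (2 - S (t n))) / 2) \<longlonglongrightarrow> (2 - 1 * (2 - 2)) / 2"
      by (intro tendsto_intros t1 Sl) simp
    then have Pl: "(\<lambda>n. P (t n)) \<longlonglongrightarrow> 1" by (simp add: Pt)
    have "(\<lambda>n. H (cnj \<tau> * t n)) \<longlonglongrightarrow> sympt (cnj \<omega>) (cnj \<omega>)"
    proof (rule vec_tendstoI)
      fix i :: 2
      have "(\<lambda>n. cnj \<omega> * S (t n)) \<longlonglongrightarrow> cnj \<omega> * 2" "(\<lambda>n. (cnj \<omega>)^2 * P (t n)) \<longlonglongrightarrow> (cnj \<omega>)^2 * 1"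
        by (intro tendsto_intros Sl Pl)+
      then show "(\<lambda>n. H (cnj \<tau> * t n) $ i) \<longlonglongrightarrow> sympt (cnj \<omega>) (cnj \<omega>) $ i"
        using exhaust_2[of i] by (auto simp: H_back power2_eq_square mult_2_right)
    qed
    moreover have "H (cnj \<tau> * t n) \<in> H ` unit_disc" for n using in_disc[OF tn[of n]] by force
    ultimately have "sympt (cnj \<omega>) (cnj \<omega>) \<in> closure (H ` unit_disc)"
      unfolding closure_sequential by (intro exI[of _ "\<lambda>n. H (cnj \<tau> * t n)"]) auto
    then show ?thesis using \<omega>(1) by (intro disjI2 exI[of _ "cnj \<omega>"]) simp
  qed
qed

lemma sym_lift_has_derivative:
  assumes "affine2 1 (- cnj b) ((cnj b)^2) x \<noteq> 0"
  obtains A1 B1 A2 B2 where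
    "\<And>T. ((\<lambda>p. sym_lift b p $ 1) has_derivative (cform A1 B1)) (at x within T)"
    "\<And>T. ((\<lambda>p. sym_lift b p $ 2) has_derivative (cform A2 B2)) (at x within T)"
    "(sym_lift b has_derivative (\<lambda>v. vector [A1 * v$1 + B1 * v$2, A2 * v$1 + B2 * v$2])) (at x)"
proof -
  have q: "\<exists>A B. \<forall>T. ((\<lambda>x. affine2 n0 n1 n2 x / affine2 1 (- cnj b) ((cnj b)^2) x) has_derivative
      (cform A B)) (at x within T)" for n0 n1 n2
    by (intro exI allI) (rule affine2_quotient_has_derivative[OF assms])
  obtain A1 B1 where 1: "\<And>T. ((\<lambda>p. sym_lift b p $ 1) has_derivative (cform A1 B1)) (at x within T)"
    using q[of "- 2 * b" "1 + b * cnj b" "- 2 * cnj b"] by (auto simp: sym_lift_def)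
  obtain A2 B2 where 2: "\<And>T. ((\<lambda>p. sym_lift b p $ 2) has_derivative (cform A2 B2)) (at x within T)"
    using q[of "b^2" "- b" 1] by (auto simp: sym_lift_def)
  have "(sym_lift b has_derivative (\<lambda>v. vector [A1 * v$1 + B1 * v$2, A2 * v$1 + B2 * v$2])) (at x)"
    by (rule has_derivative_vec2) (use 1 2 in simp_all)
  with 1 2 show ?thesis using that by blast
qed

lemma sym_lift_isCont:
  assumes "affine2 1 (- cnj b) ((cnj b)^2) x \<noteq> 0"
  shows "isCont (sym_lift b) x"
  by (rule sym_lift_has_derivative[OF assms]) (rule has_derivative_continuous)

lemma isCont_closure_image:
  fixes f :: "'a::metric_space \<Rightarrow> 'b::metric_space"
  assumes "isCont f x" "x \<in> closure S"
  shows "f x \<in> closure (f ` S)"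
proof -
  obtain s where s: "\<And>n. s n \<in> S" "s \<longlonglongrightarrow> x" using assms(2) unfolding closure_sequential by blast
  have "(\<lambda>n. f (s n)) \<longlonglongrightarrow> f x" by (rule isCont_tendsto_compose[OF assms(1) s(2)])
  then show ?thesis unfolding closure_sequential using s(1) by (intro exI[of _ "\<lambda>n. f (s n)"]) auto
qed

text \<open>
  A left inverse sends a sequence of points of the geodesic that converges inside the domain to a
  convergent sequence of parameters.
\<close>
lemma geodesic_closed_in_sym_bidisc:
  assumes "geodesic F" "p \<in> closure F" "p \<in> sym_bidisc"
  shows "p \<in> F"
proof -
  obtain h \<Phi> where h: "analytic_disc h" and \<Phi>: "\<Phi> \<in> disc_functions" "\<And>z. cmod z < 1 \<Longrightarrow> \<Phi> (h z) = z"
    and F: "F = h ` unit_disc"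
    using assms(1) unfolding geodesic_def geodesic_param_iff by blast
  obtain s where s: "\<And>n. s n \<in> F" "s \<longlonglongrightarrow> p" using assms(2) unfolding closure_sequential by blast
  have "\<forall>n. \<exists>z. cmod z < 1 \<and> s n = h z"
  proof
    fix n
    have "s n \<in> h ` unit_disc" using s(1) F by simp
    then show "\<exists>z. cmod z < 1 \<and> s n = h z" by auto
  qed
  then obtain z where z: "\<And>n. cmod (z n) < 1" "\<And>n. s n = h (z n)" by metis
  have "\<exists>f'. (\<Phi> has_derivative f') (at p within sym_bidisc)"
    using \<Phi>(1) assms(3) unfolding holomorphic2_on_def by auto
  then have "continuous (at p within sym_bidisc) \<Phi>" using has_derivative_continuous by blast
  moreover have "\<forall>n. s n \<in> sym_bidisc" using z analytic_disc_in[OF h] by simp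
  ultimately have "(\<lambda>n. \<Phi> (s n)) \<longlonglongrightarrow> \<Phi> p"
    using s(2) unfolding continuous_within_sequentially o_def by blast
  then have zl: "z \<longlonglongrightarrow> \<Phi> p" using z \<Phi>(2) by simp
  have \<Phi>p: "cmod (\<Phi> p) < 1" by (rule disc_functions_norm[OF \<Phi>(1) assms(3)])
  have "(\<lambda>n. h (z n)) \<longlonglongrightarrow> h (\<Phi> p)"
  proof (rule vec_tendstoI)
    fix i
    have "isCont (\<lambda>z. h z $ i) (\<Phi> p)" by (rule DERIV_isCont[OF analytic_disc_deriv[OF h \<Phi>p]])
    from isCont_tendsto_compose[where g = "\<lambda>z. h z $ i", OF this zl]
    show "(\<lambda>n. h (z n) $ i) \<longlonglongrightarrow> h (\<Phi> p) $ i" .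
  qed
  moreover have "s = (\<lambda>n. h (z n))" using z(2) by auto
  ultimately have "s \<longlonglongrightarrow> h (\<Phi> p)" by simp
  with s(2) have "p = h (\<Phi> p)" by (rule LIMSEQ_unique)
  then show ?thesis unfolding F by (rule image_eqI) (simp add: \<Phi>p)
qed

text \<open>
  Move the royal point of F to the origin. If the resulting geodesic were not the axis, its
  closure would contain a point (2y, y^2) with |y| = 1; moving back, this would be a second common
  point of the closures of F and of the royal variety.
\<close>
lemma flat_geodesic_normal_form:
  assumes "flat_geodesic F"
  obtains b where "cmod b < 1" "sym_lift b ` F = flat_axis"
proof -
  obtain p where F: "geodesic F" and p: "p \<in> royal_variety" "closure F \<inter> closure royal_variety = {p}"
    using assms unfolding flat_geodesic_def by (elim conjE bexE) (rule that)
  obtain b where b: "cmod b < 1" "p = sympt b b" using p(1) by (auto simp: royal_variety_iff)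
  have pF: "p \<in> F"
  proof (rule geodesic_closed_in_sym_bidisc[OF F])
    show "p \<in> closure F" using p(2) by (metis IntD1 insertI1)
    show "p \<in> sym_bidisc" by (rule subsetD[OF royal_variety_subset p(1)])
  qed
  obtain h where h: "geodesic_param h F" using F unfolding geodesic_def by blast
  then have FG: "F \<subseteq> sym_bidisc" by (simp add: geodesic_param_iff analytic_disc_def)
  have g: "geodesic (sym_lift b ` F)"
    unfolding geodesic_def
    by (rule exI[of _ "\<lambda>z. sym_lift b (h z)"]) (rule geodesic_param_compose[OF h aut_pair_sym_lift[OF b(1)]])
  have "sym_lift b p = sympt 0 0" using b by (simp add: sym_lift_sympt)
  then have o: "sympt 0 0 \<in> sym_lift b ` F" using pF by (metis imageI)
  obtain H \<Phi> where H: "analytic_disc H" "\<Phi> \<in> disc_functions" "\<And>z. cmod z < 1 \<Longrightarrow> \<Phi> (H z) = z"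
      "sym_lift b ` F = H ` unit_disc" "H 0 = sympt 0 0"
    by (rule geodesic_through[OF g o]) (rule that)
  from geodesic_through_origin[OF H(1-3,5)] show ?thesis
  proof
    assume "H ` unit_disc = flat_axis"
    then show ?thesis using that[OF b(1)] H(4) by simp
  next
    assume "\<exists>y. cmod y = 1 \<and> sympt y y \<in> closure (H ` unit_disc)"
    then obtain y where y: "cmod y = 1" "sympt y y \<in> closure (sym_lift b ` F)" using H(4) by auto
    have b': "cmod (- b) < 1" using b by simp
    have "affine2 1 (- cnj (- b)) ((cnj (- b))^2) (sympt y y) \<noteq> 0"
      unfolding sym_lift_denom using disc_shift_denom_nonzero[OF b', of y] y(1) by simp
    then have cont: "isCont (sym_lift (- b)) (sympt y y)" by (rule sym_lift_isCont)
    have "sym_lift (- b) ` sym_lift b ` F = F"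
    proof -
      have "sym_lift (- b) (sym_lift b x) = x" if "x \<in> F" for x
        using sym_lift_inverse[OF b(1)] that FG by blast
      then show ?thesis by (simp add: image_image)
    qed
    then have 1: "sym_lift (- b) (sympt y y) \<in> closure F"
      using isCont_closure_image[OF cont y(2)] by simp
    have "sympt y y \<in> closure royal_variety"
    proof -
      obtain t where t1: "t \<longlonglongrightarrow> 1" and t: "\<And>n. cmod (t n) < 1" by (rule sequence_to_one) (rule that)
      have tn: "cmod (t n * y) < 1" for n using t[of n] y(1) by (simp add: norm_mult)
      have "(\<lambda>n. sympt (t n * y) (t n * y)) \<longlonglongrightarrow> sympt y y"
      proof (rule vec_tendstoI)
        fix i :: 2
        have "(\<lambda>n. t n * y + t n * y) \<longlonglongrightarrow> 1 * y + 1 * y" "(\<lambda>n. (t n * y) * (t n * y)) \<longlonglongrightarrow> (1 * y) * (1 * y)"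
          by (intro tendsto_intros t1)+
        then show "(\<lambda>n. sympt (t n * y) (t n * y) $ i) \<longlonglongrightarrow> sympt y y $ i"
          using exhaust_2[of i] by (auto simp del: mult_1_left)
      qed
      moreover have "sympt (t n * y) (t n * y) \<in> royal_variety" for n
        using tn[of n] by (auto simp: royal_variety_iff)
      ultimately show ?thesis unfolding closure_sequential
        by (intro exI[of _ "\<lambda>n. sympt (t n * y) (t n * y)"]) auto
    qed
    from isCont_closure_image[OF cont this] have "sym_lift (- b) (sympt y y) \<in> closure (sym_lift (- b) ` royal_variety)" .
    moreover have "sym_lift (- b) ` royal_variety \<subseteq> royal_variety"
      using automorphism_royal[OF aut_pair_sym_lift[OF b']] by blast
    ultimately have 2: "sym_lift (- b) (sympt y y) \<in> closure royal_variety"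
      using closure_mono by blast
    have "sym_lift (- b) (sympt y y) = p" using 1 2 p(2) by blast
    then have "sympt (disc_shift (- b) y) (disc_shift (- b) y) = sympt b b"
      using b y(1) by (simp add: sym_lift_sympt)
    then have "disc_shift (- b) y = b" by (simp add: vec2_eq_iff)
    moreover have n: "1 + cnj b * y \<noteq> 0" using disc_shift_denom_nonzero[OF b', of y] y(1) by simp
    ultimately have "y + b = b * (1 + cnj b * y)" by (simp add: disc_shift_def divide_eq_eq)
    then have "y * (1 - cnj b * b) = 0" by (simp add: algebra_simps)
    moreover have "1 - cnj b * b \<noteq> 0" using disc_shift_denom_nonzero[of b b] b by simp
    ultimately have "y = 0" by simp
    then show ?thesis using y(1) by simp
  qed
qed

section \<open>The sharp direction\<close>

lemma C1_differentiable_on_divide: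
  fixes f g :: "real \<Rightarrow> complex"
  assumes "f C1_differentiable_on S" "g C1_differentiable_on S" "\<And>t. t \<in> S \<Longrightarrow> g t \<noteq> 0"
  shows "(\<lambda>t. f t / g t) C1_differentiable_on S"
proof -
  obtain f' where f': "\<And>t. t \<in> S \<Longrightarrow> (f has_vector_derivative f' t) (at t)" "continuous_on S f'"
    using assms(1) unfolding C1_differentiable_on_def by blast
  obtain g' where g': "\<And>t. t \<in> S \<Longrightarrow> (g has_vector_derivative g' t) (at t)" "continuous_on S g'"
    using assms(2) unfolding C1_differentiable_on_def by blast
  have cf: "continuous_on S f" "continuous_on S g"
    by (intro continuous_at_imp_continuous_on ballI has_vector_derivative_continuous[OF f'(1)]
        has_vector_derivative_continuous[OF g'(1)]; assumption)+
  have "((\<lambda>t. f t / g t) has_vector_derivative (f' t / g t - f t * g' t / (g t * g t))) (at t)" if t: "t \<in> S" for t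
  proof -
    have "((\<lambda>t. f t / g t) has_derivative
        (\<lambda>h. - f t * (inverse (g t) * (h *\<^sub>R g' t) * inverse (g t)) + h *\<^sub>R f' t / g t)) (at t)"
      using f'(1)[OF t] g'(1)[OF t] assms(3)[OF t] unfolding has_vector_derivative_def
      by (intro has_derivative_divide)
    then show ?thesis unfolding has_vector_derivative_def
    proof (rule has_derivative_eq_rhs, intro ext)
      fix u :: real
      show "- f t * (inverse (g t) * (u *\<^sub>R g' t) * inverse (g t)) + u *\<^sub>R f' t / g t
          = u *\<^sub>R (f' t / g t - f t * g' t / (g t * g t))"
        unfolding scaleR_conv_of_real divide_inverse inverse_mult_distrib by algebra
    qed
  qed
  moreover have "continuous_on S (\<lambda>t. f' t / g t - f t * g' t / (g t * g t))"
    using assms(3) by (intro continuous_intros f'(2) g'(2) cf) auto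
  ultimately show ?thesis unfolding C1_differentiable_on_def
    by (intro exI[of _ "\<lambda>t. f' t / g t - f t * g' t / (g t * g t)"]) simp
qed

lemma C1_differentiable_on_vec2:
  fixes \<gamma> :: "real \<Rightarrow> complex^2"
  assumes "(\<lambda>t. \<gamma> t $ 1) C1_differentiable_on S" "(\<lambda>t. \<gamma> t $ 2) C1_differentiable_on S"
  shows "\<gamma> C1_differentiable_on S"
proof -
  obtain f' where f': "\<And>t. t \<in> S \<Longrightarrow> ((\<lambda>t. \<gamma> t $ 1) has_vector_derivative f' t) (at t)" "continuous_on S f'"
    using assms(1) unfolding C1_differentiable_on_def by blast
  obtain g' where g': "\<And>t. t \<in> S \<Longrightarrow> ((\<lambda>t. \<gamma> t $ 2) has_vector_derivative g' t) (at t)" "continuous_on S g'"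
    using assms(2) unfolding C1_differentiable_on_def by blast
  define D where "D t = (vector [f' t, g' t] :: complex^2)" for t
  have "(\<gamma> has_vector_derivative D t) (at t)" if t: "t \<in> S" for t
    unfolding has_vector_derivative_def
    by (rule has_derivative_vec2)
       (use f'(1)[OF t] g'(1)[OF t] in \<open>simp_all add: D_def has_vector_derivative_def\<close>)
  moreover have "continuous_on S D"
  proof -
    have "D = (\<lambda>t. \<chi> i. if i = 1 then f' t else g' t)"
      by (simp add: D_def vec2_eq_iff fun_eq_iff)
    moreover have "continuous_on S (\<lambda>t. (\<chi> i::2. if i = 1 then f' t else g' t))"
    proof (rule continuous_on_vec_lambda)
      fix i :: 2
      show "continuous_on S (\<lambda>t. if i = 1 then f' t else g' t)"
        using f'(2) g'(2) by (cases "i = 1") auto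
    qed
    ultimately show ?thesis by simp
  qed
  ultimately show ?thesis unfolding C1_differentiable_on_def by (intro exI[of _ D]) simp
qed

text \<open>
  Needed because the definition of the real tangent space asks for continuously differentiable
  curves.
\<close>
lemma C1_differentiable_on_sym_lift:
  fixes \<gamma> :: "real \<Rightarrow> complex^2"
  assumes \<gamma>: "(\<lambda>t. \<gamma> t $ 1) C1_differentiable_on S" "(\<lambda>t. \<gamma> t $ 2) C1_differentiable_on S"
    and "cmod b < 1" "\<gamma> ` S \<subseteq> sym_bidisc"
  shows "(\<lambda>t. sym_lift b (\<gamma> t)) C1_differentiable_on S"
proof -
  have aff: "(\<lambda>t. affine2 c0 c1 c2 (\<gamma> t)) C1_differentiable_on S" for c0 c1 c2
    unfolding affine2_def
    by (intro C1_differentiable_on_add C1_differentiable_on_mult C1_differentiable_on_const \<gamma>)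
  have nz: "affine2 1 (- cnj b) ((cnj b)^2) (\<gamma> t) \<noteq> 0" if "t \<in> S" for t
    using sym_lift_denom_nonzero[OF assms(3)] assms(4) that by blast
  show ?thesis
    by (rule C1_differentiable_on_vec2)
       (unfold sym_lift_def vector_2, intro C1_differentiable_on_divide aff nz, assumption,
        intro C1_differentiable_on_divide aff nz, assumption)
qed

lemma aut_pair_orbit:
  assumes "aut_pair M N" "x \<in> sym_bidisc" "y \<in> orbit_sym_bidisc x"
  shows "M y \<in> orbit_sym_bidisc (M x)"
proof -
  obtain f g where fg: "aut_pair f g" "y = f x"
    using assms(3) unfolding orbit_sym_bidisc_def biholomorphic_self_map_iff by blast
  have "aut_pair (\<lambda>z. M (f (N z))) (\<lambda>z. M (g (N z)))"
    using aut_pair_compose[OF aut_pair_commute[OF assms(1)] aut_pair_compose[OF fg(1) assms(1)]] by simp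
  moreover have "M y = M (f (N (M x)))" using fg(2) aut_pair_inverse[OF assms(1,2)] by simp
  ultimately show ?thesis unfolding orbit_sym_bidisc_def biholomorphic_self_map_iff
    by (intro CollectI exI[of _ "\<lambda>z. M (f (N z))"]) blast
qed

lemma cmod_square_has_real_derivative:
  fixes f :: "real \<Rightarrow> complex"
  assumes "(f has_vector_derivative f') (at t)"
  shows "((\<lambda>t. (cmod (f t))^2) has_real_derivative 2 * Re (cnj (f t) * f')) (at t)"
proof -
  have "((\<lambda>t. Re (f t)) has_vector_derivative Re f') (at t)" "((\<lambda>t. Im (f t)) has_vector_derivative Im f') (at t)"
    using assms by (auto intro: bounded_linear.has_vector_derivative bounded_linear_Re bounded_linear_Im)
  then have d: "((\<lambda>t. Re (f t)) has_real_derivative Re f') (at t)" "((\<lambda>t. Im (f t)) has_real_derivative Im f') (at t)"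
    by (simp_all add: has_real_derivative_iff_has_vector_derivative)
  show ?thesis unfolding cmod_power2
    by (rule derivative_eq_intros d refl)+ (simp add: algebra_simps)
qed

text \<open>
  Differentiate the level set equation. At a point of the royal variety the equation says that
  discr vanishes; elsewhere its square is differentiated, and the coefficients of the two sides do
  not match unless the velocity of the second coordinate is orthogonal to the position.
\<close>
lemma orbit_velocity_flat_axis:
  fixes \<delta> :: "real \<Rightarrow> complex^2"
  assumes e: "0 < e" and a: "\<delta> 0 \<in> flat_axis" and orb: "\<And>t. \<bar>t\<bar> < e \<Longrightarrow> \<delta> t \<in> orbit_sym_bidisc (\<delta> 0)"
    and d1: "((\<lambda>t. \<delta> t $ 1) has_vector_derivative v1) (at 0)"
    and d2: "((\<lambda>t. \<delta> t $ 2) has_vector_derivative v2) (at 0)"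
  shows "if \<delta> 0 $ 2 = 0 then v2 = 0 else Re (cnj (\<delta> 0 $ 2) * v2) = 0"
proof -
  define k c where "k = level_weight (\<delta> 0)" and "c = cmod (discr (\<delta> 0))"
  have level: "cmod (discr (\<delta> t)) * k = c * level_weight (\<delta> t)" if "\<bar>t\<bar> < e" for t
    unfolding k_def c_def by (rule orbit_flat_axis_level[OF a orb[OF that]])
  have z1: "\<delta> 0 $ 1 = 0" using a by (simp add: flat_axis_def)
  have aG: "\<delta> 0 \<in> sym_bidisc" using a flat_axis_subset by blast
  have k: "0 < k" unfolding k_def by (rule level_weight_pos[OF aG])
  have "((\<lambda>t. \<delta> t $ 1 * \<delta> t $ 1 - 4 * \<delta> t $ 2) has_vector_derivative
      (\<delta> 0 $ 1 * v1 + v1 * \<delta> 0 $ 1) - 4 * v2) (at 0)"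
    by (rule has_vector_derivative_diff[OF has_vector_derivative_mult[OF d1 d1]
          bounded_linear.has_vector_derivative[OF bounded_linear_mult_right d2]])
  then have dd: "((\<lambda>t. discr (\<delta> t)) has_vector_derivative - 4 * v2) (at 0)"
    by (simp add: z1 discr_def power2_eq_square)
  show ?thesis
  proof (cases "\<delta> 0 $ 2 = 0")
    case True
    then have "c = 0" by (simp add: c_def discr_def z1)
    then have "discr (\<delta> t) = 0" if "\<bar>t\<bar> < e" for t using level[OF that] k by simp
    then have z: "\<And>t. t \<in> {-e<..<e} \<Longrightarrow> 0 = discr (\<delta> t)" by auto
    have "((\<lambda>t. discr (\<delta> t)) has_vector_derivative 0) (at 0)"
      by (rule has_vector_derivative_transform_within_open[where S = "{-e<..<e}" and f = "\<lambda>t. 0"])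
         (use e z in auto)
    with dd have "- 4 * v2 = 0" by (rule vector_derivative_unique_at)
    then show ?thesis using True by simp
  next
    case False
    define R where "R = Re (cnj (\<delta> 0 $ 2) * v2)"
    define K where "K t = 2 * (1 + (cmod (\<delta> t $ 2))^2) - (cmod (\<delta> t $ 1))^2" for t
    have K: "(K has_real_derivative 4 * R) (at 0)"
      unfolding K_def [abs_def]
      by (rule derivative_eq_intros cmod_square_has_real_derivative[OF d1] cmod_square_has_real_derivative[OF d2] refl)+
         (simp add: z1 R_def)
    have n: "((\<lambda>t. (cmod (discr (\<delta> t)))^2) has_real_derivative 32 * R) (at 0)"
      using cmod_square_has_real_derivative[OF dd] by (simp add: discr_def z1 R_def algebra_simps)
    have "((\<lambda>t. (cmod (discr (\<delta> t)))^2 * k^2) has_real_derivative 32 * R * k^2) (at 0)"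
      by (rule DERIV_cmult_right[OF n])
    moreover have "((\<lambda>t. (cmod (discr (\<delta> t)))^2 * k^2) has_real_derivative c^2 * (2 * K 0 * (4 * R))) (at 0)"
    proof (rule has_field_derivative_transform_within_open[where S = "{-e<..<e}" and f = "\<lambda>t. c^2 * (K t)^2"])
      show "((\<lambda>t. c^2 * (K t)^2) has_real_derivative c^2 * (2 * K 0 * (4 * R))) (at 0)"
        by (auto intro!: derivative_eq_intros K)
      fix t assume "t \<in> {-e<..<e}"
      then have "cmod (discr (\<delta> t)) * k = c * K t" using level[of t] by (auto simp: K_def level_weight_def)
      then show "c^2 * (K t)^2 = (cmod (discr (\<delta> t)))^2 * k^2" by (metis power_mult_distrib)
    qed (use e in auto)
    ultimately have "32 * R * k^2 = c^2 * (2 * K 0 * (4 * R))" by (rule DERIV_unique)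
    moreover have k0: "K 0 = k" by (simp add: K_def k_def level_weight_def)
    define s where "s = (cmod (\<delta> 0 $ 2))^2"
    have c2: "c^2 = 16 * s" by (simp add: c_def discr_def z1 norm_mult power_mult_distrib s_def)
    have ks: "k = 2 + 2 * s" by (simp add: k_def level_weight_def z1 s_def)
    have s1: "s < 1" using norm_snd_less_one[OF aG] by (simp add: s_def abs_square_less_1)
    ultimately have "32 * k * (R * (2 - 2 * s)) = 0"
      unfolding k0 c2 by (simp add: ks power2_eq_square algebra_simps)
    then have "R = 0" using k s1 by simp
    then show ?thesis using False by (simp add: R_def)
  qed
qed

lemma complex_line_iff:
  "vec.subspace (L :: (complex^2) set) \<and> vec.dim L = 1 \<longleftrightarrow> (\<exists>w. w \<noteq> 0 \<and> L = range (\<lambda>c. c *s w))"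
proof
  assume L: "vec.subspace L \<and> vec.dim L = 1"
  obtain B where B: "B \<subseteq> L" "vec.independent B" "L \<subseteq> vec.span B" "card B = vec.dim L"
    using vec.basis_exists by blast
  then obtain w where w: "B = {w}" using L card_1_singletonE by metis
  have "w \<noteq> 0" using B(2) w vec.dependent_zero by auto
  moreover have "L = vec.span {w}" using B L w vec.span_minimal by blast
  ultimately show "\<exists>w. w \<noteq> 0 \<and> L = range (\<lambda>c. c *s w)" using vec.span_singleton by blast
next
  assume "\<exists>w. w \<noteq> 0 \<and> L = range (\<lambda>c. c *s w)"
  then obtain w where w: "w \<noteq> 0" "L = vec.span {w}" using vec.span_singleton by blast
  have "vec.independent {w}" using w(1) by (simp add: vec.dependent_single)
  then have "vec.dim {w} = 1" using vec.dim_eq_card_independent by fastforce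
  then show "vec.subspace L \<and> vec.dim L = 1" using w(2) vec.subspace_span vec.dim_span by metis
qed

lemma kernel_eq_line:
  fixes w :: "complex^2"
  assumes "A \<noteq> 0 \<or> B \<noteq> 0" "w \<noteq> 0" "A * w$1 + B * w$2 = 0"
  shows "{v. A * v$1 + B * v$2 = 0} = range (\<lambda>c. c *s w)"
proof (intro equalityI subsetI)
  fix v :: "complex^2" assume "v \<in> {v. A * v$1 + B * v$2 = 0}"
  then have v: "A * v$1 = - B * v$2" by (simp add: add_eq_0_iff)
  have w: "A * w$1 = - B * w$2" using assms(3) by (simp add: add_eq_0_iff)
  have "A * (v$1 * w$2 - v$2 * w$1) = (A * v$1) * w$2 - v$2 * (A * w$1)" by (simp add: algebra_simps)
  also have "\<dots> = 0" unfolding v w by simp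
  finally have 1: "A * (v$1 * w$2 - v$2 * w$1) = 0" .
  have "B * (v$1 * w$2 - v$2 * w$1) = - v$1 * (- B * w$2) + (- B * v$2) * w$1" by (simp add: algebra_simps)
  also have "\<dots> = 0" unfolding v[symmetric] w[symmetric] by simp
  finally have "B * (v$1 * w$2 - v$2 * w$1) = 0" .
  with 1 have d: "v$1 * w$2 = v$2 * w$1" using assms(1) by auto
  show "v \<in> range (\<lambda>c. c *s w)"
  proof (cases "w$1 = 0")
    case False
    then have "v = (v$1 / w$1) *s w" using d by (simp add: vec2_eq_iff field_simps)
    then show ?thesis by blast
  next
    case True
    then have "w$2 \<noteq> 0" using assms(2) by (simp add: vec2_eq_iff)
    then have "v = (v$2 / w$2) *s w" using d True by (simp add: vec2_eq_iff field_simps)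
    then show ?thesis by blast
  qed
next
  fix v :: "complex^2" assume "v \<in> range (\<lambda>c. c *s w)"
  then obtain c where "v = c *s w" by blast
  then have "A * v$1 + B * v$2 = c * (A * w$1 + B * w$2)" by (simp add: algebra_simps)
  then show "v \<in> {v. A * v$1 + B * v$2 = 0}" using assms(3) by simp
qed

lemma orbit_velocity_sym_lift:
  assumes b: "cmod b < 1" and x: "x \<in> sym_bidisc" and Mx: "sym_lift b x \<in> flat_axis"
    and D1: "((\<lambda>p. sym_lift b p $ 1) has_derivative (cform C E)) (at x)"
    and D2: "((\<lambda>p. sym_lift b p $ 2) has_derivative (cform A B)) (at x)"
    and v: "v \<in> real_tangent_space (orbit_sym_bidisc x) x"
  shows "if sym_lift b x $ 2 = 0 then A * v$1 + B * v$2 = 0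
    else Re (cnj (sym_lift b x $ 2) * (A * v$1 + B * v$2)) = 0"
proof -
  obtain \<gamma> e where e: "0 < e" and \<gamma>: "\<gamma> ` {-e<..<e} \<subseteq> orbit_sym_bidisc x" "\<gamma> 0 = x"
      "(\<gamma> has_vector_derivative v) (at 0)"
    using v unfolding real_tangent_space_def by blast
  have comp: "((\<lambda>t. sym_lift b (\<gamma> t) $ i) has_vector_derivative P * v$1 + Q * v$2) (at 0)"
    if "((\<lambda>p. sym_lift b p $ i) has_derivative (cform P Q)) (at x)" for i P Q
  proof -
    have "((\<lambda>p. sym_lift b p $ i) has_derivative (cform P Q)) (at (\<gamma> 0))" using that \<gamma>(2) by simp
    from has_derivative_compose[OF \<gamma>(3)[unfolded has_vector_derivative_def] this]
    have "((\<lambda>t. sym_lift b (\<gamma> t) $ i) has_derivative (\<lambda>t. P * (t *\<^sub>R v)$1 + Q * (t *\<^sub>R v)$2)) (at 0)" .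
    then show ?thesis unfolding has_vector_derivative_def
      by (rule has_derivative_eq_rhs) (simp add: fun_eq_iff scaleR_right_distrib)
  qed
  have "sym_lift b (\<gamma> t) \<in> orbit_sym_bidisc (sym_lift b (\<gamma> 0))" if "\<bar>t\<bar> < e" for t
  proof -
    have "t \<in> {-e<..<e}" using that by (simp add: abs_less_iff)
    then have "\<gamma> t \<in> orbit_sym_bidisc x" using \<gamma>(1) by blast
    from aut_pair_orbit[OF aut_pair_sym_lift[OF b] x this] show ?thesis by (simp add: \<gamma>(2))
  qed
  note orb = this
  have "sym_lift b (\<gamma> 0) \<in> flat_axis" using Mx by (simp only: \<gamma>(2))
  from orbit_velocity_flat_axis[of e "\<lambda>t. sym_lift b (\<gamma> t)", OF e this orb comp[OF D1] comp[OF D2]]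
  show ?thesis unfolding \<gamma>(2) .
qed

text \<open>
  The curve moves y by the translations of the disc with parameters proportional to t. Its
  velocity at y is (2 (alpha + cnj alpha * a), 0), where a is the second coordinate of y, and
  since |a| < 1 every complex number occurs as the first component.
\<close>
lemma sym_lift_curve_tangent:
  assumes b: "cmod b < 1" and y: "y \<in> flat_axis"
    and D: "(sym_lift (- b) has_derivative (\<lambda>v. vector [A1 * v$1 + B1 * v$2, A2 * v$1 + B2 * v$2])) (at y)"
  shows "vector [A1 * \<kappa>, A2 * \<kappa>]
    \<in> real_tangent_space (orbit_sym_bidisc (sym_lift (- b) y)) (sym_lift (- b) y)"
proof -
  have yG: "y \<in> sym_bidisc" using y flat_axis_subset by blast
  have b': "cmod (- b) < 1" using b by simp
  define a where "a = y $ 2"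
  have y1: "y $ 1 = 0" using y by (simp add: flat_axis_def)
  have a: "cmod a < 1" unfolding a_def by (rule norm_snd_less_one[OF yG])
  define d where "d = 1 - a * cnj a"
  have d: "d \<noteq> 0" "cnj d = d"
    using disc_shift_denom_nonzero[of a a] a by (simp_all add: d_def mult.commute)
  \<comment> \<open>The solution of the real-linear equation that makes kappa the first component of the velocity.\<close>
  define \<alpha> where "\<alpha> = (\<kappa> - a * cnj \<kappa>) / (2 * d)"
  have \<alpha>: "2 * \<alpha> + 2 * cnj \<alpha> * a = \<kappa>"
  proof -
    have "cnj \<alpha> = (cnj \<kappa> - cnj a * \<kappa>) / (2 * d)" by (simp add: \<alpha>_def d(2))
    moreover have half: "2 * (X / (2 * d)) = X / d" for X by simp
    ultimately have "2 * cnj \<alpha> = (cnj \<kappa> - cnj a * \<kappa>) / d" by (simp only:)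
    moreover have "2 * \<alpha> = (\<kappa> - a * cnj \<kappa>) / d" unfolding \<alpha>_def by (rule half)
    ultimately have "2 * \<alpha> + 2 * cnj \<alpha> * a = ((\<kappa> - a * cnj \<kappa>) + (cnj \<kappa> - cnj a * \<kappa>) * a) / d"
      by (simp only: add_divide_distrib times_divide_eq_left)
    also have "(\<kappa> - a * cnj \<kappa>) + (cnj \<kappa> - cnj a * \<kappa>) * a = \<kappa> * d" by (simp add: d_def algebra_simps)
    finally show ?thesis using d(1) by simp
  qed
  define e where "e = 1 / (1 + cmod \<alpha>)"
  have e: "0 < e" by (simp add: e_def add_pos_nonneg)
  have small: "cmod (- (of_real t * \<alpha>)) < 1" if "t \<in> {-e<..<e}" for t
  proof -
    have "\<bar>t\<bar> < e" using that by (simp add: abs_less_iff)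
    then have "\<bar>t\<bar> * (1 + cmod \<alpha>) < 1" by (simp add: e_def pos_less_divide_eq add_pos_nonneg)
    then have "\<bar>t\<bar> + \<bar>t\<bar> * cmod \<alpha> < 1" by (simp add: algebra_simps)
    then show ?thesis using abs_ge_zero[of t] by (simp add: norm_mult)
  qed
  define c where "c t = sym_lift (- (of_real t * \<alpha>)) y" for t :: real
  define q where "q z = 1 + (cnj \<alpha>)^2 * a * z^2" for z
  define g1 g2 where "g1 z = (2 * \<alpha> + 2 * cnj \<alpha> * a) * z / q z" and "g2 z = (\<alpha>^2 * z^2 + a) / q z" for z
  have q_eq: "affine2 1 (- cnj (- (of_real t * \<alpha>))) ((cnj (- (of_real t * \<alpha>)))^2) y = q (of_real t)" for t
    by (simp add: affine2_def y1 a_def q_def power_mult_distrib mult_ac)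
  have c1: "c t $ 1 = g1 (of_real t)" for t
    unfolding c_def sym_lift_def vector_2 q_eq g1_def
    by (simp add: affine2_def y1 a_def algebra_simps)
  have c2: "c t $ 2 = g2 (of_real t)" for t
    unfolding c_def sym_lift_def vector_2 q_eq g2_def
    by (simp add: affine2_def y1 a_def power_mult_distrib algebra_simps)
  have qt: "q (of_real t) \<noteq> 0" if "t \<in> {-e<..<e}" for t
    using sym_lift_denom_nonzero[OF small[OF that] yG] unfolding q_eq .
  have q0: "q 0 = 1" by (simp add: q_def)
  have "(q has_field_derivative 0) (at 0)"
    unfolding q_def [abs_def] by (auto intro!: derivative_eq_intros)
  then have g': "(g1 has_field_derivative \<kappa>) (at 0)" "(g2 has_field_derivative 0) (at 0)"
    unfolding g1_def [abs_def] g2_def [abs_def] \<alpha> using q0 by (auto intro!: derivative_eq_intros)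
  have cd: "(c has_derivative (\<lambda>t. vector [t *\<^sub>R \<kappa>, t *\<^sub>R 0])) (at 0)"
  proof (rule has_derivative_vec2)
    show "((\<lambda>t. c t $ 1) has_derivative (\<lambda>t. (vector [t *\<^sub>R \<kappa>, t *\<^sub>R 0] :: complex^2) $ 1)) (at 0)"
      using has_vector_derivative_real_field[of g1 \<kappa> 0 UNIV] g'(1)
      by (simp add: c1 has_vector_derivative_def)
    show "((\<lambda>t. c t $ 2) has_derivative (\<lambda>t. (vector [t *\<^sub>R \<kappa>, t *\<^sub>R 0] :: complex^2) $ 2)) (at 0)"
      using has_vector_derivative_real_field[of g2 0 0 UNIV] g'(2)
      by (simp add: c2 has_vector_derivative_def)
  qed
  have qC1: "(\<lambda>t. q (of_real t)) C1_differentiable_on {-e<..<e}"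
    unfolding q_def power2_eq_square
    by (intro C1_differentiable_on_add C1_differentiable_on_mult C1_differentiable_on_const C1_differentiable_on_of_real)
  have poly: "(\<lambda>t. k0 + k1 * of_real t + k2 * (of_real t * of_real t)) C1_differentiable_on {-e<..<e}" for k0 k1 k2 :: complex
    by (intro C1_differentiable_on_add C1_differentiable_on_mult C1_differentiable_on_const C1_differentiable_on_of_real)
  have cC1: "(\<lambda>t. c t $ 1) C1_differentiable_on {-e<..<e}" "(\<lambda>t. c t $ 2) C1_differentiable_on {-e<..<e}"
    using C1_differentiable_on_divide[OF poly[of 0 "2 * \<alpha> + 2 * cnj \<alpha> * a" 0] qC1 qt]
      C1_differentiable_on_divide[OF poly[of a 0 "\<alpha>^2"] qC1 qt]
    by (simp_all add: c1 c2 g1_def g2_def power2_eq_square add.commute)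
  have cG: "c ` {-e<..<e} \<subseteq> sym_bidisc"
    unfolding c_def by (intro image_subsetI sym_lift_in small yG)
  have c0: "c 0 = y" using g1_def g2_def q0 by (simp add: vec2_eq_iff c1 c2 y1 a_def)
  define \<gamma> where "\<gamma> t = sym_lift (- b) (c t)" for t
  have "\<gamma> C1_differentiable_on {-e<..<e}"
    unfolding \<gamma>_def [abs_def] by (rule C1_differentiable_on_sym_lift[OF cC1 b' cG])
  moreover have "\<gamma> ` {-e<..<e} \<subseteq> orbit_sym_bidisc (sym_lift (- b) y)"
  proof (rule image_subsetI)
    fix t assume "t \<in> {-e<..<e}"
    then have t: "cmod (- (of_real t * \<alpha>)) < 1" by (rule small)
    have "c t \<in> orbit_sym_bidisc y"
      unfolding orbit_sym_bidisc_def biholomorphic_self_map_iff c_def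
      using aut_pair_sym_lift[OF t] by blast
    then show "\<gamma> t \<in> orbit_sym_bidisc (sym_lift (- b) y)"
      unfolding \<gamma>_def by (rule aut_pair_orbit[OF aut_pair_sym_lift[OF b'] yG])
  qed
  moreover have "\<gamma> 0 = sym_lift (- b) y" by (simp add: \<gamma>_def c0)
  moreover have "(\<gamma> has_vector_derivative vector [A1 * \<kappa>, A2 * \<kappa>]) (at 0)"
  proof -
    have "(sym_lift (- b) has_derivative (\<lambda>v. vector [A1 * v$1 + B1 * v$2, A2 * v$1 + B2 * v$2])) (at (c 0))"
      using D c0 by simp
    from has_derivative_compose[OF cd this]
    show ?thesis unfolding has_vector_derivative_def \<gamma>_def [abs_def]
      by (rule has_derivative_eq_rhs) (simp add: fun_eq_iff vec2_eq_iff)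
  qed
  ultimately show ?thesis unfolding real_tangent_space_def using e by blast
qed

text \<open>
  The two derivatives are inverse to each other. Evaluating them on the velocities of the
  orthogonal disc and of the axis yields the entries that are needed.
\<close>
lemma sym_lift_derivative_inverse:
  assumes b: "cmod b < 1" and y: "y \<in> flat_axis"
    and D1: "((\<lambda>p. sym_lift b p $ 1) has_derivative (cform C E)) (at (sym_lift (- b) y) within sym_bidisc)"
    and D2: "((\<lambda>p. sym_lift b p $ 2) has_derivative (cform A B)) (at (sym_lift (- b) y) within sym_bidisc)"
    and N1: "((\<lambda>p. sym_lift (- b) p $ 1) has_derivative (cform A1 B1)) (at y within sym_bidisc)"
    and N2: "((\<lambda>p. sym_lift (- b) p $ 2) has_derivative (cform A2 B2)) (at y within sym_bidisc)"
  shows "C * A1 + E * A2 = 1" "A * A1 + B * A2 = 0" "A * B1 + B * B2 = 1"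
proof -
  obtain \<beta> where \<beta>: "cmod \<beta> < 1" "y = sympt \<beta> (- \<beta>)" using y by (rule flat_axis_cases)
  have b': "cmod (- b) < 1" using b by simp
  have inv: "P * (A1 * velocity k 1 + B1 * velocity k 2)
      + Q * (A2 * velocity k 1 + B2 * velocity k 2) = velocity k i"
    if k: "analytic_disc k" "k 0 = y"
      and PQ: "((\<lambda>p. sym_lift b p $ i) has_derivative (cform P Q)) (at (sym_lift (- b) y) within sym_bidisc)"
    for k P Q i
  proof -
    note Nk = analytic_disc_compose[OF k(1) aut_pair_sym_lift[OF b']]
    have n1: "deriv (\<lambda>z. sym_lift (- b) (k z) $ 1) 0 = A1 * velocity k 1 + B1 * velocity k 2"
      by (rule DERIV_imp_deriv[OF compose_disc_derivative[where f = "\<lambda>p. sym_lift (- b) p $ 1" and z = 0, OF _ k(1)]])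
         (use N1 k(2) in simp_all)
    have n2: "deriv (\<lambda>z. sym_lift (- b) (k z) $ 2) 0 = A2 * velocity k 1 + B2 * velocity k 2"
      by (rule DERIV_imp_deriv[OF compose_disc_derivative[where f = "\<lambda>p. sym_lift (- b) p $ 2" and z = 0, OF _ k(1)]])
         (use N2 k(2) in simp_all)
    have PQ': "((\<lambda>p. sym_lift b p $ i) has_derivative (cform P Q)) (at (sym_lift (- b) (k 0)) within sym_bidisc)"
      using PQ k(2) by simp
    have "((\<lambda>z. sym_lift b (sym_lift (- b) (k z)) $ i) has_field_derivative
        P * (A1 * velocity k 1 + B1 * velocity k 2)
        + Q * (A2 * velocity k 1 + B2 * velocity k 2)) (at 0)"
      using compose_disc_derivative[where f = "\<lambda>p. sym_lift b p $ i" and h = "\<lambda>z. sym_lift (- b) (k z)", OF PQ' Nk]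
      by (simp add: n1 n2)
    then have "((\<lambda>z. k z $ i) has_field_derivative
        P * (A1 * velocity k 1 + B1 * velocity k 2)
        + Q * (A2 * velocity k 1 + B2 * velocity k 2)) (at 0)"
      by (rule has_field_derivative_transform_within_open[where S = unit_disc])
         (use sym_lift_inverse[OF b'] analytic_disc_in[OF k(1)] in auto)
    then show ?thesis by (rule DERIV_imp_deriv[symmetric])
  qed
  define t where "t = - 2 * (1 - complex_of_real (cmod \<beta>)^2)"
  have t: "t \<noteq> 0"
  proof -
    have "t = of_real (- 2 * (1 - (cmod \<beta>)^2))" by (simp add: t_def)
    moreover have "- 2 * (1 - (cmod \<beta>)^2) \<noteq> 0" using \<beta>(1) by (simp add: abs_square_eq_1)
    ultimately show ?thesis by (metis of_real_eq_0_iff)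
  qed
  note od = orth_disc_analytic[OF \<beta>(1)] orth_disc_zero[of \<beta>, folded \<beta>(2)]
  note dd = orth_disc_deriv[OF \<beta>(1)]
  have "(C * A1 + E * A2) * t = t" "(A * A1 + B * A2) * t = 0"
    using inv[OF od D1] inv[OF od D2] dd by (simp_all add: t_def algebra_simps)
  then show "C * A1 + E * A2 = 1" "A * A1 + B * A2 = 0" using t by simp_all
  define a where "a = y $ 2"
  have a: "cmod (- a) < 1" unfolding a_def using norm_snd_less_one[of y] y flat_axis_subset by auto
  define ax where "ax = axis_disc a"
  have ax: "analytic_disc ax" unfolding ax_def using a by (intro axis_disc_analytic) simp
  have ax0: "ax 0 = y" using y by (simp add: ax_def vec2_eq_iff a_def flat_axis_def)
  define s where "s = 1 - complex_of_real (cmod a)^2"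
  have s: "s \<noteq> 0"
  proof -
    have "s = of_real (1 - (cmod a)^2)" by (simp add: s_def)
    moreover have "1 - (cmod a)^2 \<noteq> 0" using a by (simp add: abs_square_eq_1)
    ultimately show ?thesis by (metis of_real_eq_0_iff)
  qed
  have axd: "velocity ax 1 = 0" "velocity ax 2 = s"
    unfolding ax_def s_def by (rule axis_disc_velocity)+
  have "(A * B1 + B * B2) * s = s"
    using inv[OF ax ax0 D2] axd by (simp add: algebra_simps)
  then show "A * B1 + B * B2 = 1" using s by simp
qed

text \<open>
  The image of the first coordinate direction under the inverse automorphism consists of
  velocities of curves in the orbit. Conversely, the automorphism takes any complex line of such velocities to a line whose
  second components satisfy a real condition; a complex multiple of a nonzero second component can
  be made a positive multiple of the position, which violates it.
\<close>
lemma sharp_eq_kernel: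
  assumes b: "cmod b < 1" and x: "x \<in> sym_bidisc" and Mx: "sym_lift b x \<in> flat_axis"
    and D2: "((\<lambda>p. sym_lift b p $ 2) has_derivative (cform A B)) (at x)"
  shows "sharp x = {v. A * v$1 + B * v$2 = 0}" "A \<noteq> 0 \<or> B \<noteq> 0"
proof -
  define y where "y = sym_lift b x"
  have yG: "y \<in> sym_bidisc" unfolding y_def by (rule sym_lift_in[OF b x])
  have xy: "sym_lift (- b) y = x" unfolding y_def by (rule sym_lift_inverse[OF b x])
  have b': "cmod (- b) < 1" using b by simp
  obtain C E where D1: "((\<lambda>p. sym_lift b p $ 1) has_derivative (cform C E)) (at x)"
    by (rule sym_lift_has_derivative[OF sym_lift_denom_nonzero[OF b x]]) (rule that)
  obtain A1 B1 A2 B2 where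
    N: "\<And>T. ((\<lambda>p. sym_lift (- b) p $ 1) has_derivative (cform A1 B1)) (at y within T)"
      "\<And>T. ((\<lambda>p. sym_lift (- b) p $ 2) has_derivative (cform A2 B2)) (at y within T)"
    and ND: "(sym_lift (- b) has_derivative (\<lambda>v. vector [A1 * v$1 + B1 * v$2, A2 * v$1 + B2 * v$2])) (at y)"
    by (rule sym_lift_has_derivative[OF sym_lift_denom_nonzero[OF b' yG]]) (rule that)
  have yF: "y \<in> flat_axis" using Mx by (simp add: y_def)
  note inv = sym_lift_derivative_inverse[OF b yF, unfolded xy, OF has_derivative_at_withinI[OF D1]
      has_derivative_at_withinI[OF D2] N(1) N(2)]
  show AB: "A \<noteq> 0 \<or> B \<noteq> 0" using inv(3) by auto
  define w where "w = (vector [A1, A2] :: complex^2)"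
  have w: "w \<noteq> 0" "A * w$1 + B * w$2 = 0" using inv(1,2) by (auto simp: w_def vec2_eq_iff)
  have ker: "{v. A * v$1 + B * v$2 = 0} = range (\<lambda>c. c *s w)" by (rule kernel_eq_line[OF AB w])
  have sub: "range (\<lambda>c. c *s w) \<subseteq> real_tangent_space (orbit_sym_bidisc x) x"
  proof (rule image_subsetI)
    fix c
    have "c *s w = vector [A1 * c, A2 * c]" by (simp add: vec2_eq_iff w_def mult.commute)
    then show "c *s w \<in> real_tangent_space (orbit_sym_bidisc x) x"
      using sym_lift_curve_tangent[OF b yF ND, of c] by (simp add: xy)
  qed
  show "sharp x = {v. A * v$1 + B * v$2 = 0}"
    unfolding sharp_def ker
  proof (rule the_equality)
    show "vec.subspace (range (\<lambda>c. c *s w)) \<and> vec.dim (range (\<lambda>c. c *s w)) = 1 \<and>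
        range (\<lambda>c. c *s w) \<subseteq> real_tangent_space (orbit_sym_bidisc x) x"
      using complex_line_iff[of "range (\<lambda>c. c *s w)"] w(1) sub by blast
    fix L :: "(complex^2) set"
    assume L: "vec.subspace L \<and> vec.dim L = 1 \<and> L \<subseteq> real_tangent_space (orbit_sym_bidisc x) x"
    then obtain u where u: "u \<noteq> 0" "L = range (\<lambda>c. c *s u)" using complex_line_iff[of L] by blast
    define \<mu> where "\<mu> = A * u$1 + B * u$2"
    have vel: "if y $ 2 = 0 then c * \<mu> = 0 else Re (cnj (y $ 2) * (c * \<mu>)) = 0" for c
    proof -
      have vR: "c *s u \<in> real_tangent_space (orbit_sym_bidisc x) x" using L u(2) by blast
      have eq: "A * (c *s u)$1 + B * (c *s u)$2 = c * \<mu>" by (simp add: \<mu>_def algebra_simps)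
      from orbit_velocity_sym_lift[OF b x Mx D1 D2 vR] show ?thesis unfolding eq y_def .
    qed
    have "\<mu> = 0"
    proof (cases "y $ 2 = 0")
      case True
      then show ?thesis using vel[of 1] by simp
    next
      case False
      have "Re (cnj (y $ 2) * (cnj (cnj (y $ 2) * \<mu>) * \<mu>)) = 0"
        using vel[of "cnj (cnj (y $ 2) * \<mu>)"] False by (simp only: if_False)
      moreover have "cnj (y $ 2) * (cnj (cnj (y $ 2) * \<mu>) * \<mu>) = of_real ((cmod (cnj (y $ 2) * \<mu>))^2)"
        by (simp only: complex_norm_square) (simp only: mult_ac)
      ultimately have "(cmod (cnj (y $ 2) * \<mu>))^2 = 0" by (simp only: Re_complex_of_real)
      then show ?thesis using False by simp
    qed
    then have "{v. A * v$1 + B * v$2 = 0} = range (\<lambda>c. c *s u)"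
      by (intro kernel_eq_line[OF AB u(1)]) (simp add: \<mu>_def)
    then show "L = range (\<lambda>c. c *s w)" using u(2) ker by simp
  qed
qed

text \<open>
  Another parametrization k of the same geodesic is h composed with a left inverse of h applied to
  k, so its velocity is a complex multiple of that of h.
\<close>
lemma complex_tangent_space_eq:
  assumes h: "analytic_disc h" and \<Phi>: "\<Phi> \<in> disc_functions" "\<And>z. cmod z < 1 \<Longrightarrow> \<Phi> (h z) = z"
  shows "complex_tangent_space (h ` unit_disc) (h 0)
    = range (\<lambda>c. c *s vector [velocity h 1, velocity h 2])"
proof (intro equalityI subsetI)
  let ?w = "vector [velocity h 1, velocity h 2] :: complex^2"
  fix v assume "v \<in> complex_tangent_space (h ` unit_disc) (h 0)"
  then obtain c k z where v: "v = c *s (\<chi> i. deriv (\<lambda>w. k w $ i) z)"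
    and k: "geodesic_param k (h ` unit_disc)" and z: "cmod z < 1" "k z = h 0"
    unfolding complex_tangent_space_def by auto
  have kd: "analytic_disc k" and kh: "k ` unit_disc = h ` unit_disc"
    using k by (simp_all add: geodesic_param_iff)
  define \<phi> where "\<phi> w = \<Phi> (k w)" for w
  have k\<phi>: "k w = h (\<phi> w)" "cmod (\<phi> w) < 1" if "cmod w < 1" for w
  proof -
    have "k w \<in> h ` unit_disc" unfolding kh[symmetric] using that by simp
    then obtain u where "cmod u < 1" "k w = h u" by auto
    then show "k w = h (\<phi> w)" "cmod (\<phi> w) < 1" by (simp_all add: \<phi>_def \<Phi>(2))
  qed
  have \<phi>z: "\<phi> z = 0" using z(2) \<Phi>(2)[of 0] by (simp add: \<phi>_def)
  have "\<phi> holomorphic_on unit_disc" unfolding \<phi>_def [abs_def] by (rule compose_disc[OF \<Phi>(1) kd])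
  then have \<phi>': "(\<phi> has_field_derivative deriv \<phi> z) (at z)"
    using z(1) by (intro holomorphic_derivI[of \<phi> unit_disc]) auto
  have ki: "deriv (\<lambda>w. k w $ i) z = deriv (\<lambda>w. h w $ i) 0 * deriv \<phi> z" for i
  proof (rule DERIV_imp_deriv)
    have "((\<lambda>w. h w $ i) has_field_derivative deriv (\<lambda>w. h w $ i) 0) (at (\<phi> z))"
      unfolding \<phi>z by (rule analytic_disc_deriv[OF h]) simp
    from DERIV_chain2[where f = "\<lambda>w. h w $ i" and g = \<phi>, OF this \<phi>']
    show "((\<lambda>w. k w $ i) has_field_derivative deriv (\<lambda>w. h w $ i) 0 * deriv \<phi> z) (at z)"
      by (rule has_field_derivative_transform_within_open[where S = unit_disc]) (use z(1) k\<phi>(1) in auto)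
  qed
  have "v = (c * deriv \<phi> z) *s ?w" by (simp add: v vec2_eq_iff ki mult_ac)
  then show "v \<in> range (\<lambda>c. c *s ?w)" by blast
next
  let ?w = "vector [velocity h 1, velocity h 2] :: complex^2"
  fix v assume "v \<in> range (\<lambda>c. c *s ?w)"
  then obtain c where "v = c *s ?w" by blast
  then have "v = c *s (\<chi> i. deriv (\<lambda>w. h w $ i) 0)" by (simp add: vec2_eq_iff)
  moreover have "geodesic_param h (h ` unit_disc)" using h \<Phi> by (auto simp: geodesic_param_iff)
  moreover have "(0::complex) \<in> unit_disc" by simp
  ultimately show "v \<in> complex_tangent_space (h ` unit_disc) (h 0)"
    unfolding complex_tangent_space_def by blast
qed

lemma geodesic_velocity_nonzero:
  assumes h: "analytic_disc h" and \<Phi>: "\<Phi> \<in> disc_functions" "\<And>z. cmod z < 1 \<Longrightarrow> \<Phi> (h z) = z"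
  shows "(vector [velocity h 1, velocity h 2] :: complex^2) \<noteq> 0"
proof
  assume 0: "(vector [velocity h 1, velocity h 2] :: complex^2) = 0"
  obtain A B where "A * velocity h 1 + B * velocity h 2 = 1"
    by (rule left_inverse_derivative[OF h \<Phi>]) (assumption, rule that)
  with 0 show False by (simp add: vec2_eq_iff)
qed

lemma tangent_sharp_iff:
  assumes h: "analytic_disc h" and \<Phi>: "\<Phi> \<in> disc_functions" "\<And>z. cmod z < 1 \<Longrightarrow> \<Phi> (h z) = z"
    and b: "cmod b < 1" and axis: "sym_lift b (h 0) \<in> flat_axis"
  shows "complex_tangent_space (h ` unit_disc) (h 0) = sharp (h 0)
    \<longleftrightarrow> deriv (\<lambda>z. sym_lift b (h z) $ 2) 0 = 0"
proof -
  let ?w = "vector [velocity h 1, velocity h 2] :: complex^2"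
  have x: "h 0 \<in> sym_bidisc" by (rule analytic_disc_in[OF h]) simp
  obtain A B where D2: "\<And>T. ((\<lambda>p. sym_lift b p $ 2) has_derivative (cform A B)) (at (h 0) within T)"
    by (rule sym_lift_has_derivative[OF sym_lift_denom_nonzero[OF b x]]) (rule that)
  note sharp = sharp_eq_kernel[OF b x axis D2]
  have d: "deriv (\<lambda>z. sym_lift b (h z) $ 2) 0 = A * ?w$1 + B * ?w$2"
    using DERIV_imp_deriv[OF compose_disc_derivative[where f = "\<lambda>p. sym_lift b p $ 2", OF D2 h]] by simp
  have T: "complex_tangent_space (h ` unit_disc) (h 0) = range (\<lambda>c. c *s ?w)"
    by (rule complex_tangent_space_eq[OF h \<Phi>])
  show ?thesis
  proof
    assume "complex_tangent_space (h ` unit_disc) (h 0) = sharp (h 0)"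
    then have "range (\<lambda>c. c *s ?w) = {v. A * v$1 + B * v$2 = 0}"
      by (simp only: T sharp(1))
    moreover have "?w \<in> range (\<lambda>c. c *s ?w)" by (rule image_eqI[of _ _ 1]) simp_all
    ultimately have "?w \<in> {v. A * v$1 + B * v$2 = 0}" by simp
    then show "deriv (\<lambda>z. sym_lift b (h z) $ 2) 0 = 0" unfolding d by simp
  next
    assume "deriv (\<lambda>z. sym_lift b (h z) $ 2) 0 = 0"
    then have "A * ?w$1 + B * ?w$2 = 0" unfolding d .
    moreover have "?w \<noteq> 0" by (rule geodesic_velocity_nonzero[OF h \<Phi>])
    ultimately show "complex_tangent_space (h ` unit_disc) (h 0) = sharp (h 0)"
      unfolding T sharp(1) using kernel_eq_line[OF sharp(2), of ?w] by simp
  qed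
qed

section \<open>Orthogonal geodesics and nearest points\<close>

theorem theorem1p3:
  fixes F D :: "(complex^2) set"
  assumes "flat_geodesic F" and "geodesic D"
  shows
    "(orthogonal_geodesic D F \<longleftrightarrow>
        (\<exists>x\<^sub>0\<in>D \<inter> F. \<exists>y\<in>D - {x\<^sub>0}. cara_dist x\<^sub>0 y = (INF x\<in>F. cara_dist x y))) \<and>
     ((\<exists>x\<^sub>0\<in>D \<inter> F. \<exists>y\<in>D - {x\<^sub>0}. cara_dist x\<^sub>0 y = (INF x\<in>F. cara_dist x y)) \<longleftrightarrow>
        (\<exists>x\<^sub>0\<in>D \<inter> F. \<forall>y\<in>D - {x\<^sub>0}. cara_dist x\<^sub>0 y = (INF x\<in>F. cara_dist x y)))"
proof -
  obtain b where b: "cmod b < 1" and F: "sym_lift b ` F = flat_axis"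
    using flat_geodesic_normal_form[OF assms(1)] .
  have "geodesic F" using assms(1) by (simp add: flat_geodesic_def)
  then have FG: "F \<subseteq> sym_bidisc" by (auto simp: geodesic_def geodesic_param_def)
  note M = aut_pair_sym_lift[OF b]
  have INF_F: "(INF x\<in>F. cara_dist x y) = (INF x\<in>flat_axis. cara_dist x (sym_lift b y))"
    if y: "y \<in> sym_bidisc" for y
  proof -
    have "(\<lambda>x. cara_dist x (sym_lift b y)) ` flat_axis = (\<lambda>x. cara_dist (sym_lift b x) (sym_lift b y)) ` F"
      unfolding F[symmetric] image_image ..
    also have "\<dots> = (\<lambda>x. cara_dist x y) ` F"
      using cara_dist_aut[OF M _ y] FG by (intro image_cong) auto
    finally show ?thesis by simp
  qed
  \<comment> \<open>All three conditions ask for a common point, so they are compared at one such point x at a time.\<close>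
  have local: "(complex_tangent_space D x = sharp x \<longrightarrow>
        (\<forall>y\<in>D - {x}. cara_dist x y = (INF x\<in>F. cara_dist x y))) \<and>
      (\<forall>y\<in>D - {x}. cara_dist x y = (INF x\<in>F. cara_dist x y) \<longrightarrow> complex_tangent_space D x = sharp x) \<and>
      D - {x} \<noteq> {}" if x: "x \<in> D \<inter> F" for x
  proof -
    obtain h \<Phi> where h: "analytic_disc h" and \<Phi>: "\<Phi> \<in> disc_functions" "\<And>z. cmod z < 1 \<Longrightarrow> \<Phi> (h z) = z"
      and D: "D = h ` unit_disc" and hx: "h 0 = x"
      using x by (auto intro: geodesic_through[OF assms(2)])
    define g where "g z = sym_lift b (h z)" for z
    have g: "analytic_disc g" unfolding g_def [abs_def] by (rule analytic_disc_compose[OF h M])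
    define \<Psi> where "\<Psi> p = \<Phi> (sym_lift (- b) p)" for p
    have \<Psi>: "\<Psi> \<in> disc_functions" unfolding \<Psi>_def [abs_def]
      by (rule disc_functions_compose[OF \<Phi>(1) aut_pair_commute[OF M]])
    have \<Psi>g: "\<Psi> (g z) = z" if "cmod z < 1" for z
      using sym_lift_inverse[OF b analytic_disc_in[OF h that]] \<Phi>(2)[OF that] by (simp add: \<Psi>_def g_def)
    have axis: "g 0 \<in> flat_axis" unfolding g_def hx F[symmetric] using x by blast
    have tangent: "complex_tangent_space D x = sharp x \<longleftrightarrow> velocity g 2 = 0"
      using tangent_sharp_iff[OF h \<Phi> b] axis unfolding D hx[symmetric] g_def by simp
    have hG: "h z \<in> sym_bidisc" if "cmod z < 1" for z by (rule analytic_disc_in[OF h that])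
    have dist: "cara_dist x (h z) = (INF x\<in>F. cara_dist x (h z))
        \<longleftrightarrow> cara_dist (g 0) (g z) = (INF x\<in>flat_axis. cara_dist x (g z))" if "cmod z < 1" for z
      using INF_F[OF hG[OF that]] cara_dist_aut[OF M hG[of 0] hG[OF that]] by (simp add: g_def hx)
    have nonzero: "z \<noteq> 0" if "h z \<in> D - {x}" for z using that hx by auto
    show ?thesis
    proof (intro conjI impI ballI)
      fix y assume T: "complex_tangent_space D x = sharp x" and "y \<in> D - {x}"
      then obtain z where z: "cmod z < 1" "y = h z" unfolding D by auto
      show "cara_dist x y = (INF x\<in>F. cara_dist x y)"
        unfolding z(2) dist[OF z(1)]
        by (rule orthogonal_imp_nearest[OF g \<Psi> \<Psi>g axis _ z(1)]) (use T tangent in blast)+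
    next
      fix y assume y: "y \<in> D - {x}" and near: "cara_dist x y = (INF x\<in>F. cara_dist x y)"
      then obtain z where z: "cmod z < 1" "y = h z" unfolding D by auto
      have "z \<noteq> 0" using nonzero y z(2) by blast
      have "cara_dist (g 0) (g z) = (INF x\<in>flat_axis. cara_dist x (g z))"
        using near unfolding z(2) dist[OF z(1)] .
      from nearest_imp_orthogonal[OF g \<Psi> \<Psi>g axis z(1) \<open>z \<noteq> 0\<close> this]
      show "complex_tangent_space D x = sharp x" unfolding tangent .
    next
      have half: "\<Phi> (h (1/2)) = 1/2" and zero: "\<Phi> (h 0) = 0" by (rule \<Phi>(2), simp)+
      have "\<Phi> (h (1/2)) \<noteq> \<Phi> (h 0)" unfolding half zero by simp
      then have "h (1/2) \<noteq> x" using hx by auto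
      moreover have "h (1/2) \<in> D" unfolding D by (intro imageI) simp
      ultimately show "D - {x} \<noteq> {}" by blast
    qed
  qed
  show ?thesis unfolding orthogonal_geodesic_def using local by (meson ex_in_conv)
qed

end
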